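(* Let $0<\varepsilon<1/3$. Assume the Strong $k$SUM Conjecture (for all constant $k\ge3$). Then for every $\delta>0$ there is no algorithm that, given two straight-line programs each of size $n=\Theta(N^{\varepsilon})$ generating two $N$-dimensional vectors $u,v$, computes their inner product $u\cdot v$ in time $O(N^{1/3-\delta})$.
   Context: A straight-line program (SLP), or grammar compression, over an alphabet $\Sigma$ is a sequence of rules $S_1,\dots,S_n$, each either $S_i\to\sigma$ with $\sigma\in\Sigma$ or $S_i\to S_jS_k$ with $j,k<i$; it generates the string of its last rule and its size is $n$. Vectors are identified with the strings of their entries. The $k$SUM problem: given $k$ sets $A_1,\dots,A_k$ of $m$ integers in $\{1,\dots,U\}$, decide whether there are $a_1\in A_1,\dots,a_k\in A_k$ with $a_1+\cdots+a_{k-1}=a_k$. The Strong $k$SUM Conjecture: for every constant $k\ge3$, no algorithm (deterministic or randomized, succeeding with high probability) solves the $k$SUM problem with $U=O(m^{\lceil k/2\rceil})$ in time $O(m^{\lceil k/2\rceil-\varepsilon'})$ for any $\varepsilon'>0$. *)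

theory Defs
  imports "HOL-Probability.Probability"
begin

section \<open>Straight-line programs\<close>

datatype 'a rule = Term 'a | Cat nat nat

type_synonym 'a slp = "'a rule list"

text \<open>Rules are numbered from 0; a rule may only refer to earlier rules.\<close>

definition slp :: "'a set \<Rightarrow> 'a slp \<Rightarrow> bool" where
  "slp \<Sigma> S \<longleftrightarrow> S \<noteq> [] \<and>
     (\<forall>i<length S. case S ! i of Term \<sigma> \<Rightarrow> \<sigma> \<in> \<Sigma> | Cat j k \<Rightarrow> j < i \<and> k < i)"

text \<open>The list of the strings generated by the individual rules, in order.\<close>

definition slp_strings :: "'a slp \<Rightarrow> 'a list list" where
  "slp_strings S =
     foldl (\<lambda>ws r. ws @ [case r of Term \<sigma> \<Rightarrow> [\<sigma>] | Cat j k \<Rightarrow> ws ! j @ ws ! k]) [] S"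

definition slp_string :: "'a slp \<Rightarrow> 'a list" where
  "slp_string S = last (slp_strings S)"

definition inner_prod :: "int list \<Rightarrow> int list \<Rightarrow> int" where
  "inner_prod u v = (\<Sum>i<length u. u ! i * v ! i)"


section \<open>A randomized word RAM\<close>

text \<open>
  Algorithms are structured programs for a unit-cost word RAM. A program uses finitely many
  word variables and finitely many random-access arrays. (A constant number of arrays can be
  interleaved in a single memory with constant overhead, and structured control flow costs a
  constant factor over jumps.) Words are signed integers with \<open>w\<close> bits besides the sign bit, and
  every operation wraps around. The expressions of a fixed program have constant size, so
  executing an elementary command counts as one step.
\<close>

datatype binop = Plus | Minus | Times | Divide | Modulo
  | BitAnd | BitOr | BitXor | ShiftL | ShiftR | Less | Equal

datatype exp = Const int | Var nat | Cell nat exp | Op binop exp exp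

datatype com =
    Skip
  | Assign nat exp
  | Store nat exp exp
  | Flip nat
  | Seq com com
  | If exp com com
  | While exp com

record state =
  vars :: "nat \<Rightarrow> int"
  arrs :: "nat \<Rightarrow> int \<Rightarrow> int"

abbreviation wrap :: "nat \<Rightarrow> int \<Rightarrow> int" where
  "wrap w \<equiv> signed_take_bit w"

fun binop_val :: "binop \<Rightarrow> int \<Rightarrow> int \<Rightarrow> int" where
  "binop_val Plus x y = x + y"
| "binop_val Minus x y = x - y"
| "binop_val Times x y = x * y"
| "binop_val Divide x y = x div y"
| "binop_val Modulo x y = x mod y"
| "binop_val BitAnd x y = semiring_bit_operations_class.and x y"
| "binop_val BitOr x y = semiring_bit_operations_class.or x y"
| "binop_val BitXor x y = semiring_bit_operations_class.xor x y"
| "binop_val ShiftL x y = push_bit (nat y) x"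
| "binop_val ShiftR x y = drop_bit (nat y) x"
| "binop_val Less x y = of_bool (x < y)"
| "binop_val Equal x y = of_bool (x = y)"

primrec exp_val :: "nat \<Rightarrow> state \<Rightarrow> exp \<Rightarrow> int" where
  "exp_val w s (Const z) = wrap w z"
| "exp_val w s (Var x) = vars s x"
| "exp_val w s (Cell a e) = arrs s a (exp_val w s e)"
| "exp_val w s (Op f e1 e2) = wrap w (binop_val f (exp_val w s e1) (exp_val w s e2))"

definition set_var :: "nat \<Rightarrow> int \<Rightarrow> state \<Rightarrow> state" where
  "set_var x z s = s\<lparr>vars := (vars s)(x := z)\<rparr>"

definition set_cell :: "nat \<Rightarrow> int \<Rightarrow> int \<Rightarrow> state \<Rightarrow> state" where
  "set_cell a i z s = s\<lparr>arrs := (arrs s)(a := (arrs s a)(i := z))\<rparr>"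

text \<open>One step of a program; a program has halted when it has become \<open>Skip\<close>.\<close>

primrec step :: "nat \<Rightarrow> com \<Rightarrow> state \<Rightarrow> (com \<times> state) pmf" where
  "step w Skip s = return_pmf (Skip, s)"
| "step w (Assign x e) s = return_pmf (Skip, set_var x (exp_val w s e) s)"
| "step w (Store a e1 e2) s =
     return_pmf (Skip, set_cell a (exp_val w s e1) (exp_val w s e2) s)"
| "step w (Flip x) s =
     map_pmf (\<lambda>b. (Skip, set_var x (wrap w (of_bool b)) s)) (bernoulli_pmf (1 / 2))"
| "step w (Seq p q) s =
     (if p = Skip then return_pmf (q, s)
      else map_pmf (\<lambda>(p', s'). (Seq p' q, s')) (step w p s))"
| "step w (If e p q) s = return_pmf (if exp_val w s e \<noteq> 0 then p else q, s)"
| "step w (While e p) s =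
     return_pmf (if exp_val w s e \<noteq> 0 then Seq p (While e p) else Skip, s)"

primrec run :: "nat \<Rightarrow> nat \<Rightarrow> com \<times> state \<Rightarrow> (com \<times> state) pmf" where
  "run w 0 cfg = return_pmf cfg"
| "run w (Suc t) cfg = bind_pmf (step w (fst cfg) (snd cfg)) (run w t)"

text \<open>The input is stored in array 0; everything else is initially zero.\<close>

definition init_state :: "nat \<Rightarrow> int list \<Rightarrow> state" where
  "init_state w inp =
     \<lparr>vars = (\<lambda>_. 0),
      arrs = (\<lambda>a i. if a = 0 \<and> 0 \<le> i \<and> i < int (length inp) then wrap w (inp ! nat i) else 0)\<rparr>"

text \<open>
  The probability that the program has halted within \<open>t\<close> steps with output \<open>z\<close> in variable 0.
  It is 0 or 1 for programs without \<open>Flip\<close>.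
\<close>

definition output_prob :: "nat \<Rightarrow> com \<Rightarrow> int list \<Rightarrow> nat \<Rightarrow> int \<Rightarrow> real" where
  "output_prob w P inp t z =
     measure_pmf.prob (run w t (P, init_state w inp)) {(p, s). p = Skip \<and> vars s 0 = z}"

text \<open>
  Conventions for the two problems below. The running time is at most \<open>C\<close> times the stated bound.
  ``With high probability'' means with probability at least \<open>1 - x powr (-\<gamma>)\<close> for a constant
  \<open>\<gamma> > 0\<close>, where \<open>x\<close> is the size parameter; deterministic algorithms are included as those
  with success probability 1. The word size is logarithmic: an algorithm comes with a constant \<open>c\<close>
  and has to work, within the same time bound, for every word size that is at least \<open>c\<close> times
  the logarithm of the instance parameters. In particular it cannot profit from large words.
\<close>


section \<open>kSUM\<close>

text \<open>The sets are given as lists of their elements, in arbitrary order.\<close>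

definition ksum_instance :: "nat \<Rightarrow> nat \<Rightarrow> nat \<Rightarrow> int list list \<Rightarrow> bool" where
  "ksum_instance k m U As \<longleftrightarrow> length As = k \<and>
     (\<forall>A \<in> set As. distinct A \<and> length A = m \<and> set A \<subseteq> {1..int U})"

definition ksum_solvable :: "nat \<Rightarrow> int list list \<Rightarrow> bool" where
  "ksum_solvable k As \<longleftrightarrow>
     (\<exists>a :: nat \<Rightarrow> int. (\<forall>i<k. a i \<in> set (As ! i)) \<and> (\<Sum>i<k - 1. a i) = a (k - 1))"

definition ksum_input :: "nat \<Rightarrow> nat \<Rightarrow> int list list \<Rightarrow> int list" where
  "ksum_input m U As = [int m, int U] @ concat As"

text \<open>
  \<open>P\<close> solves kSUM with \<open>U = O(m powr \<lceil>k/2\<rceil>)\<close> in time \<open>O(m powr \<tau>)\<close>. The constant of the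
  running time may depend on the constant \<open>K\<close> of the bound on \<open>U\<close>.
\<close>

definition solves_ksum :: "com \<Rightarrow> nat \<Rightarrow> real \<Rightarrow> bool" where
  "solves_ksum P k \<tau> \<longleftrightarrow>
     (\<exists>c. \<exists>\<gamma>>0. \<forall>K. \<exists>C. \<forall>m U As w.
        m \<ge> 1 \<longrightarrow>
        real U \<le> K * real m powr real_of_int \<lceil>real k / 2\<rceil> \<longrightarrow>
        ksum_instance k m U As \<longrightarrow>
        real w \<ge> c * log 2 (real (m + U)) \<longrightarrow>
        output_prob w P (ksum_input m U As) (nat \<lfloor>C * real m powr \<tau>\<rfloor>)
            (of_bool (ksum_solvable k As))
          \<ge> 1 - real m powr (- \<gamma>))"

definition strong_ksum_conjecture :: bool where
  "strong_ksum_conjecture \<longleftrightarrow>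
     (\<forall>k\<ge>3. \<forall>\<epsilon>'>0. \<not> (\<exists>P. solves_ksum P k (real_of_int \<lceil>real k / 2\<rceil> - \<epsilon>')))"


section \<open>Inner product of grammar-compressed vectors\<close>

fun rule_input :: "int rule \<Rightarrow> int list" where
  "rule_input (Term \<sigma>) = [0, \<sigma>, 0]"
| "rule_input (Cat j k) = [1, int j, int k]"

definition slp_pair_input :: "int slp \<Rightarrow> int slp \<Rightarrow> int list" where
  "slp_pair_input S T =
     [int (length S), int (length T)] @ concat (map rule_input S) @ concat (map rule_input T)"

text \<open>
  \<open>P\<close> computes, in time \<open>O(N powr \<tau>)\<close>, the inner product of two \<open>N\<close>-dimensional vectors over
  \<open>\<Sigma>\<close> from SLPs of equal size \<open>n\<close> with \<open>\<alpha> * N powr \<epsilon> \<le> n \<le> \<beta> * N powr \<epsilon>\<close>.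
  Nothing is required on inputs outside this class.
\<close>

definition solves_slp_inner_prod ::
    "com \<Rightarrow> int set \<Rightarrow> real \<Rightarrow> real \<Rightarrow> real \<Rightarrow> real \<Rightarrow> bool" where
  "solves_slp_inner_prod P \<Sigma> \<alpha> \<beta> \<epsilon> \<tau> \<longleftrightarrow>
     (\<exists>c. \<exists>\<gamma>>0. \<exists>C. \<forall>N n S T w.
        slp \<Sigma> S \<longrightarrow> slp \<Sigma> T \<longrightarrow>
        length S = n \<longrightarrow> length T = n \<longrightarrow>
        length (slp_string S) = N \<longrightarrow> length (slp_string T) = N \<longrightarrow>
        \<alpha> * real N powr \<epsilon> \<le> real n \<longrightarrow> real n \<le> \<beta> * real N powr \<epsilon> \<longrightarrow>
        real w \<ge> c * log 2 (real N + 1) \<longrightarrow>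
        output_prob w P (slp_pair_input S T) (nat \<lfloor>C * real N powr \<tau>\<rfloor>)
            (inner_prod (slp_string S) (slp_string T))
          \<ge> 1 - real N powr (- \<gamma>))"

end

theory Submission
  imports Defs "HOL-Real_Asymp.Real_Asymp"
begin

text \<open>
  Let \<open>k = 2 * r\<close>. For a kSUM instance consider the string \<open>u\<close> with one block for each \<open>k\<close>-tuple of elements,
  containing a single one at the sum of the first \<open>k - 1\<close> elements, and the string \<open>v\<close> with the same blocks,
  but the one at the \<open>k\<close>-th element. Then \<open>u\<close> and \<open>v\<close> have a common one iff the instance is solvable. They
  have length \<open>N = \<Theta>(m ^ k * U)\<close>, which is \<open>O(m ^ (3 * r))\<close>, but straight-line programs of size
  \<open>O(k * m * log U)\<close>, because running through the elements of one set only shifts the string of the previous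
  sets. So an algorithm for inner products in time \<open>N powr (1 / 3 - \<delta>)\<close> yields one for kSUM in time
  \<open>m powr (r - 3 * r * \<delta>)\<close>.

  The straight-line programs must be padded to size \<open>\<Theta>(N powr \<epsilon>)\<close>, but \<open>\<epsilon>\<close> need not be computable. The
  reduction therefore tries all powers of two as sizes \<open>n\<close>. For a wrong \<open>n\<close> the given algorithm may answer
  anything, run forever and leave its memory in disorder. To cope with this, the reduction uses a clocked
  version of the algorithm that records the cells it writes to, asks it for a solution (element by element)
  and accepts only if the answer is a solution. If \<open>r\<close> is large with respect to \<open>\<delta>\<close>, \<open>\<epsilon>\<close> and the error
  exponent, then the polynomially many calls are affordable and with high probability all correct for the
  right \<open>n\<close>.
\<close>

section \<open>Expected outcomes of bounded runs\<close>

text \<open>The exponent 1/3 is the quotient of the kSUM exponent r, for k = 2r, and the exponent 3r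
  of the length. The bound \<epsilon> < 1/3 makes the right size, of order N^\<epsilon>, at most the
  time budget, which is also the largest size tried.

  A bare yes or no obtained with a wrong size could not be told from a correct answer, whereas a
  tuple can be checked. Hence an unsolvable instance is never accepted, whatever the calls return,
  and the union bound only has to cover the k * m calls made for one size instead of all calls.

  In \<open>solves_ksum\<close> the constant K of the bound on U comes after the program. The budget
  is therefore computed from U itself, and K enters only the constant of the running time. Dividing
  by m^4 in the budget pays for the O(m^2) calls, k * m for each of O(m) sizes (a crude bound on a
  logarithm): the total is O(m^(r - 2)), below the m^(r - 1) that contradicts the
  conjecture.\<close>

lemma finite_step: "finite (set_pmf (step w c s))"
  by (induction c) auto

text \<open>
  The expectation of \<open>f\<close> at the halting time, counting 0 if the program is still running after \<open>t\<close>
  steps. The first argument of \<open>f\<close> is the number of steps that are left; since it is part of the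
  outcome, sequential composition becomes an equation.
\<close>

primrec ewp :: "nat \<Rightarrow> nat \<Rightarrow> com \<Rightarrow> state \<Rightarrow> (nat \<Rightarrow> state \<Rightarrow> real) \<Rightarrow> real" where
  "ewp w 0 c s f = (if c = Skip then f 0 s else 0)"
| "ewp w (Suc t) c s f =
     (if c = Skip then f (Suc t) s
      else measure_pmf.expectation (step w c s) (\<lambda>(c', s'). ewp w t c' s' f))"

lemma ewp_Skip [simp]: "ewp w t Skip s f = f t s"
  by (cases t) auto

lemma ewp_Assign [simp]: "ewp w (Suc t) (Assign x e) s f = f t (set_var x (exp_val w s e) s)"
  by simp

lemma ewp_Store [simp]:
  "ewp w (Suc t) (Store a e1 e2) s f = f t (set_cell a (exp_val w s e1) (exp_val w s e2) s)"
  by simp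

lemma ewp_Flip [simp]:
  "ewp w (Suc t) (Flip x) s f =
     (f t (set_var x (wrap w 1) s) + f t (set_var x (wrap w 0) s)) / 2"
  by simp

lemma ewp_If [simp]:
  "ewp w (Suc t) (If e p q) s f = ewp w t (if exp_val w s e \<noteq> 0 then p else q) s f"
  by simp

lemma ewp_While [simp]:
  "ewp w (Suc t) (While e p) s f =
     (if exp_val w s e \<noteq> 0 then ewp w t (Seq p (While e p)) s f else f t s)"
  by simp

text \<open>Leaving the finished \<open>p\<close> costs one step, hence the passage from
  \<open>Suc u\<close> to \<open>u\<close>; with no step left the composition counts as still
  running.\<close>

lemma ewp_Seq:
  "ewp w t (Seq p q) s f =
     ewp w t p s (\<lambda>t' s'. case t' of 0 \<Rightarrow> 0 | Suc u \<Rightarrow> ewp w u q s' f)"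
proof (induction t arbitrary: p s)
  case 0
  then show ?case by simp
next
  case (Suc t)
  show ?case
  proof (cases "p = Skip")
    case False
    then have "ewp w (Suc t) (Seq p q) s f =
        measure_pmf.expectation (step w p s) (\<lambda>(p', s'). ewp w t (Seq p' q) s' f)"
      by (simp add: case_prod_unfold)
    also have "\<dots> = measure_pmf.expectation (step w p s)
        (\<lambda>(p', s'). ewp w t p' s' (\<lambda>t' s'. case t' of 0 \<Rightarrow> 0 | Suc u \<Rightarrow> ewp w u q s' f))"
      by (simp only: Suc.IH)
    finally show ?thesis using False by simp
  qed simp
qed

declare ewp.simps(2) [simp del]

lemma ewp_mono:
  assumes "\<And>t' s'. t' \<le> t \<Longrightarrow> f t' s' \<le> g t' s'"
  shows "ewp w t c s f \<le> ewp w t c s g"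
  using assms
proof (induction t arbitrary: c s)
  case (Suc t)
  have "ewp w t c s f \<le> ewp w t c s g" for c s
    using Suc by simp
  then show ?case
    using Suc.prems
    by (auto simp: ewp.simps(2) intro!: integral_mono integrable_measure_pmf_finite finite_step)
qed auto

lemma ewp_add: "ewp w t c s (\<lambda>t s. f t s + g t s) = ewp w t c s f + ewp w t c s g"
proof (induction t arbitrary: c s)
  case (Suc t)
  then show ?case
    by (auto simp: ewp.simps(2) case_prod_unfold
        intro!: Bochner_Integration.integral_add integrable_measure_pmf_finite finite_step)
qed auto

lemma ewp_cmult: "ewp w t c s (\<lambda>t s. a * f t s) = a * ewp w t c s f"
proof (induction t arbitrary: c s)
  case (Suc t)
  then show ?case
    by (auto simp: ewp.simps(2) case_prod_unfold)
qed auto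

lemma ewp_const_le: "0 \<le> a \<Longrightarrow> ewp w t c s (\<lambda>_ _. a) \<le> a"
proof (induction t arbitrary: c s)
  case (Suc t)
  have "measure_pmf.expectation (step w c s) (\<lambda>cf. ewp w t (fst cf) (snd cf) (\<lambda>_ _. a))
      \<le> measure_pmf.expectation (step w c s) (\<lambda>_. a)"
    using Suc by (intro integral_mono integrable_measure_pmf_finite finite_step) auto
  then show ?case
    by (auto simp: ewp.simps(2) case_prod_unfold)
qed auto

lemma ewp_nonneg: "(\<And>t s. 0 \<le> f t s) \<Longrightarrow> 0 \<le> ewp w t c s f"
  using ewp_mono[of t "\<lambda>_ _. 0" f w c s] ewp_cmult[of w t c s 0 "\<lambda>_ _. 0"] by simp

text \<open>Only the halting part of the distribution is charged with \<open>a\<close>, so the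
  expectation drops by at most \<open>a\<close>.\<close>

lemma ewp_diff_const: "0 \<le> a \<Longrightarrow> ewp w t c s f - a \<le> ewp w t c s (\<lambda>t s. f t s - a)"
  using ewp_add[of w t c s f "\<lambda>_ _. (-1) * a"] ewp_cmult[of w t c s "-1" "\<lambda>_ _. a"]
    ewp_const_le[of a w t c s]
  by simp

lemma run_Skip [simp]: "run w t (Skip, s) = return_pmf (Skip, s)"
  by (induction t) (auto simp: bind_return_pmf)

lemma prob_bind_pmf:
  "measure_pmf.prob (bind_pmf M f) A =
     measure_pmf.expectation M (\<lambda>x. measure_pmf.prob (f x) A)"
  unfolding bind_pmf.rep_eq o_def id_apply
  by (rule measure_pmf.measure_bind[where N = "count_space UNIV"]) (auto simp: measure_subprob)

lemma ewp_eq_prob: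
  "ewp w t c s (\<lambda>_ s'. of_bool (Q s')) =
     measure_pmf.prob (run w t (c, s)) {(p, s'). p = Skip \<and> Q s'}"
proof (induction t arbitrary: c s)
  case 0
  show ?case by (simp add: measure_return_pmf indicator_def)
next
  case (Suc t)
  show ?case
  proof (cases "c = Skip")
    case True
    then show ?thesis by (simp del: run.simps add: indicator_def)
  next
    case False
    have "ewp w (Suc t) c s (\<lambda>_ s'. of_bool (Q s')) =
      measure_pmf.expectation (step w c s)
        (\<lambda>cf. measure_pmf.prob (run w t cf) {(p, s'). p = Skip \<and> Q s'})"
      using False
      by (auto simp only: ewp.simps(2) if_False Suc.IH intro!: Bochner_Integration.integral_cong)
    also have "\<dots> = measure_pmf.prob (run w (Suc t) (c, s)) {(p, s'). p = Skip \<and> Q s'}"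
      by (simp only: prob_bind_pmf run.simps fst_conv snd_conv)
    finally show ?thesis .
  qed
qed

text \<open>Runs that have not halted after \<open>t\<close> steps count 0 and can only gain. For
  the others the outcome is unchanged because \<open>f\<close> ignores the steps that are
  left.\<close>

lemma ewp_mono_time:
  assumes "\<And>t' s'. f t' s' = g s'" and "\<And>s'. 0 \<le> g s'" and "t \<le> t'"
  shows "ewp w t c s f \<le> ewp w t' c s f"
  using assms(3)
proof (induction t arbitrary: c s t')
  case 0
  show ?case
    using assms by (auto intro: ewp_nonneg)
next
  case (Suc t)
  then obtain u where u: "t' = Suc u" "t \<le> u" by (cases t') auto
  show ?case
    using Suc.IH[OF u(2)] assms unfolding u(1)
    by (auto simp: ewp.simps(2) intro!: integral_mono integrable_measure_pmf_finite finite_step)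
qed

text \<open>Except with probability \<open>e\<close>, the program halts within \<open>t\<close> steps in a state satisfying \<open>Q\<close>.\<close>

definition runs :: "nat \<Rightarrow> nat \<Rightarrow> real \<Rightarrow> com \<Rightarrow> state \<Rightarrow> (state \<Rightarrow> bool) \<Rightarrow> bool" where
  "runs w t e c s Q \<longleftrightarrow>
     (\<forall>u. 1 - e \<le> ewp w (t + u) c s (\<lambda>u' s'. of_bool (u \<le> u' \<and> Q s')))"

lemma runsI:
  "(\<And>u. 1 - e \<le> ewp w (t + u) c s (\<lambda>u' s'. of_bool (u \<le> u' \<and> Q s'))) \<Longrightarrow> runs w t e c s Q"
  by (simp add: runs_def)

lemma runs_weaken:
  assumes "runs w t e c s Q" and "t \<le> t'" and "e \<le> e'" and "\<And>s'. Q s' \<Longrightarrow> Q' s'"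
  shows "runs w t' e' c s Q'"
proof (rule runsI)
  fix u
  have "1 - e' \<le> 1 - e" using assms by simp
  also have "\<dots> \<le> ewp w (t + (t' - t + u)) c s (\<lambda>u' s'. of_bool (t' - t + u \<le> u' \<and> Q s'))"
    using assms(1) unfolding runs_def by blast
  also have "\<dots> \<le> ewp w (t + (t' - t + u)) c s (\<lambda>u' s'. of_bool (u \<le> u' \<and> Q' s'))"
    by (rule ewp_mono) (use assms(4) in auto)
  finally show "1 - e' \<le> ewp w (t' + u) c s (\<lambda>u' s'. of_bool (u \<le> u' \<and> Q' s'))"
    using assms(2) by simp
qed

text \<open>A union bound over the two failure events. The surplus \<open>u\<close> in
  \<open>runs\<close> is what makes this compose: \<open>p\<close> is run with the time of
  \<open>q\<close> as part of its surplus. The extra step removes the finished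
  \<open>p\<close>.\<close>

lemma runs_Seq:
  assumes p: "runs w t1 e1 p s R"
    and q: "\<And>s'. R s' \<Longrightarrow> runs w t2 e2 q s' Q" and e2: "0 \<le> e2"
  shows "runs w (t1 + t2 + 1) (e1 + e2) (Seq p q) s Q"
proof (rule runsI)
  fix u
  let ?g = "\<lambda>u' s'. case u' of 0 \<Rightarrow> 0
      | Suc v \<Rightarrow> ewp w v q s' (\<lambda>u' s'. of_bool (u \<le> u' \<and> Q s'))"
  let ?f = "\<lambda>u' s'. of_bool (t2 + 1 + u \<le> u' \<and> R s') :: real"
  have "1 - e1 - e2 \<le> ewp w (t1 + (t2 + 1 + u)) p s ?f - e2"
    using p unfolding runs_def by (metis diff_right_mono)
  also have "\<dots> \<le> ewp w (t1 + (t2 + 1 + u)) p s (\<lambda>u' s'. ?f u' s' - e2)"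
    by (rule ewp_diff_const[OF e2])
  also have "\<dots> \<le> ewp w (t1 + (t2 + 1 + u)) p s ?g"
  proof (rule ewp_mono)
    fix u' s'
    show "?f u' s' - e2 \<le> ?g u' s'"
    proof (cases "t2 + 1 + u \<le> u' \<and> R s'")
      case True
      then obtain v where v: "u' = Suc v" "t2 + u \<le> v"
        by (cases u') auto
      have "1 - e2 \<le> ewp w (t2 + (v - t2)) q s' (\<lambda>u' s'. of_bool (v - t2 \<le> u' \<and> Q s'))"
        using q True unfolding runs_def by blast
      also have "\<dots> \<le> ewp w (t2 + (v - t2)) q s' (\<lambda>u' s'. of_bool (u \<le> u' \<and> Q s'))"
        by (rule ewp_mono) (use v in auto)
      finally show ?thesis using v True by simp
    next
      case False
      then have "?f u' s' = 0" by (simp only: of_bool_def if_False)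
      moreover have "0 \<le> ?g u' s'"
        by (cases u') (auto intro: ewp_nonneg)
      ultimately show ?thesis using e2 by linarith
    qed
  qed
  also have "\<dots> = ewp w (t1 + t2 + 1 + u) (Seq p q) s (\<lambda>u' s'. of_bool (u \<le> u' \<and> Q s'))"
    by (simp only: ewp_Seq add.assoc)
  finally show "1 - (e1 + e2) \<le> ewp w (t1 + t2 + 1 + u) (Seq p q) s
      (\<lambda>u' s'. of_bool (u \<le> u' \<and> Q s'))" by simp
qed

lemma runs_If:
  assumes "runs w t e (if exp_val w s b \<noteq> 0 then p else q) s Q"
  shows "runs w (Suc t) e (If b p q) s Q"
  using assms unfolding runs_def by (simp split: if_splits)

lemma runs_While_step:
  assumes "exp_val w s b \<noteq> 0" and "runs w t e (Seq p (While b p)) s Q"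
  shows "runs w (Suc t) e (While b p) s Q"
  using assms unfolding runs_def by simp

lemma runs_While_done:
  assumes "exp_val w s b = 0" and "Q s"
  shows "runs w 1 0 (While b p) s Q"
  using assms unfolding runs_def by simp

text \<open>An iteration costs two steps beyond its body, for the guard and for removing the
  finished body; the final 1 is the failing guard. The error depends on the index so that it can be
  charged to a single round.\<close>

lemma runs_While:
  assumes "I i s" and "i \<le> n"
    and step: "\<And>j s. j < n \<Longrightarrow> i \<le> j \<Longrightarrow> I j s \<Longrightarrow>
       exp_val w s b \<noteq> 0 \<and> runs w t (e j) p s (I (Suc j))"
    and last: "\<And>s. I n s \<Longrightarrow> exp_val w s b = 0 \<and> Q s"
    and e: "\<And>j. 0 \<le> e j"
  shows "runs w ((n - i) * (t + 2) + 1) (\<Sum>j=i..<n. e j) (While b p) s Q"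
  using assms(1-3)
proof (induction "n - i" arbitrary: i s)
  case 0
  then have "i = n" by simp
  then show ?case using 0 last runs_While_done by simp
next
  case (Suc d)
  then have i: "i < n" "d = n - Suc i" by auto
  have "runs w (t + (d * (t + 2) + 1) + 1) (e i + (\<Sum>j=Suc i..<n. e j)) (Seq p (While b p)) s Q"
  proof (rule runs_Seq)
    show "runs w t (e i) p s (I (Suc i))" using Suc.prems i by auto
    show "runs w (d * (t + 2) + 1) (\<Sum>j=Suc i..<n. e j) (While b p) s' Q"
      if "I (Suc i) s'" for s'
      unfolding i(2) by (rule Suc.hyps(1)) (use Suc.prems that i in auto)
    show "0 \<le> (\<Sum>j=Suc i..<n. e j)" by (simp add: e sum_nonneg)
  qed
  then have "runs w (Suc (t + (d * (t + 2) + 1) + 1)) (e i + (\<Sum>j=Suc i..<n. e j)) (While b p) s Q"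
    using runs_While_step Suc.prems i by blast
  moreover have "Suc (t + (d * (t + 2) + 1) + 1) = (n - i) * (t + 2) + 1"
    using Suc.hyps(2) by (simp flip: Suc.hyps(2))
  moreover have "e i + (\<Sum>j=Suc i..<n. e j) = (\<Sum>j=i..<n. e j)"
    using i by (simp add: sum.atLeast_Suc_lessThan)
  ultimately show ?case by simp
qed

section \<open>Loop-free programs as state transformers\<close>

primrec loopfree :: "com \<Rightarrow> bool" where
  "loopfree Skip = True"
| "loopfree (Assign x e) = True"
| "loopfree (Store a e1 e2) = True"
| "loopfree (Flip x) = False"
| "loopfree (Seq p q) = (loopfree p \<and> loopfree q)"
| "loopfree (If e p q) = (loopfree p \<and> loopfree q)"
| "loopfree (While e p) = False"

primrec den :: "nat \<Rightarrow> com \<Rightarrow> state \<Rightarrow> state" where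
  "den w Skip s = s"
| "den w (Assign x e) s = set_var x (exp_val w s e) s"
| "den w (Store a e1 e2) s = set_cell a (exp_val w s e1) (exp_val w s e2) s"
| "den w (Flip x) s = s"
| "den w (Seq p q) s = den w q (den w p s)"
| "den w (If e p q) s = (if exp_val w s e \<noteq> 0 then den w p s else den w q s)"
| "den w (While e p) s = s"

primrec cost :: "com \<Rightarrow> nat" where
  "cost Skip = 0"
| "cost (Assign x e) = 1"
| "cost (Store a e1 e2) = 1"
| "cost (Flip x) = 1"
| "cost (Seq p q) = cost p + cost q + 1"
| "cost (If e p q) = cost p + cost q + 1"
| "cost (While e p) = 0"

lemma runs_den: "loopfree c \<Longrightarrow> Q (den w c s) \<Longrightarrow> runs w (cost c) 0 c s Q"
proof (induction c arbitrary: s Q)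
  case (Seq p q)
  have "runs w (cost p + cost q + 1) (0 + 0) (Seq p q) s Q"
    by (rule runs_Seq[where R = "\<lambda>s'. s' = den w p s"]) (use Seq in auto)
  then show ?case by simp
next
  case (If e p q)
  have "runs w (cost p + cost q) 0 (if exp_val w s e \<noteq> 0 then p else q) s Q"
    using If runs_weaken[of w "cost p" 0 p s Q "cost p + cost q" 0 Q]
      runs_weaken[of w "cost q" 0 q s Q "cost p + cost q" 0 Q] by auto
  then show ?case using runs_If by fastforce
qed (auto simp: runs_def)

section \<open>Clocked programs\<close>

primrec exp_bound :: "exp \<Rightarrow> nat" where
  "exp_bound (Const z) = 0"
| "exp_bound (Var x) = Suc x"
| "exp_bound (Cell a e) = max (Suc a) (exp_bound e)"
| "exp_bound (Op f e1 e2) = max (exp_bound e1) (exp_bound e2)"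

primrec com_bound :: "com \<Rightarrow> nat" where
  "com_bound Skip = 0"
| "com_bound (Assign x e) = max (Suc x) (exp_bound e)"
| "com_bound (Store a e1 e2) = max (Suc a) (max (exp_bound e1) (exp_bound e2))"
| "com_bound (Flip x) = Suc x"
| "com_bound (Seq p q) = max (com_bound p) (com_bound q)"
| "com_bound (If e p q) = max (exp_bound e) (max (com_bound p) (com_bound q))"
| "com_bound (While e p) = max (exp_bound e) (com_bound p)"

definition agree :: "nat \<Rightarrow> state \<Rightarrow> state \<Rightarrow> bool" where
  "agree B s s' \<longleftrightarrow> (\<forall>x<B. vars s x = vars s' x) \<and> (\<forall>a<B. arrs s a = arrs s' a)"

lemma exp_val_agree: "exp_bound e \<le> B \<Longrightarrow> agree B s s' \<Longrightarrow> exp_val w s e = exp_val w s' e"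
  by (induction e) (auto simp: agree_def)

lemma wrap_id: "0 \<le> z \<Longrightarrow> z < 2 ^ w \<Longrightarrow> wrap w z = z"
  by (simp add: signed_take_bit_int_eq_self_iff)

text \<open>
  The clocked version of a program that uses only variables and arrays below \<open>B\<close>. Variable \<open>B\<close>
  counts the loop iterations and stores; variable \<open>B + 1\<close> holds the allowance, beyond which loops
  are left and stores are skipped. Array \<open>B\<close> logs the addresses written to, so that the memory can
  be cleaned in time proportional to the number of writes.
\<close>

definition within_budget :: "nat \<Rightarrow> exp" where
  "within_budget B = Op Less (Var B) (Var (Suc B))"

definition tick :: "nat \<Rightarrow> com" where
  "tick B = Assign B (Op Plus (Var B) (Const 1))"

primrec clocked :: "nat \<Rightarrow> com \<Rightarrow> com" where
  "clocked B Skip = Skip"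
| "clocked B (Assign x e) = Assign x e"
| "clocked B (Store a e1 e2) =
     If (within_budget B) (Seq (Store B (Var B) e1) (Seq (tick B) (Store a e1 e2))) Skip"
| "clocked B (Flip x) = Flip x"
| "clocked B (Seq p q) = Seq (clocked B p) (clocked B q)"
| "clocked B (If e p q) = If e (clocked B p) (clocked B q)"
| "clocked B (While e p) =
     While (Op Less (Op Equal e (Const 0)) (within_budget B)) (Seq (tick B) (clocked B p))"

text \<open>A clocked store takes exactly 6 steps: test, log entry, tick, store, and two removals of
  finished commands. The 5 of a loop covers the guard, the tick and two removals in an iteration, as
  well as the final guard.\<close>

primrec weight :: "com \<Rightarrow> nat" where
  "weight Skip = 0"
| "weight (Assign x e) = 1"
| "weight (Store a e1 e2) = 6"
| "weight (Flip x) = 1"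
| "weight (Seq p q) = weight p + weight q + 1"
| "weight (If e p q) = weight p + weight q + 1"
| "weight (While e p) = weight p + 5"

text \<open>
  Stores and loop iterations burn fuel, and between two of them only boundedly many steps can happen;
  hence the running time is linear in the fuel burnt, also for nested loops.
\<close>

definition fuel :: "nat \<Rightarrow> state \<Rightarrow> nat" where
  "fuel B s = nat (vars s (Suc B) - vars s B)"

definition clock_ok :: "nat \<Rightarrow> nat \<Rightarrow> state \<Rightarrow> bool" where
  "clock_ok w B s \<longleftrightarrow> 0 < w \<and> 0 \<le> vars s B \<and> vars s B \<le> vars s (Suc B) \<and> vars s (Suc B) < 2 ^ w"

text \<open>The log holds addresses without the array they belong to. Cleaning therefore treats an
  address in all arrays below \<open>B\<close>, a constant number.\<close>

definition logged :: "nat \<Rightarrow> state \<Rightarrow> state \<Rightarrow> bool" where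
  "logged B s0 s \<longleftrightarrow>
     (\<forall>a<B. \<forall>z. arrs s a z \<noteq> arrs s0 a z \<longrightarrow> (\<exists>h. 0 \<le> h \<and> h < vars s B \<and> arrs s B h = z))"

definition frame :: "nat \<Rightarrow> state \<Rightarrow> state \<Rightarrow> bool" where
  "frame B s s' \<longleftrightarrow> (\<forall>x>B. vars s' x = vars s x) \<and> (\<forall>a>B. arrs s' a = arrs s a)"

lemma frame_refl [simp]: "frame B s s" by (simp add: frame_def)

lemma frame_trans: "frame B s s' \<Longrightarrow> frame B s' s'' \<Longrightarrow> frame B s s''" by (simp add: frame_def)

lemma vars_set_var [simp]: "vars (set_var x z s) = (vars s)(x := z)"
  and arrs_set_var [simp]: "arrs (set_var x z s) = arrs s"
  and vars_set_cell [simp]: "vars (set_cell a i z s) = vars s"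
  and arrs_set_cell [simp]: "arrs (set_cell a i z s) = (arrs s)(a := (arrs s a)(i := z))"
  by (simp_all add: set_var_def set_cell_def)

lemma wrap_bool [simp]: "0 < w \<Longrightarrow> wrap w (of_bool b) = of_bool b"
  by (cases b) (auto intro!: wrap_id)

lemma wrap_1 [simp]: "0 < w \<Longrightarrow> wrap w 1 = 1"
  by (auto intro!: wrap_id)

lemma exp_val_within_budget:
  "clock_ok w B s \<Longrightarrow> exp_val w s (within_budget B) = of_bool (0 < fuel B s)"
  by (auto simp: within_budget_def clock_ok_def fuel_def)

lemma exp_val_guard:
  "clock_ok w B s \<Longrightarrow>
     exp_val w s (Op Less (Op Equal e (Const 0)) (within_budget B)) =
       of_bool (exp_val w s e \<noteq> 0 \<and> 0 < fuel B s)"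
  using exp_val_within_budget[of w B s] by (auto simp: clock_ok_def)

lemma exp_val_tick:
  "clock_ok w B s \<Longrightarrow> 0 < fuel B s \<Longrightarrow>
     exp_val w s (Op Plus (Var B) (Const 1)) = vars s B + 1"
  by (auto simp: clock_ok_def fuel_def intro!: wrap_id)

lemma ewp_tick:
  "clock_ok w B s \<Longrightarrow> 0 < fuel B s \<Longrightarrow>
     ewp w (Suc t) (tick B) s f = f t (set_var B (vars s B + 1) s)"
  using exp_val_tick[of w B s] by (simp add: tick_def del: exp_val.simps)

lemma tick_props:
  assumes "clock_ok w B s" and "0 < fuel B s"
  defines "s' \<equiv> set_var B (vars s B + 1) s"
  shows "clock_ok w B s'" and "fuel B s' = fuel B s - 1" and "frame B s s'"
    and "logged B s0 s \<Longrightarrow> logged B s0 s'" and "agree B s0 s \<Longrightarrow> agree B s0 s'"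
  using assms by (force simp: clock_ok_def fuel_def frame_def logged_def agree_def)+

text \<open>An amortized time bound: the steps taken, \<open>t - t'\<close>, are at most \<kappa>
  times the fuel burnt plus \<kappa>, arranged to avoid truncated subtraction. \<open>s0\<close> is
  the memory that the log refers to; it stays fixed while \<open>s\<close> moves along with the
  parts of the program.\<close>

definition clocked_post :: "nat \<Rightarrow> nat \<Rightarrow> nat \<Rightarrow> state \<Rightarrow> state \<Rightarrow> nat \<Rightarrow> nat \<Rightarrow> state \<Rightarrow> bool" where
  "clocked_post w B \<kappa> s0 s t t' s' \<longleftrightarrow> clock_ok w B s' \<and> frame B s s' \<and> logged B s0 s' \<and>
     fuel B s' \<le> fuel B s \<and> t + \<kappa> * fuel B s' \<le> t' + \<kappa> * fuel B s + \<kappa>"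

lemma clocked_post_seq:
  assumes "clocked_post w B \<kappa>1 s0 s t t1 s1" and "clocked_post w B \<kappa>2 s0 s1 (t1 - 1) t2 s2"
  shows "clocked_post w B (\<kappa>1 + \<kappa>2 + 1) s0 s t t2 s2"
proof -
  obtain d1 d2 where d: "fuel B s = fuel B s1 + d1" "fuel B s1 = fuel B s2 + d2"
    using assms by (auto simp: clocked_post_def le_iff_add)
  show ?thesis
    using assms d by (auto simp: clocked_post_def algebra_simps intro: frame_trans)
qed

lemma clocked_post_mono:
  assumes "clocked_post w B \<kappa> s0 s t t' s'" and "\<kappa> \<le> \<kappa>'"
  shows "clocked_post w B \<kappa>' s0 s t t' s'"
proof -
  obtain d e where d: "fuel B s = fuel B s' + d" "\<kappa>' = \<kappa> + e"
    using assms by (auto simp: clocked_post_def le_iff_add)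
  show ?thesis
    using assms d by (auto simp: clocked_post_def algebra_simps)
qed

lemma ewp_ge_1_seq:
  assumes "1 \<le> ewp w t p s (\<lambda>t' s'. of_bool (R t' s'))"
    and "\<And>t' s'. R t' s' \<Longrightarrow> 0 < t' \<and> 1 \<le> ewp w (t' - 1) q s' (\<lambda>t' s'. of_bool (Q t' s'))"
  shows "1 \<le> ewp w t (Seq p q) s (\<lambda>t' s'. of_bool (Q t' s'))"
proof -
  note assms(1)
  also have "ewp w t p s (\<lambda>t' s'. of_bool (R t' s')) \<le>
      ewp w t p s (\<lambda>t' s'. case t' of 0 \<Rightarrow> 0
        | Suc u \<Rightarrow> ewp w u q s' (\<lambda>t' s'. of_bool (Q t' s')))"
  proof (rule ewp_mono)
    fix t' s'
    show "of_bool (R t' s') \<le> (case t' of 0 \<Rightarrow> 0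
        | Suc u \<Rightarrow> ewp w u q s' (\<lambda>t' s'. of_bool (Q t' s')))"
      using assms(2)[of t' s'] by (cases t'; cases "R t' s'") (auto intro: ewp_nonneg)
  qed
  finally show ?thesis by (simp only: ewp_Seq)
qed

lemma clocked_Store:
  assumes bnd: "com_bound (Store a e1 e2) \<le> B" and ok: "clock_ok w B s"
    and logd: "logged B s0 s" and fuel: "0 < fuel B s" and tm: "6 \<le> t"
  obtains s3 where "\<And>f. ewp w t (clocked B (Store a e1 e2)) s f = f (t - 6) s3"
    and "clocked_post w B 6 s0 s t (t - 6) s3" and "fuel B s3 = fuel B s - 1"
    and "\<And>s'. agree B s' s \<Longrightarrow>
           agree B (set_cell a (exp_val w s' e1) (exp_val w s' e2) s') s3"
proof -
  obtain u where t: "t = Suc (Suc (Suc (Suc (Suc (Suc u)))))"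
    using tm by (auto dest!: le_Suc_ex)
  define s1 where "s1 = set_cell B (vars s B) (exp_val w s e1) s"
  have ok1: "clock_ok w B s1" "fuel B s1 = fuel B s" "frame B s s1" "agree B s s1"
    using assms by (auto simp: s1_def clock_ok_def fuel_def frame_def agree_def)
  define s2 where "s2 = set_var B (vars s B + 1) s1"
  have s2: "clock_ok w B s2" "fuel B s2 = fuel B s - 1" "frame B s1 s2" "agree B s s2"
    using tick_props[of w B s1] ok1 fuel by (auto simp: s2_def s1_def)
  have e: "exp_val w s1 (Op Plus (Var B) (Const 1)) = vars s B + 1"
    using exp_val_tick[of w B s1] ok1 fuel by (simp add: s1_def)
  \<comment> \<open>Logging and ticking change only array \<open>B\<close> and variable
    \<open>B\<close>, which \<open>e1\<close> cannot read, so its second evaluation gives the logged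
    address.\<close>
  have e1: "exp_val w s2 e1 = exp_val w s e1"
    using exp_val_agree[of e1 B s s2 w] s2 assms by simp
  define s3 where "s3 = set_cell a (exp_val w s e1) (exp_val w s2 e2) s2"
  have "logged B s0 s3"
    unfolding logged_def
  proof (intro allI impI)
    fix a' z
    assume a': "a' < B" and ne: "arrs s3 a' z \<noteq> arrs s0 a' z"
    have a: "a < B" and top: "0 \<le> vars s B" using assms by (auto simp: clock_ok_def)
    have top3: "vars s3 B = vars s B + 1"
      and log3: "arrs s3 B = (arrs s B)(vars s B := exp_val w s e1)"
      using a by (auto simp: s3_def s2_def s1_def)
    show "\<exists>h. 0 \<le> h \<and> h < vars s3 B \<and> arrs s3 B h = z"
    proof (cases "arrs s a' z = arrs s0 a' z")
      case True
      then have "z = exp_val w s e1"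
        using ne a' by (auto simp: s3_def s2_def s1_def split: if_splits)
      then show ?thesis using top top3 log3 by (intro exI[of _ "vars s B"]) auto
    next
      case False
      then obtain h where "0 \<le> h" "h < vars s B" "arrs s B h = z"
        using logd a' unfolding logged_def by blast
      then show ?thesis using top3 log3 by (intro exI[of _ h]) auto
    qed
  qed
  then have "clocked_post w B 6 s0 s t u s3"
    using s2 ok1 assms fuel unfolding clocked_post_def t
    by (auto simp: s3_def clock_ok_def fuel_def frame_def)
  moreover have "ewp w t (clocked B (Store a e1 e2)) s f = f u s3" for f
    using assms fuel e e1
    by (simp add: t exp_val_within_budget ewp_Seq tick_def s1_def[symmetric] s2_def[symmetric]
        s3_def[symmetric] del: exp_val.simps(4))
  moreover have "fuel B s3 = fuel B s - 1"
    using s2 by (simp add: s3_def fuel_def)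
  moreover have "agree B (set_cell a (exp_val w s' e1) (exp_val w s' e2) s') s3" if "agree B s' s" for s'
  proof -
    have "agree B s' s2" using that s2 by (simp add: agree_def)
    then show ?thesis
      using exp_val_agree[of e1 B s' s w] exp_val_agree[of e2 B s' s2 w] that bnd
      by (auto simp: s3_def agree_def)
  qed
  ultimately show ?thesis using that[of s3] by (simp add: t del: clocked.simps)
qed

lemma clocked_While_step:
  assumes "clock_ok w B s" and "exp_val w s e \<noteq> 0" and "0 < fuel B s"
  shows "ewp w (Suc (Suc (Suc t))) (clocked B (While e p)) s f =
    ewp w t (Seq (clocked B p) (clocked B (While e p))) (set_var B (vars s B + 1) s) f"
  using exp_val_guard[OF assms(1), of e] assms
  by (simp add: ewp_Seq ewp_tick del: exp_val.simps cong: nat.case_cong)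

text \<open>This holds even if the original program diverges. Every loop iteration burns fuel, so
  for loops an induction on the fuel is nested into the one on the program; without fuel, loops are
  left and only boundedly many steps remain.\<close>

lemma clocked_total:
  assumes "com_bound c \<le> B" and "clock_ok w B s" and "logged B s0 s"
    and "weight c * fuel B s + weight c \<le> t"
  shows "1 \<le> ewp w t (clocked B c) s
           (\<lambda>t' s'. of_bool (clocked_post w B (weight c) s0 s t t' s'))"
  using assms
proof (induction c arbitrary: s t)
  case Skip
  then show ?case by (simp add: clocked_post_def)
next
  case (Assign x e)
  then obtain u where "t = Suc u" by (cases t) auto
  with Assign show ?case
    by (auto simp: clocked_post_def clock_ok_def fuel_def frame_def logged_def)
next
  case (Flip x)
  then obtain u where "t = Suc u" by (cases t) auto
  with Flip show ?case
    by (auto simp: clocked_post_def clock_ok_def fuel_def frame_def logged_def)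
next
  case (Store a e1 e2)
  then obtain u where t: "t = Suc u" by (cases t) auto
  show ?case
  proof (cases "0 < fuel B s")
    case False
    then show ?thesis
      using Store by (simp add: t exp_val_within_budget clocked_post_def)
  next
    case True
    then show ?thesis
      using Store.prems(4) by (auto intro: clocked_Store[OF Store.prems(1-3) True, of t]
          simp del: clocked.simps)
  qed
next
  case (Seq p q)
  have p: "1 \<le> ewp w t (clocked B p) s
           (\<lambda>t' s'. of_bool (clocked_post w B (weight p) s0 s t t' s'))"
    using Seq.prems by (intro Seq.IH) (auto simp: algebra_simps)
  show ?case
    unfolding clocked.simps
  proof (rule ewp_ge_1_seq[OF p], intro conjI)
    fix t' s'
    assume post: "clocked_post w B (weight p) s0 s t t' s'"
    then obtain d where d: "fuel B s = fuel B s' + d"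
      by (auto simp: clocked_post_def le_iff_add)
    have *: "weight q * fuel B s' + weight q + 1 \<le> t'"
      using post Seq.prems(4) unfolding clocked_post_def d by (auto simp: algebra_simps)
    then show "0 < t'" by simp
    have "1 \<le> ewp w (t' - 1) (clocked B q) s'
           (\<lambda>t'' s''. of_bool (clocked_post w B (weight q) s0 s' (t' - 1) t'' s''))"
      using Seq.prems post * by (intro Seq.IH) (auto simp: clocked_post_def)
    also have "\<dots> \<le> ewp w (t' - 1) (clocked B q) s'
           (\<lambda>t'' s''. of_bool (clocked_post w B (weight (Seq p q)) s0 s t t'' s''))"
      by (rule ewp_mono) (use clocked_post_seq[OF post] in auto)
    finally show "1 \<le> ewp w (t' - 1) (clocked B q) s'
           (\<lambda>t'' s''. of_bool (clocked_post w B (weight (Seq p q)) s0 s t t'' s''))" .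
  qed
next
  case (If e p q)
  then obtain u where u: "t = Suc u" by (cases t) auto
  have "1 \<le> ewp w u (clocked B c) s
           (\<lambda>t' s'. of_bool (clocked_post w B (weight (If e p q)) s0 s t t' s'))"
    if c: "c \<in> {p, q}" for c
  proof -
    have "1 \<le> ewp w u (clocked B c) s
           (\<lambda>t' s'. of_bool (clocked_post w B (weight c) s0 s u t' s'))"
      using If.prems c u by (auto intro!: If.IH simp: algebra_simps)
    also have "\<dots> \<le> ewp w u (clocked B c) s
           (\<lambda>t' s'. of_bool (clocked_post w B (weight (If e p q)) s0 s t t' s'))"
    proof (rule ewp_mono)
      fix t' s'
      have "clocked_post w B (weight p + weight q + 1) s0 s t t' s'"
        if "clocked_post w B (weight c) s0 s u t' s'"
      proof -
        have "clocked_post w B (weight p + weight q) s0 s u t' s'"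
          using clocked_post_mono[OF that, of "weight p + weight q"] c by auto
        then show ?thesis by (auto simp: clocked_post_def u algebra_simps)
      qed
      then show "of_bool (clocked_post w B (weight c) s0 s u t' s') \<le>
        (of_bool (clocked_post w B (weight (If e p q)) s0 s t t' s') :: real)" by auto
    qed
    finally show ?thesis .
  qed
  then show ?case by (simp add: u)
next
  case (While e p)
  let ?c = "clocked B (While e p)"
  let ?\<kappa> = "weight (While e p)"
  from While.prems show ?case
  proof (induction "fuel B s" arbitrary: s t rule: less_induct)
    case less
    then obtain u where u: "t = Suc u" by (cases t) auto
    note ok = less.prems(2)
    show ?case
    proof (cases "exp_val w s e \<noteq> 0 \<and> 0 < fuel B s")
      case False
      then have "ewp w t ?c s f = f u s" for f
        using exp_val_guard[OF ok, of e] by (simp add: u del: exp_val.simps)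
      moreover have "clocked_post w B ?\<kappa> s0 s t u s"
        using less.prems by (auto simp: clocked_post_def u)
      ultimately show ?thesis by simp
    next
      case True
      define s1 where "s1 = set_var B (vars s B + 1) s"
      obtain g where g: "fuel B s = Suc g" using True gr0_conv_Suc by auto
      have s1: "clock_ok w B s1" "fuel B s1 = g" "frame B s s1" "logged B s0 s1"
        using tick_props[OF ok] True less.prems g by (auto simp: s1_def)
      have ts: "(weight p + 5) * g + 2 * weight p + 9 \<le> u"
        using less.prems(4) by (simp add: g u)
      then obtain v where v: "u = Suc (Suc v)"
        by (cases u; cases "u - 1") auto
      have p: "1 \<le> ewp w v (clocked B p) s1
           (\<lambda>t' s'. of_bool (clocked_post w B (weight p) s0 s1 v t' s'))"
        using less.prems s1 ts by (intro While.IH) (auto simp: v algebra_simps)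
      have "1 \<le> ewp w v (Seq (clocked B p) ?c) s1
           (\<lambda>t' s'. of_bool (clocked_post w B ?\<kappa> s0 s t t' s'))"
      proof (rule ewp_ge_1_seq[OF p], intro conjI)
        fix t' s'
        assume post: "clocked_post w B (weight p) s0 s1 v t' s'"
        then obtain d where d: "g = fuel B s' + d"
          by (auto simp: clocked_post_def le_iff_add s1)
        have *: "?\<kappa> * fuel B s' + ?\<kappa> + 1 \<le> t'"
          using post ts unfolding clocked_post_def s1 d v by (auto simp: algebra_simps)
        then show "0 < t'" by simp
        have "1 \<le> ewp w (t' - 1) ?c s'
           (\<lambda>t'' s''. of_bool (clocked_post w B ?\<kappa> s0 s' (t' - 1) t'' s''))"
          using less.prems post * s1 g by (intro less.hyps) (auto simp: clocked_post_def)
        also have "\<dots> \<le> ewp w (t' - 1) ?c s'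
           (\<lambda>t'' s''. of_bool (clocked_post w B ?\<kappa> s0 s t t'' s''))"
        proof (rule ewp_mono)
          fix t'' s''
          have "clocked_post w B ?\<kappa> s0 s t t'' s''"
            if last: "clocked_post w B ?\<kappa> s0 s' (t' - 1) t'' s''"
          proof -
            obtain d' where d': "fuel B s' = fuel B s'' + d'"
              using last le_Suc_ex[of "fuel B s''" "fuel B s'"]
              by (auto simp: clocked_post_def)
            show ?thesis
              using post last * s1 g unfolding clocked_post_def d s1 u v
              by (auto simp: algebra_simps d' intro: frame_trans)
          qed
          then show "of_bool (clocked_post w B ?\<kappa> s0 s' (t' - 1) t'' s'') \<le>
            (of_bool (clocked_post w B ?\<kappa> s0 s t t'' s'') :: real)" by auto
        qed
        finally show "1 \<le> ewp w (t' - 1) ?c s'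
           (\<lambda>t'' s''. of_bool (clocked_post w B ?\<kappa> s0 s t t'' s''))" .
      qed
      then show ?thesis
        by (simp only: u v s1_def clocked_While_step[OF ok conjunct1[OF True] conjunct2[OF True]])
    qed
  qed
qed

text \<open>The unit of fuel burnt by the tick is worth \<kappa> + 5 steps. This pays for the
  additive \<kappa> of the body and for the bookkeeping of the iteration, so the additive constant
  does not grow with the number of iterations.\<close>

lemma clocked_post_while:
  assumes "clock_ok w B s" and "0 < fuel B s"
    and "clocked_post w B \<kappa> s0 (set_var B (vars s B + 1) s) t t1 s1"
    and "clocked_post w B (\<kappa> + 5) s0 s1 (t1 - 1) t2 s2"
  shows "clocked_post w B (\<kappa> + 5) s0 s (t + 3) t2 s2"
proof -
  obtain g where g: "fuel B s = Suc g" using assms(2) gr0_conv_Suc by auto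
  then have s': "fuel B (set_var B (vars s B + 1) s) = g" "frame B s (set_var B (vars s B + 1) s)"
    using tick_props[OF assms(1,2)] by auto
  obtain d1 d2 where d: "g = fuel B s1 + d1" "fuel B s1 = fuel B s2 + d2"
    using assms s' by (auto simp: clocked_post_def le_iff_add)
  have "frame B s s2"
    using assms s' unfolding clocked_post_def by (blast intro: frame_trans)
  then show ?thesis
    using assms(3,4) unfolding clocked_post_def g s' d(1)
    by (auto simp: algebra_simps d(2))
qed

text \<open>A coupling with identical coin flips. Each unit of fuel burnt matches at least one step
  of the original, so the fuel stays at least the time that the original has left, and no store is
  skipped and no loop left early. Once the original is out of time it contributes 0, and
  nonnegativity of \<open>F\<close> suffices.\<close>

lemma clocked_simulates:
  assumes "com_bound c \<le> B" and "agree B s s'" and "clock_ok w B s'" and "logged B s0 s'"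
    and "t \<le> fuel B s'" and "weight c * fuel B s' + weight c \<le> t'"
    and "\<And>t1 s1 t2 s2. clocked_post w B (weight c) s0 s' t' t2 s2 \<Longrightarrow> agree B s1 s2 \<Longrightarrow>
           t1 \<le> fuel B s2 \<Longrightarrow> G t1 s1 \<le> F t2 s2"
    and "\<And>t s. 0 \<le> F t s"
  shows "ewp w t c s G \<le> ewp w t' (clocked B c) s' F"
  using assms
proof (induction c arbitrary: s s' t t' F G)
  case Skip
  then show ?case by (simp add: clocked_post_def)
next
  case (Assign x e)
  then obtain u where u: "t' = Suc u" by (cases t') auto
  show ?case
  proof (cases t)
    case 0
    then show ?thesis using Assign.prems(8) by (simp add: ewp_nonneg)
  next
    case (Suc v)
    have "exp_val w s e = exp_val w s' e"
      using Assign.prems by (intro exp_val_agree[of e B]) auto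
    then show ?thesis
      using Assign.prems(1-6) unfolding Suc u
      by (auto simp: clocked_post_def clock_ok_def fuel_def frame_def logged_def agree_def
          u intro!: Assign.prems(7))
  qed
next
  case (Flip x)
  then obtain u where u: "t' = Suc u" by (cases t') auto
  show ?case
  proof (cases t)
    case 0
    then show ?thesis using Flip.prems(8) by (simp add: ewp_nonneg)
  next
    case (Suc v)
    have "G v (set_var x z s) \<le> F u (set_var x z s')" for z
      using Flip.prems(1-6) unfolding Suc u
      by (intro Flip.prems(7))
        (auto simp: clocked_post_def clock_ok_def fuel_def frame_def logged_def agree_def u)
    then show ?thesis
      unfolding Suc u clocked.simps ewp_Flip by (intro divide_right_mono add_mono) auto
  qed
next
  case (Store a e1 e2)
  show ?case
  proof (cases t)
    case 0
    then show ?thesis using Store.prems(8) by (simp add: ewp_nonneg del: clocked.simps)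
  next
    case (Suc v)
    have fuel: "0 < fuel B s'" and "6 \<le> t'" using Store.prems(5,6) Suc by auto
    then obtain s3 where "\<And>f. ewp w t' (clocked B (Store a e1 e2)) s' f = f (t' - 6) s3"
      and "clocked_post w B 6 s0 s' t' (t' - 6) s3" and "fuel B s3 = fuel B s' - 1"
      and "\<And>r. agree B r s' \<Longrightarrow> agree B (set_cell a (exp_val w r e1) (exp_val w r e2) r) s3"
      using clocked_Store[OF Store.prems(1,3,4)] by metis
    then show ?thesis
      using Store.prems(2,5) Suc by (auto intro!: Store.prems(7) simp del: clocked.simps)
  qed
next
  case (Seq p q)
  show ?case
    unfolding clocked.simps ewp_Seq[of w t] ewp_Seq[of w t']
  proof (rule Seq.IH(1))
    fix t1 s1 t2 s2
    assume post: "clocked_post w B (weight p) s0 s' t' t2 s2" and ag: "agree B s1 s2"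
      and t1: "t1 \<le> fuel B s2"
    obtain d where d: "fuel B s' = fuel B s2 + d"
      using post by (auto simp: clocked_post_def le_iff_add)
    have *: "weight q * fuel B s2 + weight q + 1 \<le> t2"
      using post Seq.prems(6) unfolding clocked_post_def d by (auto simp: algebra_simps)
    then obtain u2 where u2: "t2 = Suc u2" by (cases t2) auto
    show "(case t1 of 0 \<Rightarrow> 0 | Suc u \<Rightarrow> ewp w u q s1 G) \<le>
        (case t2 of 0 \<Rightarrow> 0 | Suc u \<Rightarrow> ewp w u (clocked B q) s2 F)"
    proof (cases t1)
      case 0
      then show ?thesis using Seq.prems(8) u2 by (simp add: ewp_nonneg)
    next
      case (Suc u1)
      have "ewp w u1 q s1 G \<le> ewp w u2 (clocked B q) s2 F"
      proof (rule Seq.IH(2))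
        fix t3 s3 t4 s4
        assume "clocked_post w B (weight q) s0 s2 u2 t4 s4" "agree B s3 s4" "t3 \<le> fuel B s4"
        then show "G t3 s3 \<le> F t4 s4"
          using clocked_post_seq[OF post, of "weight q" t4 s4] u2 by (intro Seq.prems(7)) auto
      qed (use Seq.prems post ag t1 * Suc u2 in \<open>auto simp: clocked_post_def\<close>)
      then show ?thesis by (simp add: Suc u2)
    qed
  next
    show "0 \<le> (case t of 0 \<Rightarrow> 0 | Suc u \<Rightarrow> ewp w u (clocked B q) s F)" for t s
      using Seq.prems(8) by (cases t) (auto intro: ewp_nonneg)
  qed (use Seq.prems in \<open>auto simp: algebra_simps\<close>)
next
  case (If e p q)
  then obtain u where u: "t' = Suc u" by (cases t') auto
  show ?case
  proof (cases t)
    case 0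
    then show ?thesis using If.prems(8) by (simp add: ewp_nonneg)
  next
    case (Suc v)
    have e: "exp_val w s e = exp_val w s' e"
      using If.prems by (intro exp_val_agree[of e B]) auto
    have "ewp w v c s G \<le> ewp w u (clocked B c) s' F" if c: "c \<in> {p, q}" for c
    proof -
      have "G t1 s1 \<le> F t2 s2"
        if last: "clocked_post w B (weight c) s0 s' u t2 s2" "agree B s1 s2" "t1 \<le> fuel B s2"
        for t1 s1 t2 s2
      proof (rule If.prems(7))
        have "clocked_post w B (weight p + weight q) s0 s' u t2 s2"
          using clocked_post_mono[OF last(1), of "weight p + weight q"] c by auto
        then show "clocked_post w B (weight (If e p q)) s0 s' t' t2 s2"
          by (auto simp: clocked_post_def u algebra_simps)
      qed (use last in auto)
      moreover have "weight c * fuel B s' + weight c \<le> u"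
        using If.prems(6) c by (auto simp: u algebra_simps)
      ultimately show ?thesis
        using If.prems(1-6,8) c Suc by (auto intro!: If.IH)
    qed
    then show ?thesis by (simp add: Suc u e)
  qed
next
  case (While e p)
  let ?c = "clocked B (While e p)"
  let ?\<kappa> = "weight (While e p)"
  from While.prems show ?case
  proof (induction "fuel B s'" arbitrary: s s' t t' rule: less_induct)
    case less
    then obtain u where u: "t' = Suc u" by (cases t') auto
    note ok = less.prems(3)
    show ?case
    proof (cases t)
      case 0
      then show ?thesis using less.prems(8) by (simp add: ewp_nonneg del: clocked.simps)
    next
      case (Suc v)
      then have fuel: "0 < fuel B s'" using less.prems(5) by simp
      have e: "exp_val w s e = exp_val w s' e"
        using less.prems by (intro exp_val_agree[of e B]) auto
      show ?thesis
      proof (cases "exp_val w s' e = 0")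
        case True
        then have "ewp w t' ?c s' F = F u s'"
          using exp_val_guard[OF ok, of e] by (simp add: u del: exp_val.simps)
        moreover have "clocked_post w B ?\<kappa> s0 s' t' u s'"
          using less.prems by (auto simp: clocked_post_def u)
        ultimately show ?thesis
          using True less.prems(2,5) e by (auto simp: Suc intro!: less.prems(7) simp del: clocked.simps)
      next
        case False
        define s1 where "s1 = set_var B (vars s' B + 1) s'"
        obtain g where g: "fuel B s' = Suc g" using fuel gr0_conv_Suc by auto
        have s1: "clock_ok w B s1" "fuel B s1 = g" "frame B s' s1" "logged B s0 s1" "agree B s s1"
          using tick_props[OF ok] fuel less.prems g by (auto simp: s1_def)
        have ts: "(weight p + 5) * g + 2 * weight p + 9 \<le> u"
          using less.prems(6) by (simp add: g u)
        then obtain v' where v': "u = Suc (Suc v')"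
          by (cases u; cases "u - 1") auto
        have "ewp w t (While e p) s G = ewp w v (Seq p (While e p)) s G"
          using False e by (simp add: Suc)
        also have "\<dots> \<le> ewp w v' (Seq (clocked B p) ?c) s1 F"
          unfolding ewp_Seq[of w v] ewp_Seq[of w v']
        proof (rule While.IH)
          fix t1 r1 t2 r2
          assume post: "clocked_post w B (weight p) s0 s1 v' t2 r2" and ag: "agree B r1 r2"
            and t1: "t1 \<le> fuel B r2"
          then obtain d where d: "g = fuel B r2 + d"
            by (auto simp: clocked_post_def le_iff_add s1)
          have *: "?\<kappa> * fuel B r2 + ?\<kappa> + 1 \<le> t2"
            using post ts unfolding clocked_post_def s1 d v' by (auto simp: algebra_simps)
          then obtain u2 where u2: "t2 = Suc u2" by (cases t2) auto
          show "(case t1 of 0 \<Rightarrow> 0 | Suc u \<Rightarrow> ewp w u (While e p) r1 G) \<le>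
              (case t2 of 0 \<Rightarrow> 0 | Suc u \<Rightarrow> ewp w u ?c r2 F)"
          proof (cases t1)
            case 0
            then show ?thesis using less.prems(8) u2 by (simp add: ewp_nonneg del: clocked.simps)
          next
            case (Suc u1)
            have "ewp w u1 (While e p) r1 G \<le> ewp w u2 ?c r2 F"
            proof (rule less.hyps)
              fix t3 s3 t4 s4
              assume last: "clocked_post w B ?\<kappa> s0 r2 u2 t4 s4" "agree B s3 s4" "t3 \<le> fuel B s4"
              have "clocked_post w B ?\<kappa> s0 s' t' t4 s4"
                using clocked_post_while[OF ok fuel, of "weight p" s0 v' t2 r2 t4 s4] post last(1)
                by (simp add: s1_def u2 u v' numeral_3_eq_3)
              then show "G t3 s3 \<le> F t4 s4"
                using last by (intro less.prems(7)) auto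
            qed (use less.prems(1,8) post ag t1 * Suc u2 g d in \<open>auto simp: clocked_post_def\<close>)
            then show ?thesis by (simp add: Suc u2 del: clocked.simps)
          qed
        next
          show "0 \<le> (case t of 0 \<Rightarrow> 0 | Suc u \<Rightarrow> ewp w u ?c s F)" for t s
            using less.prems(8) by (cases t) (auto intro: ewp_nonneg)
        qed (use less.prems(1,5) s1 ts Suc g in \<open>auto simp: v' algebra_simps\<close>)
        also have "\<dots> = ewp w t' ?c s' F"
          by (simp only: u v' s1_def clocked_While_step[OF ok False fuel])
        finally show ?thesis .
      qed
    qed
  qed
qed


lemma ewp_conj:
  assumes "1 \<le> ewp w t c s (\<lambda>t s. of_bool (Q t s))" and "1 - e \<le> ewp w t c s (\<lambda>t s. of_bool (R t s))"
  shows "1 - e \<le> ewp w t c s (\<lambda>t s. of_bool (Q t s \<and> R t s))"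
proof -
  have "1 - e \<le> ewp w t c s (\<lambda>t s. of_bool (Q t s) + of_bool (R t s)) - 1"
    using assms by (simp add: ewp_add)
  also have "\<dots> \<le> ewp w t c s (\<lambda>t s. of_bool (Q t s) + of_bool (R t s) - 1)"
    by (rule ewp_diff_const) simp
  also have "\<dots> \<le> ewp w t c s (\<lambda>t s. of_bool (Q t s \<and> R t s))"
    by (rule ewp_mono) auto
  finally show ?thesis .
qed

lemma runs_clocked:
  assumes "com_bound c \<le> B" and "clock_ok w B s" and "vars s B = 0" and "vars s (Suc B) = int T"
  shows "runs w (weight c * (T + 1)) 0 (clocked B c) s
           (\<lambda>s'. clock_ok w B s' \<and> frame B s s' \<and> logged B s s')"
proof (rule runsI)
  fix u
  have fuel: "fuel B s = T" using assms by (simp add: fuel_def)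
  have "1 \<le> ewp w (weight c * (T + 1) + u) (clocked B c) s
      (\<lambda>t' s'. of_bool (clocked_post w B (weight c) s s (weight c * (T + 1) + u) t' s'))"
    by (rule clocked_total) (use assms in \<open>auto simp: fuel logged_def\<close>)
  also have "\<dots> \<le> ewp w (weight c * (T + 1) + u) (clocked B c) s
      (\<lambda>t' s'. of_bool (u \<le> t' \<and> clock_ok w B s' \<and> frame B s s' \<and> logged B s s'))"
  proof (rule ewp_mono)
    fix t' s'
    have "u \<le> t'" if post: "clocked_post w B (weight c) s s (weight c * (T + 1) + u) t' s'"
    proof -
      have "weight c * (T + 1) + u \<le> t' + weight c * T + weight c"
        using post unfolding clocked_post_def fuel by simp
      then show ?thesis by simp
    qed
    then show "of_bool (clocked_post w B (weight c) s s (weight c * (T + 1) + u) t' s') \<le>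
      (of_bool (u \<le> t' \<and> clock_ok w B s' \<and> frame B s s' \<and> logged B s s') :: real)"
      by (auto simp: clocked_post_def)
  qed
  finally show "1 - 0 \<le> ewp w (weight c * (T + 1) + u) (clocked B c) s
      (\<lambda>t' s'. of_bool (u \<le> t' \<and> clock_ok w B s' \<and> frame B s s' \<and> logged B s s'))"
    by simp
qed

text \<open>The simulation yields the answer, totality the remaining time and the state of the
  memory. As the latter has probability 1, the conjunction causes no further error.\<close>

lemma runs_clocked_output:
  assumes "com_bound c \<le> B" and "0 < B" and "clock_ok w B s" and "vars s B = 0" and "vars s (Suc B) = int T"
    and "agree B (init_state w inp) s" and "1 - e \<le> output_prob w c inp t z" and "t \<le> T"
  shows "runs w (weight c * (T + 1)) e (clocked B c) s
           (\<lambda>s'. clock_ok w B s' \<and> frame B s s' \<and> logged B s s' \<and> vars s' 0 = z)"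
proof (rule runsI)
  fix u
  let ?t = "weight c * (T + 1) + u"
  have fuel: "fuel B s = T" using assms by (simp add: fuel_def)
  have "1 - e \<le> ewp w t c (init_state w inp) (\<lambda>_ s'. of_bool (vars s' 0 = z))"
    using assms(7) by (simp add: output_prob_def ewp_eq_prob)
  also have "\<dots> \<le> ewp w ?t (clocked B c) s (\<lambda>_ s'. of_bool (vars s' 0 = z))"
    by (rule clocked_simulates[where B = B and ?s0.0 = s])
      (use assms in \<open>auto simp: fuel logged_def agree_def\<close>)
  finally have "1 - e \<le> ewp w ?t (clocked B c) s (\<lambda>t' s'. of_bool ((u \<le> t' \<and> clock_ok w B s' \<and>
      frame B s s' \<and> logged B s s') \<and> vars s' 0 = z))"
    using runs_clocked[OF assms(1,3,4,5)] unfolding runs_def by (intro ewp_conj) auto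
  then show "1 - e \<le> ewp w ?t (clocked B c) s (\<lambda>t' s'. of_bool (u \<le> t' \<and> clock_ok w B s' \<and>
      frame B s s' \<and> logged B s s' \<and> vars s' 0 = z))"
    by (simp only: conj_assoc)
qed

section \<open>Restoring zeroed memory after a call\<close>

primrec clear_cells :: "nat \<Rightarrow> nat \<Rightarrow> com" where
  "clear_cells L 0 = Skip"
| "clear_cells L (Suc a) = Seq (clear_cells L a) (Store a (Cell L (Var L)) (Const 0))"

primrec reset_vars :: "nat \<Rightarrow> com" where
  "reset_vars 0 = Skip"
| "reset_vars (Suc x) = Seq (reset_vars x) (Assign x (Const 0))"

lemma loopfree_clear_cells: "loopfree (clear_cells L a)" "cost (clear_cells L a) = 2 * a"
  by (induction a) auto

lemma loopfree_reset_vars: "loopfree (reset_vars x)" "cost (reset_vars x) = 2 * x"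
  by (induction x) auto

lemma vars_den_clear_cells [simp]: "vars (den w (clear_cells L a) s) = vars s"
  by (induction a) auto

lemma arrs_den_clear_cells:
  "a \<le> L \<Longrightarrow> arrs (den w (clear_cells L a) s) =
     (\<lambda>b. if b < a then (arrs s b)(arrs s L (vars s L) := 0) else arrs s b)"
  by (induction a) (auto simp: fun_eq_iff less_Suc_eq)

lemma arrs_den_reset_vars [simp]: "arrs (den w (reset_vars n) s) = arrs s"
  by (induction n) auto

lemma vars_den_reset_vars [simp]:
  "vars (den w (reset_vars n) s) = (\<lambda>x. if x < n then 0 else vars s x)"
  by (induction n) (auto simp: fun_eq_iff)

text \<open>The clock doubles as the height of the log. Loop iterations advance it without writing
  an entry, so stale addresses are cleared too; this is harmless, because the cells below
  \<open>B\<close> are meant to become zero.\<close>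

definition clear_memory :: "nat \<Rightarrow> com" where
  "clear_memory B = While (Var B) (Seq (Assign B (Op Minus (Var B) (Const 1))) (clear_cells B B))"

lemma runs_clear_memory:
  assumes "clock_ok w B s" and "vars s B \<le> int T"
  shows "runs w (T * (2 * B + 4) + 1) 0 (clear_memory B) s
    (\<lambda>s'. (\<forall>x. x \<noteq> B \<longrightarrow> vars s' x = vars s x) \<and> frame B s s' \<and>
      (\<forall>a<B. \<forall>z. arrs s' a z =
         (if \<exists>h. 0 \<le> h \<and> h < vars s B \<and> arrs s B h = z then 0 else arrs s a z)))"
    (is "runs _ _ _ _ _ ?Q")
proof -
  obtain N where N: "vars s B = int N" "N \<le> T"
    using assms by (metis clock_ok_def of_nat_le_iff zero_le_imp_eq_int)
  define I where "I i s' \<longleftrightarrow> i \<le> N \<and> vars s' B = int (N - i) \<and> (\<forall>x. x \<noteq> B \<longrightarrow> vars s' x = vars s x) \<and>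
      frame B s s' \<and> arrs s' B = arrs s B \<and> (\<forall>a<B. \<forall>z. arrs s' a z =
         (if \<exists>h. int (N - i) \<le> h \<and> h < int N \<and> arrs s B h = z then 0 else arrs s a z))" for i s'
  have "runs w ((N - 0) * (2 * B + 2 + 2) + 1) (\<Sum>i=0..<N. 0) (clear_memory B) s ?Q"
    unfolding clear_memory_def
  proof (rule runs_While[where I = I])
    show "I 0 s" by (auto simp: I_def N)
    fix i s'
    assume i: "i < N" and I: "I i s'"
    let ?c = "Seq (Assign B (Op Minus (Var B) (Const 1))) (clear_cells B B)"
    have w: "int N < 2 ^ w" "0 < w"
      using assms N(1) unfolding clock_ok_def by linarith+
    have v: "vars s' B = int (N - i)" using I by (simp add: I_def)
    have e: "exp_val w s' (Op Minus (Var B) (Const 1)) = int (N - Suc i)"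
    proof -
      have "vars s' B - 1 = int (N - Suc i)" using i v by simp
      moreover have "int (N - Suc i) \<le> int N" by simp
      then have "int (N - Suc i) < 2 ^ w" using w by linarith
      ultimately show ?thesis using w by (simp add: wrap_id)
    qed
    have "I (Suc i) (den w ?c s')"
    proof -
      have "(\<exists>h. int (N - Suc i) \<le> h \<and> h < int N \<and> arrs s B h = z) \<longleftrightarrow>
          arrs s B (int (N - Suc i)) = z \<or> (\<exists>h. int (N - i) \<le> h \<and> h < int N \<and> arrs s B h = z)" for z
      proof -
        have "int (N - Suc i) \<le> h \<and> h < int N \<longleftrightarrow>
            h = int (N - Suc i) \<or> (int (N - i) \<le> h \<and> h < int N)" for h
          using i by auto
        then show ?thesis by metis
      qed
      then show ?thesis
        using I i unfolding I_def
        by (auto simp: arrs_den_clear_cells frame_def e simp del: exp_val.simps)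
    qed
    then show "exp_val w s' (Var B) \<noteq> 0 \<and> runs w (2 * B + 2) 0 ?c s' (I (Suc i))"
      using runs_den[of ?c "I (Suc i)" w s'] i v by (simp add: loopfree_clear_cells)
  qed (auto simp: I_def N)
  then show ?thesis
    by (rule runs_weaken) (use N mult_le_mono1[of N T "2 * B + 4"] in \<open>auto simp: algebra_simps\<close>)
qed

section \<open>Straight-line programs for a kSUM instance\<close>

text \<open>Computing the strings is reduced to guessing a closed form \<open>f\<close> that
  satisfies the recursion given by the rules.\<close>

lemma slp_strings_map:
  assumes "\<And>x. x < n \<Longrightarrow> f x = (case R x of Term \<sigma> \<Rightarrow> [\<sigma>] | Cat i j \<Rightarrow> f i @ f j)"
    and "\<And>x i j. x < n \<Longrightarrow> R x = Cat i j \<Longrightarrow> i < x \<and> j < x"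
  shows "slp_strings (map R [0..<n]) = map f [0..<n]"
  using assms
proof (induction n)
  case (Suc n)
  have "f n = (case R n of Term \<sigma> \<Rightarrow> [\<sigma>] | Cat i j \<Rightarrow> map f [0..<n] ! i @ map f [0..<n] ! j)"
    using Suc.prems(1)[of n] Suc.prems(2)[of n] by (auto split: rule.splits)
  then show ?case
    using Suc by (simp add: slp_strings_def)
qed (simp add: slp_strings_def)

text \<open>The padding on both sides always adds up to 2^b - 1, so that the length does not reveal
  the shift and copies with different shifts stay aligned. Only the lowest \<open>b\<close> bits of
  \<open>a\<close> count, which allows a shift to be built bit by bit.\<close>

definition shifted :: "nat \<Rightarrow> nat \<Rightarrow> int list \<Rightarrow> int list" where
  "shifted b a ws = replicate (a mod 2 ^ b) 0 @ ws @ replicate (2 ^ b - 1 - a mod 2 ^ b) 0"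

lemma shifted_0 [simp]: "shifted 0 a ws = ws"
  by (simp add: shifted_def)

text \<open>Bit \<open>b\<close> of \<open>a\<close> decides on which side the 2^b zeros go, so one
  rule suffices per bit.\<close>

lemma shifted_Suc:
  "shifted (Suc b) a ws =
     (if odd (a div 2 ^ b) then replicate (2 ^ b) 0 @ shifted b a ws
      else shifted b a ws @ replicate (2 ^ b) 0)"
proof -
  have "a mod 2 ^ b < 2 ^ b" by simp
  then obtain d where d: "2 ^ b = Suc (a mod 2 ^ b + d)"
    using less_imp_Suc_add by blast
  have "a mod 2 ^ Suc b = 2 ^ b * (a div 2 ^ b mod 2) + a mod 2 ^ b"
    by (simp only: power_Suc2 mod_mult2_eq)
  then have r: "a mod 2 ^ Suc b = (if odd (a div 2 ^ b) then 2 ^ b else 0) + a mod 2 ^ b"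
    by (simp only: odd_iff_mod_2_eq_one) auto
  have "2 ^ Suc b - 1 - (2 ^ b + a mod 2 ^ b) = d" "2 ^ Suc b - 1 - (0 + a mod 2 ^ b) = d + 2 ^ b"
      "2 ^ b - 1 - a mod 2 ^ b = d"
    unfolding power_Suc using d by linarith+
  then show ?thesis
    unfolding shifted_def r by (simp only: replicate_add append_assoc if_split) (simp add: replicate_add)
qed

lemma length_shifted [simp]: "length (shifted b a ws) = length ws + (2 ^ b - 1)"
proof -
  have "a mod 2 ^ b < 2 ^ b" by simp
  then obtain d where d: "2 ^ b = Suc (a mod 2 ^ b + d)"
    using less_imp_Suc_add by blast
  then have "2 ^ b - 1 - a mod 2 ^ b = d" "2 ^ b - 1 = a mod 2 ^ b + d" by linarith+
  then show ?thesis unfolding shifted_def length_append length_replicate by simp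
qed

text \<open>
  Level \<open>Suc i\<close> contains \<open>m\<close> copies of level \<open>i\<close>, the \<open>j\<close>-th one shifted by \<open>sh (i * m + j)\<close>.
  Hence the ones of level \<open>k\<close> correspond to the \<open>k\<close>-tuples, each displaced by the sum of its shifts.
\<close>

primrec level :: "nat \<Rightarrow> nat \<Rightarrow> (nat \<Rightarrow> nat) \<Rightarrow> nat \<Rightarrow> int list" where
  "level l m sh 0 = [1]"
| "level l m sh (Suc i) = 0 # concat (map (\<lambda>j. shifted l (sh (i * m + j)) (level l m sh i)) [0..<m])"

text \<open>
  Rule \<open>b < l\<close> generates \<open>2 ^ b\<close> zeros and rule \<open>l\<close> a single one. Then comes a block of \<open>l + 1\<close> rules
  for each \<open>q < k * m\<close>: its rule number \<open>b < l\<close> puts \<open>2 ^ b\<close> zeros before or after the preceding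
  string, depending on bit \<open>b\<close> of \<open>sh q\<close>, and its last rule appends the result to the level under
  construction. The rules from \<open>sz\<close> on pad the program to \<open>n\<close> rules. The strings do not depend on \<open>n\<close>.
\<close>

definition level_rule :: "nat \<Rightarrow> nat \<Rightarrow> nat \<Rightarrow> nat \<Rightarrow> (nat \<Rightarrow> nat) \<Rightarrow> nat \<Rightarrow> int rule" where
  "level_rule l m sz n sh x =
    (if x = 0 then Term 0 else if x < l then Cat (x - 1) (x - 1) else if x = l then Term 1
     else if x < sz then
       let q = (x - (l + 1)) div (l + 1); b = (x - (l + 1)) mod (l + 1) in
       if b < l then
         let c = (if b = 0 then l + q div m * (m * (l + 1)) else x - 1) in
         if odd (sh q div 2 ^ b) then Cat b c else Cat c b
       else Cat (if q mod m = 0 then 0 else x - (l + 1)) (x - 1)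
     else if x + 1 < n then Term 0 else Cat (sz - 1) 0)"

definition level_slp :: "nat \<Rightarrow> nat \<Rightarrow> nat \<Rightarrow> nat \<Rightarrow> (nat \<Rightarrow> nat) \<Rightarrow> int slp" where
  "level_slp l m sz n sh = map (level_rule l m sz n sh) [0..<n]"

lemma length_level_slp [simp]: "length (level_slp l m sz n sh) = n"
  by (simp add: level_slp_def)

text \<open>The leading zero stems from the fact that no rule generates the empty string: the
  concatenation of the copies has to start from some string, and rule 0 provides it.\<close>

definition level_prefix :: "nat \<Rightarrow> nat \<Rightarrow> (nat \<Rightarrow> nat) \<Rightarrow> nat \<Rightarrow> nat \<Rightarrow> int list" where
  "level_prefix l m sh i r =
     0 # concat (map (\<lambda>j. shifted l (sh (i * m + j)) (level l m sh i)) [0..<r])"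

text \<open>The closed form of the generated strings that \<open>slp_strings_map\<close> asks
  for.\<close>

definition level_string :: "nat \<Rightarrow> nat \<Rightarrow> nat \<Rightarrow> nat \<Rightarrow> nat \<Rightarrow> (nat \<Rightarrow> nat) \<Rightarrow> nat \<Rightarrow> int list" where
  "level_string l m k sz n sh x =
    (if x < l then replicate (2 ^ x) 0 else if x = l then [1]
     else if x < sz then
       let q = (x - (l + 1)) div (l + 1); b = (x - (l + 1)) mod (l + 1) in
       if b < l then shifted (Suc b) (sh q) (level l m sh (q div m))
       else level_prefix l m sh (q div m) (Suc (q mod m))
     else if x + 1 < n then [0] else level l m sh k @ [0])"

context
  fixes l m k sz n :: nat and sh :: "nat \<Rightarrow> nat"
  assumes l: "0 < l" and m: "0 < m" and k: "0 < k" and sz: "sz = (l + 1) * (k * m + 1)" and n: "sz < n"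
begin

lemma level_string_block:
  assumes "b \<le> l" and "q < k * m"
  shows "level_string l m k sz n sh ((l + 1) * (q + 1) + b) =
     (if b < l then shifted (Suc b) (sh q) (level l m sh (q div m))
      else level_prefix l m sh (q div m) (Suc (q mod m)))"
proof -
  have x: "(l + 1) * (q + 1) + b - (l + 1) = b + (l + 1) * q" by (simp add: algebra_simps)
  have "(l + 1) * (q + 1) + b < (l + 1) * (q + 2)" using assms by (simp add: algebra_simps)
  also have "\<dots> \<le> (l + 1) * (k * m + 1)" by (rule mult_le_mono2) (use assms in simp)
  finally have sz': "(l + 1) * (q + 1) + b < sz" by (simp add: sz)
  have "(b + (l + 1) * q) div (l + 1) = q" "(b + (l + 1) * q) mod (l + 1) = b"
    using assms(1) by (simp_all only: div_mult_self2 mod_mult_self2) auto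
  then show ?thesis
    using sz' unfolding level_string_def Let_def x by simp
qed

lemma level_rule_block:
  assumes "b \<le> l" and "q < k * m"
  shows "level_rule l m sz n sh ((l + 1) * (q + 1) + b) =
     (if b < l then
         let c = (if b = 0 then l + q div m * (m * (l + 1)) else (l + 1) * (q + 1) + (b - 1)) in
         if odd (sh q div 2 ^ b) then Cat b c else Cat c b
       else Cat (if q mod m = 0 then 0 else (l + 1) * q + l) ((l + 1) * (q + 1) + (l - 1)))"
proof -
  have x: "(l + 1) * (q + 1) + b - (l + 1) = b + (l + 1) * q" by (simp add: algebra_simps)
  have "(l + 1) * (q + 1) + b < (l + 1) * (q + 2)" using assms by (simp add: algebra_simps)
  also have "\<dots> \<le> (l + 1) * (k * m + 1)" by (rule mult_le_mono2) (use assms in simp)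
  finally have sz': "(l + 1) * (q + 1) + b < sz" by (simp add: sz)
  have "(b + (l + 1) * q) div (l + 1) = q" "(b + (l + 1) * q) mod (l + 1) = b"
    using assms(1) by (simp_all only: div_mult_self2 mod_mult_self2) auto
  then show ?thesis
    using sz' l assms(1) unfolding level_rule_def Let_def x by (auto simp: algebra_simps)
qed

lemma block_index:
  assumes "l < x" and "x < sz"
  obtains q b where "x = (l + 1) * (q + 1) + b" and "b \<le> l" and "q < k * m"
proof
  let ?q = "(x - (l + 1)) div (l + 1)" and ?b = "(x - (l + 1)) mod (l + 1)"
  have "x = (l + 1) + (x - (l + 1))" using assms by simp
  also have "x - (l + 1) = (l + 1) * ?q + ?b" by (simp only: mult_div_mod_eq)
  finally show x: "x = (l + 1) * (?q + 1) + ?b" by (simp add: algebra_simps)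
  show "?b \<le> l" using mod_less_divisor[of "l + 1" "x - (l + 1)"] by linarith
  have "(l + 1) * (?q + 1) < (l + 1) * (k * m + 1)"
    using x assms(2) unfolding sz by linarith
  then show "?q < k * m" by (simp only: mult_less_cancel1) simp
qed

text \<open>Level \<open>i\<close> is complete at the last rule of block \<open>i * m - 1\<close>.
  The same formula gives rule \<open>l\<close>, the single one, for \<open>i = 0\<close>, so the
  first rule of a block needs no special case for the lowest level.\<close>

lemma level_string_level:
  assumes "i \<le> k"
  shows "level_string l m k sz n sh (l + i * (m * (l + 1))) = level l m sh i"
proof (cases i)
  case 0
  then show ?thesis using l by (simp add: level_string_def)
next
  case (Suc i')
  obtain m' where m': "m = Suc m'" using m by (cases m) auto
  define q where "q = i' * m + m'"
  have "q < Suc i' * m" by (simp add: q_def m')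
  also have "\<dots> \<le> k * m" using assms Suc by (intro mult_le_mono1) simp
  finally have "q < k * m" .
  have idx: "l + i * (m * (l + 1)) = (l + 1) * (q + 1) + l"
    by (simp add: Suc q_def m' algebra_simps)
  have "q div m = i'" "q mod m = m'"
    by (simp_all add: q_def m' div_mult_self3 flip: mult_Suc_right)
  then show ?thesis
    unfolding idx level_string_block[OF order_refl \<open>q < k * m\<close>]
    by (simp add: Suc level_prefix_def m')
qed

lemma level_string_rule:
  assumes "x < n"
  shows "level_string l m k sz n sh x = (case level_rule l m sz n sh x of Term \<sigma> \<Rightarrow> [\<sigma>]
           | Cat i j \<Rightarrow> level_string l m k sz n sh i @ level_string l m k sz n sh j)" (is ?A)
    and "level_rule l m sz n sh x = Cat i j \<Longrightarrow> i < x \<and> j < x"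
    and "level_rule l m sz n sh x = Term \<sigma> \<Longrightarrow> \<sigma> \<in> {0, 1}"
proof -
  have lsz: "l < sz" by (simp add: sz)
  have "?A \<and> (\<forall>i j. level_rule l m sz n sh x = Cat i j \<longrightarrow> i < x \<and> j < x) \<and>
     (\<forall>\<sigma>. level_rule l m sz n sh x = Term \<sigma> \<longrightarrow> \<sigma> \<in> {0, 1})"
  proof -
    consider "x = 0" | "0 < x" "x < l" | "x = l" | "l < x" "x < sz" | "sz \<le> x" "x + 1 < n" | "sz \<le> x" "x + 1 = n"
      using assms by linarith
    then show ?thesis
    proof cases
      case 2
      then obtain y where "x = Suc y" by (cases x) auto
      then show ?thesis using 2
        by (simp add: level_rule_def level_string_def replicate_add[symmetric] mult_2)
    next
      case 4
      then obtain q b where x: "x = (l + 1) * (q + 1) + b" and b: "b \<le> l" and q: "q < k * m"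
        by (rule block_index)
      show ?thesis
      proof (cases "b < l")
        case True
        define c where "c = (if b = 0 then l + q div m * (m * (l + 1)) else (l + 1) * (q + 1) + (b - 1))"
        have qk: "q div m \<le> k" using q by (simp add: less_mult_imp_div_less less_imp_le)
        have "q div m * m \<le> q" by simp
        then have "q div m * (m * (l + 1)) \<le> (l + 1) * q"
          using mult_le_mono2[of "q div m * m" q "l + 1"] by (simp add: algebra_simps)
        then have c: "c < x" using b by (auto simp: c_def x)
        have "level_string l m k sz n sh c = shifted b (sh q) (level l m sh (q div m))"
        proof (cases b)
          case 0
          then show ?thesis using level_string_level[OF qk] by (simp add: c_def)
        next
          case (Suc b')
          then show ?thesis using level_string_block[of b' q] q b by (simp add: c_def)
        qed
        moreover have "level_string l m k sz n sh b = replicate (2 ^ b) 0"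
          using True by (simp add: level_string_def)
        moreover have "level_string l m k sz n sh x = shifted (Suc b) (sh q) (level l m sh (q div m))"
          using level_string_block[OF b q] True by (simp add: x)
        moreover have "level_rule l m sz n sh x = (if odd (sh q div 2 ^ b) then Cat b c else Cat c b)"
          using level_rule_block[OF b q] True by (simp only: x c_def Let_def if_True)
        moreover have "b < x" using True 4 by simp
        ultimately show ?thesis using c by (simp add: shifted_Suc)
      next
        case False
        then have bl: "b = l" using b by simp
        define c where "c = (if q mod m = 0 then 0 else (l + 1) * q + l)"
        define d where "d = (l + 1) * (q + 1) + (l - 1)"
        have rl: "level_rule l m sz n sh x = Cat c d"
          using level_rule_block[OF b q] by (simp only: x bl c_def d_def if_False less_irrefl)
        have "c < x" "d < x" using l by (auto simp: c_def d_def x bl)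
        moreover have "level_string l m k sz n sh d = shifted l (sh q) (level l m sh (q div m))"
          using level_string_block[of "l - 1" q] q l by (simp add: d_def)
        moreover have "level_string l m k sz n sh c = level_prefix l m sh (q div m) (q mod m)"
        proof (cases "q mod m = 0")
          case True
          then show ?thesis using l by (simp add: c_def level_string_def level_prefix_def)
        next
          case False
          then obtain q' where q': "q = Suc q'" by (cases q) auto
          \<comment> \<open>Block \<open>q\<close> does not open a level, so the block before it
            belongs to the same level and ends with the copies assembled so far.\<close>
          have "Suc q' mod m = Suc (q' mod m)" "Suc q' div m = q' div m"
            using False by (auto simp: q' mod_Suc div_Suc split: if_splits)
          then show ?thesis
            using level_string_block[of l q'] q False by (simp add: c_def q')
        qed
        moreover have "level_string l m k sz n sh x =
            level_prefix l m sh (q div m) (q mod m) @ shifted l (sh q) (level l m sh (q div m))"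
          using level_string_block[OF b q] by (simp add: x bl level_prefix_def)
        ultimately show ?thesis by (simp add: rl)
      qed
    next
      case 6
      have "sz - 1 = l + k * (m * (l + 1))" by (simp add: sz algebra_simps)
      then have "level_string l m k sz n sh (sz - 1) = level l m sh k"
        using level_string_level[of k] by simp
      then show ?thesis
        using 6 l lsz by (simp add: level_rule_def level_string_def)
    qed (use l lsz in \<open>auto simp: level_rule_def level_string_def\<close>)
  qed
  then show ?A "level_rule l m sz n sh x = Cat i j \<Longrightarrow> i < x \<and> j < x"
      "level_rule l m sz n sh x = Term \<sigma> \<Longrightarrow> \<sigma> \<in> {0, 1}"
    by blast+
qed

lemma slp_level_slp:
  assumes "{0, 1} \<subseteq> \<Sigma>"
  shows "slp \<Sigma> (level_slp l m sz n sh)"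
proof -
  have "case level_rule l m sz n sh x of Term \<sigma> \<Rightarrow> \<sigma> \<in> \<Sigma> | Cat i j \<Rightarrow> i < x \<and> j < x" if x: "x < n" for x
  proof (cases "level_rule l m sz n sh x")
    case (Term \<sigma>)
    then show ?thesis using level_string_rule(3)[OF x Term] assms by auto
  next
    case (Cat i j)
    then show ?thesis using level_string_rule(2)[OF x Cat] by simp
  qed
  then show ?thesis
    using n by (simp add: slp_def level_slp_def)
qed

text \<open>After the padding the last rule must refer back to the finished level. Rules have two
  parts, hence the additional zero, which does not affect the inner product.\<close>

lemma slp_string_level_slp: "slp_string (level_slp l m sz n sh) = level l m sh k @ [0]"
proof -
  have "slp_strings (level_slp l m sz n sh) = map (level_string l m k sz n sh) [0..<n]"
    unfolding level_slp_def by (rule slp_strings_map) (use level_string_rule in auto)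
  then have "slp_string (level_slp l m sz n sh) = level_string l m k sz n sh (n - 1)"
    using n by (simp add: slp_string_def last_map)
  also have "\<dots> = level l m sh k @ [0]"
  proof -
    have "l < sz" by (simp add: sz)
    then show ?thesis using n by (simp add: level_string_def)
  qed
  finally show ?thesis .
qed

end

text \<open>Independence of the shifts gives both vectors the same dimension and puts the copies of
  a tuple at the same offset in both.\<close>

primrec level_length :: "nat \<Rightarrow> nat \<Rightarrow> nat \<Rightarrow> nat" where
  "level_length l m 0 = 1"
| "level_length l m (Suc i) = 1 + m * (level_length l m i + (2 ^ l - 1))"

lemma length_level [simp]: "length (level l m sh i) = level_length l m i"
proof (induction i)
  case (Suc i)
  have "length (level l m sh (Suc i)) =
      1 + sum_list (map (\<lambda>j. length (shifted l (sh (i * m + j)) (level l m sh i))) [0..<m])"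
    by (simp add: length_concat comp_def del: length_shifted)
  also have "\<dots> = 1 + m * (level_length l m i + (2 ^ l - 1))"
    unfolding length_shifted Suc.IH sum_list_triv by simp
  finally show ?case by simp
qed simp

section \<open>Positions of the ones, and what the inner product detects\<close>

definition ones :: "int list \<Rightarrow> nat set" where
  "ones ws = {p. p < length ws \<and> ws ! p = 1}"

lemma ones_append: "ones (us @ vs) = ones us \<union> (+) (length us) ` ones vs"
proof (rule set_eqI)
  fix p
  show "p \<in> ones (us @ vs) \<longleftrightarrow> p \<in> ones us \<union> (+) (length us) ` ones vs"
  proof (cases "p < length us")
    case True
    then show ?thesis by (simp add: ones_def nth_append image_iff)
  next
    case False
    then obtain p' where "p = length us + p'" by (metis le_Suc_ex not_less)
    then show ?thesis by (simp add: ones_def nth_append image_iff)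
  qed
qed

lemma ones_replicate_0 [simp]: "ones (replicate c 0) = {}"
  by (auto simp: ones_def)

lemma ones_Cons_0 [simp]: "ones (0 # ws) = Suc ` ones ws"
  using ones_append[of "[0]" ws] ones_replicate_0[of 1] by simp

lemma ones_snoc_0 [simp]: "ones (ws @ [0]) = ones ws"
  using ones_replicate_0[of 1] by (simp add: ones_append)

lemma ones_shifted: "a < 2 ^ b \<Longrightarrow> ones (shifted b a ws) = (+) a ` ones ws"
  by (simp add: shifted_def ones_append)

lemma ones_concat:
  assumes "\<And>j. j < r \<Longrightarrow> length (g j) = d"
  shows "ones (concat (map g [0..<r])) = (\<Union>j<r. (+) (j * d) ` ones (g j))"
  using assms
proof (induction r)
  case (Suc r)
  have "length (concat (map g [0..<r])) = sum_list (map (\<lambda>j. length (g j)) [0..<r])"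
    by (simp add: length_concat comp_def)
  also have "\<dots> = sum_list (map (\<lambda>_. d) [0..<r])"
    using Suc.prems by (intro arg_cong[where f = sum_list] map_cong) auto
  finally have "length (concat (map g [0..<r])) = r * d"
    by (simp add: sum_list_triv)
  with Suc show ?case by (simp add: ones_append lessThan_Suc Un_commute)
qed (simp add: ones_def)

text \<open>On each level a one is moved by 1 for the leading zero, by the lengths of the copies in
  front of the chosen one, and by the shift of that copy.\<close>

lemma ones_level:
  assumes "\<And>q. q < i * m \<Longrightarrow> sh q < 2 ^ l"
  shows "p \<in> ones (level l m sh i) \<longleftrightarrow>
    (\<exists>J. (\<forall>t<i. J t < m) \<and>
       p = (\<Sum>t<i. 1 + J t * (level_length l m t + (2 ^ l - 1)) + sh (t * m + J t)))"
  using assms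
proof (induction i arbitrary: p)
  case 0
  then show ?case by (auto simp: ones_def)
next
  case (Suc i)
  let ?D = "\<lambda>t. level_length l m t + (2 ^ l - 1)"
  let ?f = "\<lambda>J t. 1 + J t * ?D t + sh (t * m + J t)"
  have IH: "p \<in> ones (level l m sh i) \<longleftrightarrow> (\<exists>J. (\<forall>t<i. J t < m) \<and> p = (\<Sum>t<i. ?f J t))" for p
    using Suc by simp
  have "ones (level l m sh (Suc i)) =
      Suc ` (\<Union>j<m. (+) (j * ?D i) ` ones (shifted l (sh (i * m + j)) (level l m sh i)))"
    using ones_concat[of m "\<lambda>j. shifted l (sh (i * m + j)) (level l m sh i)" "?D i"] by simp
  also have "\<dots> = Suc ` (\<Union>j<m. (+) (j * ?D i) ` (+) (sh (i * m + j)) ` ones (level l m sh i))"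
    using Suc.prems by (simp add: ones_shifted)
  finally have "p \<in> ones (level l m sh (Suc i)) \<longleftrightarrow>
      (\<exists>j<m. \<exists>p'\<in>ones (level l m sh i). p = p' + (1 + j * ?D i + sh (i * m + j)))"
    by (force simp: image_iff)
  also have "\<dots> \<longleftrightarrow> (\<exists>j<m. \<exists>J. (\<forall>t<i. J t < m) \<and>
      p = (\<Sum>t<i. ?f J t) + (1 + j * ?D i + sh (i * m + j)))"
    unfolding Bex_def IH by blast
  also have "\<dots> \<longleftrightarrow> (\<exists>J. (\<forall>t<Suc i. J t < m) \<and> p = (\<Sum>t<Suc i. ?f J t))" (is "?L \<longleftrightarrow> ?R")
  proof
    assume ?L
    then obtain j J where j: "j < m" and J: "\<forall>t<i. J t < m"
      and p: "p = (\<Sum>t<i. ?f J t) + (1 + j * ?D i + sh (i * m + j))" by blast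
    have "(\<Sum>t<i. ?f (J(i := j)) t) = (\<Sum>t<i. ?f J t)"
      by (rule sum.cong) auto
    then show ?R
      using j J p by (intro exI[of _ "J(i := j)"]) auto
  next
    assume ?R
    then obtain J where "\<forall>t<Suc i. J t < m" "p = (\<Sum>t<Suc i. ?f J t)" by blast
    then show ?L by (intro exI[of _ "J i"] conjI exI[of _ J]) auto
  qed
  finally show ?case .
qed

lemma offset_less:
  assumes "\<And>t. t < i \<Longrightarrow> J t < m"
  shows "(\<Sum>t<i. J t * (level_length l m t + (2 ^ l - 1))) < level_length l m i"
  using assms
proof (induction i)
  case (Suc i)
  let ?D = "level_length l m i + (2 ^ l - 1)"
  have "(\<Sum>t<i. J t * (level_length l m t + (2 ^ l - 1))) + J i * ?D \<le> (J i + 1) * ?D"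
    using Suc by simp
  also have "\<dots> \<le> m * ?D" by (rule mult_le_mono1) (use Suc.prems[of i] in simp)
  finally show ?case by simp
qed simp

text \<open>The offsets are numbers in a mixed radix system with digits \<open>J t\<close>. Each
  place value leaves room for a further 2^l - 1, so adding \<open>a\<close> never causes a carry,
  and the top digit is recovered by division.\<close>

lemma offset_unique:
  assumes "\<And>t. t < i \<Longrightarrow> J t < m" and "\<And>t. t < i \<Longrightarrow> J' t < m" and "a < 2 ^ l" and "a' < 2 ^ l"
    and "(\<Sum>t<i. J t * (level_length l m t + (2 ^ l - 1))) + a =
         (\<Sum>t<i. J' t * (level_length l m t + (2 ^ l - 1))) + a'"
  shows "(\<forall>t<i. J t = J' t) \<and> a = a'"
  using assms
proof (induction i)
  case (Suc i)
  let ?D = "level_length l m i + (2 ^ l - 1)"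
  let ?o = "\<lambda>J. (\<Sum>t<i. J t * (level_length l m t + (2 ^ l - 1)))"
  have lt: "?o J + a < ?D" "?o J' + a' < ?D"
    using offset_less[of i J m l] offset_less[of i J' m l] Suc.prems by (auto simp: less_Suc_eq)
  have eq: "?o J + a + J i * ?D = ?o J' + a' + J' i * ?D"
    using Suc.prems(5) by simp
  have "J i = (?o J + a + J i * ?D) div ?D" using lt by simp
  also have "\<dots> = J' i" unfolding eq using lt by simp
  finally have "J i = J' i" .
  moreover have "(\<forall>t<i. J t = J' t) \<and> a = a'"
    by (rule Suc.IH) (use Suc.prems eq calculation in auto)
  ultimately show ?case by (auto simp: less_Suc_eq)
qed simp

lemma set_level: "set (level l m sh i) \<subseteq> {0, 1}"
  by (induction i) (auto simp: shifted_def)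

lemma inner_prod_nonzero_iff:
  assumes "set us \<subseteq> {0, 1}" and "set vs \<subseteq> {0, 1}" and "length us = length vs"
  shows "inner_prod us vs \<noteq> 0 \<longleftrightarrow> ones us \<inter> ones vs \<noteq> {}"
proof -
  have 01: "us ! i \<in> {0, 1}" "vs ! i \<in> {0, 1}" if "i < length us" for i
    using assms that nth_mem by (metis subsetD)+
  have "inner_prod us vs = 0 \<longleftrightarrow> (\<forall>i<length us. us ! i * vs ! i = 0)"
    unfolding inner_prod_def using 01 by (subst sum_nonneg_eq_0_iff) fastforce+
  then show ?thesis
    using 01 assms(3) by (fastforce simp: ones_def)
qed

text \<open>A common one determines its offset and its total shift uniquely, by
  \<open>offset_unique\<close>. Hence it belongs to the same tuple in both strings, with equal sums
  of shifts.\<close>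

lemma inner_prod_levels_nonzero_iff:
  assumes "\<And>q. q < i * m \<Longrightarrow> sh q < 2 ^ l" and "\<And>q. q < i * m \<Longrightarrow> sh' q < 2 ^ l"
    and "\<And>J. (\<And>t. t < i \<Longrightarrow> J t < m) \<Longrightarrow> (\<Sum>t<i. sh (t * m + J t)) < 2 ^ l"
    and "\<And>J. (\<And>t. t < i \<Longrightarrow> J t < m) \<Longrightarrow> (\<Sum>t<i. sh' (t * m + J t)) < 2 ^ l"
  shows "inner_prod (level l m sh i @ [0]) (level l m sh' i @ [0]) \<noteq> 0 \<longleftrightarrow>
    (\<exists>J. (\<forall>t<i. J t < m) \<and> (\<Sum>t<i. sh (t * m + J t)) = (\<Sum>t<i. sh' (t * m + J t)))"
proof -
  let ?o = "\<lambda>J. \<Sum>t<i. J t * (level_length l m t + (2 ^ l - 1))"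
  have ex_common: "(\<exists>p. (\<exists>J. V J \<and> p = f J) \<and> (\<exists>J. V J \<and> p = g J)) \<longleftrightarrow>
      (\<exists>J J'. V J \<and> V J' \<and> f J = g J')" for V f g :: "(nat \<Rightarrow> nat) \<Rightarrow> _"
    by auto
  have split: "(\<Sum>t<i. 1 + J t * (level_length l m t + (2 ^ l - 1)) + f (t * m + J t)) =
      i + (?o J + (\<Sum>t<i. f (t * m + J t)))" for J f
    by (simp add: sum.distrib sum_Suc)
  have o1: "p \<in> ones (level l m sh i) \<longleftrightarrow> (\<exists>J. (\<forall>t<i. J t < m) \<and>
      p = (\<Sum>t<i. 1 + J t * (level_length l m t + (2 ^ l - 1)) + sh (t * m + J t)))" for p
    by (rule ones_level) (rule assms(1))
  have o2: "p \<in> ones (level l m sh' i) \<longleftrightarrow> (\<exists>J. (\<forall>t<i. J t < m) \<and>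
      p = (\<Sum>t<i. 1 + J t * (level_length l m t + (2 ^ l - 1)) + sh' (t * m + J t)))" for p
    by (rule ones_level) (rule assms(2))
  have "inner_prod (level l m sh i @ [0]) (level l m sh' i @ [0]) \<noteq> 0 \<longleftrightarrow>
      ones (level l m sh i) \<inter> ones (level l m sh' i) \<noteq> {}"
    using set_level by (subst inner_prod_nonzero_iff) auto
  also have "\<dots> \<longleftrightarrow> (\<exists>p. p \<in> ones (level l m sh i) \<and> p \<in> ones (level l m sh' i))"
    by blast
  also have "\<dots> \<longleftrightarrow> (\<exists>J J'. (\<forall>t<i. J t < m) \<and> (\<forall>t<i. J' t < m) \<and>
      i + (?o J + (\<Sum>t<i. sh (t * m + J t))) = i + (?o J' + (\<Sum>t<i. sh' (t * m + J' t))))"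
    unfolding o1 o2 split by (rule ex_common)
  also have "\<dots> \<longleftrightarrow> (\<exists>J J'. (\<forall>t<i. J t < m) \<and> (\<forall>t<i. J' t < m) \<and>
      ?o J + (\<Sum>t<i. sh (t * m + J t)) = ?o J' + (\<Sum>t<i. sh' (t * m + J' t)))"
    by (simp only: add_left_cancel)
  also have "\<dots> \<longleftrightarrow> (\<exists>J. (\<forall>t<i. J t < m) \<and> (\<Sum>t<i. sh (t * m + J t)) = (\<Sum>t<i. sh' (t * m + J t)))"
    (is "?L \<longleftrightarrow> ?R")
  proof
    assume ?L
    then obtain J J' where J: "\<forall>t<i. J t < m" "\<forall>t<i. J' t < m"
      and eq: "?o J + (\<Sum>t<i. sh (t * m + J t)) = ?o J' + (\<Sum>t<i. sh' (t * m + J' t))" by blast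
    have "(\<forall>t<i. J t = J' t) \<and> (\<Sum>t<i. sh (t * m + J t)) = (\<Sum>t<i. sh' (t * m + J' t))"
      by (rule offset_unique[OF _ _ _ _ eq]) (use J assms(3,4) in auto)
    moreover from this have "(\<Sum>t<i. sh' (t * m + J' t)) = (\<Sum>t<i. sh' (t * m + J t))"
      by (intro sum.cong) auto
    ultimately show ?R using J by metis
  next
    assume ?R
    then obtain J where "\<forall>t<i. J t < m" "(\<Sum>t<i. sh (t * m + J t)) = (\<Sum>t<i. sh' (t * m + J t))"
      by blast
    then show ?L by (intro exI[of _ J]) simp
  qed
  finally show ?thesis .
qed

text \<open>With the summand 2^l included, each level multiplies the quantity by at most 2 * m, so
  the induction goes through.\<close>

lemma level_length_upper:
  assumes "0 < m"
  shows "level_length l m i + 2 ^ l \<le> (2 * m) ^ i * (2 ^ l + 1)"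
proof (induction i)
  case (Suc i)
  obtain m' where m': "m = Suc m'" using assms by (cases m) auto
  have "1 \<le> level_length l m i" by (cases i) auto
  moreover obtain L where L: "2 ^ l = Suc L" using not0_implies_Suc[of "2 ^ l"] by auto
  ultimately have "level_length l m (Suc i) + 2 ^ l \<le> 2 * m * (level_length l m i + 2 ^ l)"
    by (simp add: m' algebra_simps)
  also have "\<dots> \<le> 2 * m * ((2 * m) ^ i * (2 ^ l + 1))" using Suc by (rule mult_le_mono2)
  finally show ?case by (simp add: algebra_simps)
qed simp

lemma level_length_lower: "m ^ Suc i * (2 ^ l - 1) \<le> level_length l m (Suc i)"
proof (induction i)
  case (Suc i)
  have "m ^ Suc (Suc i) * (2 ^ l - 1) = m * (m ^ Suc i * (2 ^ l - 1))" by (simp add: mult.assoc)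
  also have "\<dots> \<le> m * level_length l m (Suc i)" using Suc by (rule mult_le_mono2)
  also have "\<dots> \<le> level_length l m (Suc (Suc i))"
    unfolding level_length.simps(2)[of l m "Suc i"]
    by (rule order_trans[OF mult_le_mono2[OF le_add1] le_add2])
  finally show ?case .
next
  case 0
  show ?case
    unfolding level_length.simps power_Suc0_right
    by (rule order_trans[OF mult_le_mono2[OF le_add2] le_add2])
qed

section \<open>Evaluation of expressions and generation of the rules\<close>

text \<open>This moves word arithmetic to natural numbers. The rules below carry the conditions that
  exclude wrap-around: values under 2^w are represented exactly.\<close>

definition evn :: "nat \<Rightarrow> state \<Rightarrow> exp \<Rightarrow> nat \<Rightarrow> bool" where
  "evn w s e v \<longleftrightarrow> exp_val w s e = int v"

lemma wrap_int [simp]: "v < 2 ^ w \<Longrightarrow> wrap w (int v) = int v"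
  by (rule wrap_id) simp_all

lemma evn_Const: "v < 2 ^ w \<Longrightarrow> evn w s (Const (int v)) v"
  by (simp add: evn_def)

lemma evn_Var: "vars s x = int v \<Longrightarrow> evn w s (Var x) v"
  by (simp add: evn_def)

lemma evn_Cell: "evn w s e i \<Longrightarrow> arrs s a (int i) = int v \<Longrightarrow> evn w s (Cell a e) v"
  by (simp add: evn_def)

lemma evn_Plus:
  "evn w s e1 v1 \<Longrightarrow> evn w s e2 v2 \<Longrightarrow> v1 + v2 < 2 ^ w \<Longrightarrow> evn w s (Op Plus e1 e2) (v1 + v2)"
  by (simp add: evn_def wrap_int flip: of_nat_add)

lemma evn_Times:
  "evn w s e1 v1 \<Longrightarrow> evn w s e2 v2 \<Longrightarrow> v1 * v2 < 2 ^ w \<Longrightarrow> evn w s (Op Times e1 e2) (v1 * v2)"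
  by (simp add: evn_def wrap_int flip: of_nat_mult)

lemma evn_Minus:
  "evn w s e1 v1 \<Longrightarrow> evn w s e2 v2 \<Longrightarrow> v2 \<le> v1 \<Longrightarrow> v1 < 2 ^ w \<Longrightarrow> evn w s (Op Minus e1 e2) (v1 - v2)"
  by (simp add: evn_def wrap_int flip: of_nat_diff)

lemma evn_Divide:
  "evn w s e1 v1 \<Longrightarrow> evn w s e2 v2 \<Longrightarrow> v1 < 2 ^ w \<Longrightarrow> evn w s (Op Divide e1 e2) (v1 div v2)"
  using le_less_trans[OF div_le_dividend[of v1 v2]] by (simp add: evn_def wrap_int flip: of_nat_div)

lemma evn_Modulo:
  "evn w s e1 v1 \<Longrightarrow> evn w s e2 v2 \<Longrightarrow> v1 < 2 ^ w \<Longrightarrow> evn w s (Op Modulo e1 e2) (v1 mod v2)"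
  using le_less_trans[OF mod_less_eq_dividend[of v1 v2]] by (simp add: evn_def wrap_int flip: of_nat_mod)

lemma evn_Less:
  "evn w s e1 v1 \<Longrightarrow> evn w s e2 v2 \<Longrightarrow> 0 < w \<Longrightarrow> evn w s (Op Less e1 e2) (of_bool (v1 < v2))"
  by (simp add: evn_def)

lemma evn_Equal:
  "evn w s e1 v1 \<Longrightarrow> evn w s e2 v2 \<Longrightarrow> 0 < w \<Longrightarrow> evn w s (Op Equal e1 e2) (of_bool (v1 = v2))"
  by (simp add: evn_def)

lemma int_mod_2: "int d mod 2 = of_bool (odd d)"
  by (cases "even d") (auto elim!: evenE oddE)

lemma evn_bit:
  assumes "evn w s e1 a" and "evn w s e2 b" and "a < 2 ^ w" and "0 < w"
  shows "evn w s (Op BitAnd (Op ShiftR e1 e2) (Const (int 1))) (of_bool (odd (a div 2 ^ b)))"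
proof -
  have "a div 2 ^ b < 2 ^ w" using assms(3) div_le_dividend le_less_trans by blast
  then have wr: "wrap w (int (a div 2 ^ b)) = int (a div 2 ^ b)" by (rule wrap_int)
  have "drop_bit b (int a) = int (a div 2 ^ b)"
    by (simp add: drop_bit_eq_div zdiv_int)
  then have "exp_val w s (Op ShiftR e1 e2) = int (a div 2 ^ b)"
    using assms(1,2) wr by (simp only: evn_def exp_val.simps(4) binop_val.simps nat_int)
  then show ?thesis
    using assms(4) int_mod_2[of "a div 2 ^ b"]
    by (simp only: evn_def exp_val.simps(4) binop_val.simps exp_val.simps(1) of_nat_1 wrap_1 and_one_eq
        wrap_bool of_nat_of_bool)
qed

lemma den_If_evn:
  "evn w s c (of_bool P) \<Longrightarrow> den w (If c p q) s = (if P then den w p s else den w q s)"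
  by (simp add: evn_def)

text \<open>The three fields of a rule are evaluated one after the other while array 0 is being
  written, so the later ones must not read that array.\<close>

primrec avoids_input :: "exp \<Rightarrow> bool" where
  "avoids_input (Const z) = True"
| "avoids_input (Var x) = True"
| "avoids_input (Cell a e) = (a \<noteq> 0 \<and> avoids_input e)"
| "avoids_input (Op f e1 e2) = (avoids_input e1 \<and> avoids_input e2)"

lemma exp_val_set_cell_0: "avoids_input e \<Longrightarrow> exp_val w (set_cell 0 i z s) e = exp_val w s e"
  by (induction e) auto

abbreviation C :: "nat \<Rightarrow> exp" where
  "C c \<equiv> Const (int c)"

text \<open>
  Above the memory of the given program, which occupies the variables and arrays below \<open>B\<close>, and
  above the clock (variables \<open>B\<close> and \<open>B + 1\<close>) and the log (array \<open>B\<close>), the reduction uses variables for: \<open>m\<close> (offset 2),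
  \<open>l\<close> (3), the candidate length \<open>n\<close> of the SLPs (4), the position \<open>q\<close> of the search (5), a counter
  \<open>x\<close> (6), the final answer (7), \<open>U\<close> (8), a power of two (9), the number of rules needed (10), an
  output pointer (11); and arrays for the kSUM instance (1) and the indices chosen so far (2).
\<close>

definition emit :: "nat \<Rightarrow> exp \<Rightarrow> exp \<Rightarrow> exp \<Rightarrow> com" where
  "emit B e1 e2 e3 =
     Seq (Store 0 (Var (B + 11)) e1)
    (Seq (Store 0 (Op Plus (Var (B + 11)) (C 1)) e2)
         (Store 0 (Op Plus (Var (B + 11)) (C 2)) e3))"

definition put_rule :: "nat \<Rightarrow> int rule \<Rightarrow> state \<Rightarrow> state" where
  "put_rule p r s =
     set_cell 0 (int p + 2) (rule_input r ! 2)
    (set_cell 0 (int p + 1) (rule_input r ! 1)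
    (set_cell 0 (int p) (rule_input r ! 0) s))"

lemma den_emit:
  assumes "evn w s e1 v1" "evn w s e2 v2" "evn w s e3 v3" and "avoids_input e2" "avoids_input e3"
    and "vars s (B + 11) = int p" and "p + 2 < 2 ^ w"
  shows "den w (emit B e1 e2 e3) s =
    set_cell 0 (int p + 2) (int v3) (set_cell 0 (int p + 1) (int v2) (set_cell 0 (int p) (int v1) s))"
proof -
  have "evn w s' (Op Plus (Var (B + 11)) (C 1)) (p + 1)" "evn w s' (Op Plus (Var (B + 11)) (C 2)) (p + 2)"
    if "vars s' = vars s" for s'
    by (intro evn_Plus evn_Var evn_Const; use assms(6,7) that in simp)+
  then show ?thesis
    using assms unfolding emit_def den.simps
    by (simp add: evn_def exp_val_set_cell_0 add.commute del: exp_val.simps(1,4))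
qed

definition level_size :: "nat \<Rightarrow> exp" where
  "level_size B = Op Plus (Var (B + 3)) (C 1)"

definition block_offset :: "nat \<Rightarrow> exp" where
  "block_offset B = Op Minus (Var (B + 6)) (level_size B)"

definition block_bit :: "nat \<Rightarrow> exp" where
  "block_bit B = Op Modulo (block_offset B) (level_size B)"

definition block_index :: "nat \<Rightarrow> exp" where
  "block_index B = Op Divide (block_offset B) (level_size B)"

definition block_level :: "nat \<Rightarrow> exp" where
  "block_level B = Op Divide (block_index B) (Var (B + 2))"

definition search_level :: "nat \<Rightarrow> exp" where
  "search_level B = Op Divide (Var (B + 5)) (Var (B + 2))"

text \<open>Comparisons serve as 0/1 factors, so that the case distinction of \<open>choice\<close>
  becomes a single expression and can be used as an address.\<close>

definition choice_exp :: "nat \<Rightarrow> exp" where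
  "choice_exp B =
     Op Plus (Op Times (Op Less (block_level B) (search_level B))
                (Op Plus (Op Times (block_level B) (Var (B + 2))) (Cell (B + 2) (block_level B))))
    (Op Plus (Op Times (Op Equal (block_level B) (search_level B)) (Var (B + 5)))
             (Op Times (Op Less (search_level B) (block_level B)) (block_index B)))"

definition shift_exp :: "nat \<Rightarrow> nat \<Rightarrow> bool \<Rightarrow> exp" where
  "shift_exp B k sel =
     Op Times (Op (if sel then Less else Equal) (block_level B) (C (k - 1))) (Cell (B + 1) (choice_exp B))"

definition pred_exp :: "nat \<Rightarrow> exp" where
  "pred_exp B = Op Minus (Var (B + 6)) (C 1)"

definition emit_shift :: "nat \<Rightarrow> nat \<Rightarrow> bool \<Rightarrow> exp \<Rightarrow> com" where
  "emit_shift B k sel c =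
     If (Op BitAnd (Op ShiftR (shift_exp B k sel) (block_bit B)) (C 1))
        (emit B (C 1) (block_bit B) c) (emit B (C 1) c (block_bit B))"

definition emit_rule :: "nat \<Rightarrow> nat \<Rightarrow> bool \<Rightarrow> com" where
  "emit_rule B k sel =
     If (Op Less (Var (B + 6)) (C 1)) (emit B (C 0) (C 0) (C 0))
    (If (Op Less (Var (B + 6)) (Var (B + 3))) (emit B (C 1) (pred_exp B) (pred_exp B))
    (If (Op Equal (Var (B + 6)) (Var (B + 3))) (emit B (C 0) (C 1) (C 0))
    (If (Op Less (Var (B + 6)) (Var (B + 10)))
        (If (Op Less (block_bit B) (Var (B + 3)))
           (If (Op Equal (block_bit B) (C 0))
              (emit_shift B k sel (Op Plus (Var (B + 3))
                 (Op Times (block_level B) (Op Times (Var (B + 2)) (level_size B)))))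
              (emit_shift B k sel (pred_exp B)))
           (If (Op Equal (Op Modulo (block_index B) (Var (B + 2))) (C 0))
              (emit B (C 1) (C 0) (pred_exp B))
              (emit B (C 1) (block_offset B) (pred_exp B))))
    (If (Op Less (Op Plus (Var (B + 6)) (C 1)) (Var (B + 4)))
        (emit B (C 0) (C 0) (C 0))
        (emit B (C 1) (Op Minus (Var (B + 10)) (C 1)) (C 0))))))"

text \<open>
  Array position \<open>i * m + j\<close> holds the \<open>j\<close>-th element of the \<open>i\<close>-th set. When the search stands at
  position \<open>q\<close>, the sets before set \<open>q div m\<close> are restricted to the elements chosen by \<open>R\<close>, and set
  \<open>q div m\<close> is restricted to its element \<open>q mod m\<close>. A restricted set is represented by \<open>m\<close> copies of one
  element, so that all instances of the search lead to strings of the same length.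
\<close>

locale machine =
  fixes w B k m l sz T U :: nat and A :: "nat \<Rightarrow> nat"
  assumes B: "0 < B" and k: "0 < k" and m: "0 < m" and l: "0 < l"
    and sz: "sz = (l + 1) * (k * m + 1)" and A: "\<And>p. p < k * m \<Longrightarrow> A p \<le> U"
    and kU: "k * U < 2 ^ l" and kUw: "k * U < 2 ^ w" and Tw: "6 * T + 8 < 2 ^ w"
begin

lemma w: "0 < w"
  using Tw by (cases w) auto

definition choice :: "(nat \<Rightarrow> nat) \<Rightarrow> nat \<Rightarrow> nat \<Rightarrow> nat" where
  "choice R q p = (if p div m < q div m then p div m * m + R (p div m)
     else if p div m = q div m then q else p)"

text \<open>\<open>sel\<close> distinguishes the two vectors: one is shifted by the elements of the
  first \<open>k - 1\<close> sets, the other by those of the last set. The remaining sets get shift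
  0 instead of being left out, which keeps the two strings aligned.\<close>

definition shift :: "bool \<Rightarrow> (nat \<Rightarrow> nat) \<Rightarrow> nat \<Rightarrow> nat \<Rightarrow> nat" where
  "shift sel R q p = (if sel = (p div m < k - 1) then A (choice R q p) else 0)"

definition base :: "nat \<Rightarrow> nat \<Rightarrow> (nat \<Rightarrow> nat) \<Rightarrow> state \<Rightarrow> bool" where
  "base n q R s \<longleftrightarrow> vars s (B + 1) = int T \<and> vars s (B + 2) = int m \<and> vars s (B + 3) = int l \<and>
     vars s (B + 4) = int n \<and> vars s (B + 5) = int q \<and> vars s (B + 10) = int sz \<and>
     (\<forall>p<k * m. arrs s (B + 1) (int p) = int (A p)) \<and> (\<forall>t<k. arrs s (B + 2) (int t) = int (R t))"

lemma choice_less: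
  assumes "p < k * m" and "q < k * m" and "\<And>t. t < k \<Longrightarrow> R t < m"
  shows "choice R q p < k * m"
proof -
  have "p div m < k" using assms(1) by (simp add: less_mult_imp_div_less)
  then have "p div m * m + R (p div m) < (p div m + 1) * m"
    using assms(3)[of "p div m"] by simp
  also have "\<dots> \<le> k * m" by (intro mult_le_mono1) (use \<open>p div m < k\<close> in simp)
  finally show ?thesis using assms(1,2) by (auto simp: choice_def)
qed

text \<open>The program follows \<open>level_rule\<close> branch by branch. What has to be checked
  is that no intermediate value overflows: rule numbers are below \<open>n\<close> \<le>
  \<open>T\<close>, and elements are at most \<open>U\<close>.\<close>

lemma den_emit_rule:
  assumes s: "base n q R s" and x: "vars s (B + 6) = int x" "x < n" and o: "vars s (B + 11) = int p" "p + 2 < 2 ^ w"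
    and n: "sz < n" "n \<le> T" and q: "q < k * m" and R: "\<And>t. t < k \<Longrightarrow> R t < m"
  shows "den w (emit_rule B k sel) s = put_rule p (level_rule l m sz n (shift sel R q) x) s"
proof -
  have km: "k * m < sz" "l < sz" using l by (auto simp: sz)
  have nw: "6 * n + 8 < 2 ^ w" using n(2) Tw by linarith
  have v: "vars s (B + 2) = int m" "vars s (B + 3) = int l" "vars s (B + 4) = int n"
      "vars s (B + 5) = int q" "vars s (B + 10) = int sz"
    using s by (auto simp: base_def)
  note ev = evn_Plus evn_Times evn_Minus evn_Divide evn_Modulo evn_Less evn_Equal evn_Const evn_Var[OF v(1)]
    evn_Var[OF v(2)] evn_Var[OF v(3)] evn_Var[OF v(4)] evn_Var[OF v(5)] evn_Var[OF x(1)] evn_Var[OF o(1)]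
  note emit = den_emit[OF _ _ _ _ _ o]
  have c: "evn w s (C 0) 0" "evn w s (C 1) 1"
    by (intro ev; use nw in simp)+
  have c1: "evn w s (Op Less (Var (B + 6)) (C 1)) (of_bool (x < 1))"
    and c2: "evn w s (Op Less (Var (B + 6)) (Var (B + 3))) (of_bool (x < l))"
    and c3: "evn w s (Op Equal (Var (B + 6)) (Var (B + 3))) (of_bool (x = l))"
    and c4: "evn w s (Op Less (Var (B + 6)) (Var (B + 10))) (of_bool (x < sz))"
    and c5: "evn w s (Op Less (Op Plus (Var (B + 6)) (C 1)) (Var (B + 4))) (of_bool (x + 1 < n))"
    by (intro ev; use nw w x in simp)+
  have pred: "evn w s (pred_exp B) (x - 1)" if "0 < x"
    unfolding pred_exp_def by (intro ev; use nw x that in simp)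
  have av: "avoids_input (pred_exp B)" "avoids_input (block_bit B)" "avoids_input (block_offset B)"
      "avoids_input (block_level B)" "avoids_input (level_size B)"
    by (simp_all add: pred_exp_def block_level_def block_index_def block_bit_def block_offset_def level_size_def)
  consider "x = 0" | "0 < x" "x < l" | "x = l" | "l < x" "x < sz" | "sz \<le> x" "x + 1 < n" | "sz \<le> x" "x + 1 = n"
    using x(2) by linarith
  then show ?thesis
  proof cases
    case 4
    define y where "y = x - (l + 1)"
    define b where "b = y mod (l + 1)"
    define i where "i = y div (l + 1)"
    have y: "x = l + 1 + y" using 4 by (simp add: y_def)
    have ib: "y = i * (l + 1) + b" by (simp only: i_def b_def div_mult_mod_eq)
    have "i * (l + 1) + (l + 1) < (k * m + 1) * (l + 1)"
      using 4(2) unfolding y ib sz by (simp add: mult.commute)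
    then have "(i + 1) * (l + 1) < (k * m + 1) * (l + 1)" by simp
    then have i: "i < k * m" by (simp only: mult_less_cancel2) simp
    then have ik: "i div m < k" by (simp add: less_mult_imp_div_less)
    have yw: "y < 2 ^ w" using nw x y by linarith
    have e1: "evn w s (level_size B) (l + 1)"
      unfolding level_size_def by (intro ev; use nw km n in simp)
    have e2: "evn w s (block_offset B) y"
      unfolding block_offset_def y_def by (intro ev e1; use nw x 4 in simp)
    have e3: "evn w s (block_bit B) b" "evn w s (block_index B) i"
      unfolding block_bit_def block_index_def b_def i_def by (intro ev e1 e2; use yw in simp)+
    have iw: "i < 2 ^ w" using i km n nw by linarith
    have e4: "evn w s (block_level B) (i div m)"
      unfolding block_level_def by (intro ev e3; use iw in simp)
    have qw: "q < 2 ^ w" using q km n nw by linarith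
    have e5: "evn w s (search_level B) (q div m)"
      unfolding search_level_def by (intro ev; use qw in simp)
    have r1: "i div m * m + R (i div m) < k * m"
    proof -
      have "i div m * m + R (i div m) < (i div m + 1) * m" using R[OF ik] by simp
      also have "\<dots> \<le> k * m" using ik by (intro mult_le_mono1) simp
      finally show ?thesis .
    qed
    then have r2: "i div m * m < 2 ^ w" "i div m * m + R (i div m) < 2 ^ w" using km n nw by linarith+
    have e6: "evn w s (Cell (B + 2) (block_level B)) (R (i div m))"
      by (rule evn_Cell[OF e4]) (use s ik in \<open>simp add: base_def\<close>)
    have e7: "evn w s (choice_exp B) (of_bool (i div m < q div m) * (i div m * m + R (i div m)) +
        (of_bool (i div m = q div m) * q + of_bool (q div m < i div m) * i))"
      unfolding choice_exp_def by (intro ev e4 e5 e6 e3; use w r2 qw iw in \<open>simp add: of_bool_def\<close>)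
    also have "of_bool (i div m < q div m) * (i div m * m + R (i div m)) +
        (of_bool (i div m = q div m) * q + of_bool (q div m < i div m) * i) = choice R q i"
      by (auto simp: choice_def)
    finally have e7: "evn w s (choice_exp B) (choice R q i)" .
    have ch: "choice R q i < k * m" by (rule choice_less[OF i q R])
    have "U \<le> k * U" using k by simp
    then have Aw: "A (choice R q i) < 2 ^ w"
      using A[OF ch] kUw by linarith
    have e8: "evn w s (Cell (B + 1) (choice_exp B)) (A (choice R q i))"
      by (rule evn_Cell[OF e7]) (use s ch in \<open>simp add: base_def\<close>)
    have kw: "k - 1 < 2 ^ w"
    proof -
      have "k * 1 \<le> k * m" using m by (intro mult_le_mono2) simp
      then show ?thesis using km n nw by linarith
    qed
    have e9: "evn w s (shift_exp B k sel) (of_bool (if sel then i div m < k - 1 else i div m = k - 1) * A (choice R q i))"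
    proof (cases sel)
      case True
      then show ?thesis unfolding shift_exp_def if_P[OF True]
        by (intro ev e4 e8; use w kw Aw in \<open>simp add: of_bool_def\<close>)
    next
      case False
      then show ?thesis unfolding shift_exp_def if_not_P[OF False]
        by (intro ev e4 e8; use w kw Aw in \<open>simp add: of_bool_def\<close>)
    qed
    also have "of_bool (if sel then i div m < k - 1 else i div m = k - 1) * A (choice R q i) = shift sel R q i"
      using ik by (auto simp: shift_def)
    finally have e9: "evn w s (shift_exp B k sel) (shift sel R q i)" .
    have sw: "shift sel R q i < 2 ^ w" using Aw by (simp add: shift_def)
    have e10: "evn w s (Op BitAnd (Op ShiftR (shift_exp B k sel) (block_bit B)) (C 1))
        (of_bool (odd (shift sel R q i div 2 ^ b)))"
      by (rule evn_bit[OF e9 e3(1) sw w])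
    have c6: "evn w s (Op Less (block_bit B) (Var (B + 3))) (of_bool (b < l))"
      and c7: "evn w s (Op Equal (block_bit B) (C 0)) (of_bool (b = 0))"
      by (intro ev e3; use w in simp)+
    have c8: "evn w s (Op Equal (Op Modulo (block_index B) (Var (B + 2))) (C 0)) (of_bool (i mod m = 0))"
      by (intro ev e3; use w iw in simp)
    have "i div m * (m * (l + 1)) = (i div m * m) * (l + 1)" by (simp only: mult.assoc)
    also have "\<dots> \<le> i * (l + 1)" by (intro mult_le_mono1) simp
    finally have le: "l + i div m * (m * (l + 1)) < x" using y ib by linarith
    have mw: "m * (l + 1) < 2 ^ w"
    proof -
      have "m * (l + 1) \<le> k * m * (l + 1)" using k by (intro mult_le_mono1) simp
      also have "\<dots> < sz" by (simp add: sz)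
      finally show ?thesis using n nw by linarith
    qed
    let ?c = "Op Plus (Var (B + 3)) (Op Times (block_level B) (Op Times (Var (B + 2)) (level_size B)))"
    have e11: "evn w s ?c (l + i div m * (m * (l + 1)))"
    proof (intro ev e4 e1)
      show "l + i div m * (m * (l + 1)) < 2 ^ w" "i div m * (m * (l + 1)) < 2 ^ w"
        using nw le x by linarith+
    qed (rule mw)
    have avc: "avoids_input ?c" using av by simp
    have shift_case: "den w (emit_shift B k sel e) s =
        put_rule p (if odd (shift sel R q i div 2 ^ b) then Cat b c else Cat c b) s"
      if "evn w s e c" "avoids_input e" for e c
      unfolding emit_shift_def den_If_evn[OF e10]
      using emit[OF c(2) e3(1) that(1) av(2) that(2)] emit[OF c(2) that(1) e3(1) that(2) av(2)]
      by (simp add: put_rule_def)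
    have rl: "level_rule l m sz n (shift sel R q) x =
      (if b < l then
         let c = (if b = 0 then l + i div m * (m * (l + 1)) else x - 1) in
         if odd (shift sel R q i div 2 ^ b) then Cat b c else Cat c b
       else Cat (if i mod m = 0 then 0 else y) (x - 1))"
      using 4 by (simp add: level_rule_def y_def b_def i_def Let_def)
    show ?thesis
      unfolding emit_rule_def den_If_evn[OF c1] den_If_evn[OF c2] den_If_evn[OF c3] den_If_evn[OF c4]
        den_If_evn[OF c6] den_If_evn[OF c7] den_If_evn[OF c8] rl
      using 4 shift_case[OF e11 avc] shift_case[OF pred av(1)]
        emit[OF c(2) c(1) pred _ av(1)] emit[OF c(2) e2 pred av(3) av(1)]
      by (simp add: Let_def put_rule_def)
  next
    case 2
    then show ?thesis
      unfolding emit_rule_def den_If_evn[OF c1] den_If_evn[OF c2]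
      using emit[OF c(2) pred pred av(1) av(1)] by (simp add: level_rule_def put_rule_def)
  next
    case 3
    then show ?thesis
      unfolding emit_rule_def den_If_evn[OF c1] den_If_evn[OF c2] den_If_evn[OF c3]
      using emit[OF c(1) c(2) c(1)] l by (simp add: level_rule_def put_rule_def)
  next
    case 5
    then show ?thesis
      unfolding emit_rule_def den_If_evn[OF c1] den_If_evn[OF c2] den_If_evn[OF c3] den_If_evn[OF c4]
        den_If_evn[OF c5]
      using emit[OF c(1) c(1) c(1)] km by (simp add: level_rule_def put_rule_def)
  next
    case 6
    have "evn w s (Op Minus (Var (B + 10)) (C 1)) (sz - 1)"
      by (intro ev; use nw n km in simp)
    then show ?thesis
      using 6 emit[OF c(2) _ c(1)] km
      unfolding emit_rule_def den_If_evn[OF c1] den_If_evn[OF c2] den_If_evn[OF c3] den_If_evn[OF c4]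
        den_If_evn[OF c5]
      by (simp add: level_rule_def put_rule_def)
  next
    case 1
    then show ?thesis
      unfolding emit_rule_def den_If_evn[OF c1]
      using emit[OF c(1) c(1) c(1)] by (simp add: level_rule_def put_rule_def)
  qed
qed

end

section \<open>Writing the two programs into the input array\<close>

definition overwrite :: "nat \<Rightarrow> int list \<Rightarrow> (int \<Rightarrow> int) \<Rightarrow> int \<Rightarrow> int" where
  "overwrite p xs f = (\<lambda>z. if int p \<le> z \<and> z < int p + int (length xs) then xs ! nat (z - int p) else f z)"

lemma overwrite_Nil [simp]: "overwrite p [] f = f"
  by (auto simp: overwrite_def)

lemma overwrite_append:
  "overwrite p (xs @ ys) f = overwrite (p + length xs) ys (overwrite p xs f)"
proof
  fix z
  consider "z < int p" | "int p \<le> z" "z < int p + int (length xs)" | "int p + int (length xs) \<le> z"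
    by linarith
  then show "overwrite p (xs @ ys) f z = overwrite (p + length xs) ys (overwrite p xs f) z"
  proof cases
    case 3
    then have "nat (z - int p) = length xs + nat (z - int (p + length xs))" by simp
    then show ?thesis using 3 by (auto simp: overwrite_def nth_append)
  qed (auto simp: overwrite_def nth_append)
qed

lemma length_rule_input [simp]: "length (rule_input r) = 3"
  by (cases r) auto

lemma length_concat_rule_input [simp]: "length (concat (map rule_input rs)) = 3 * length rs"
  by (induction rs) auto

lemma put_rule_simps [simp]:
  "vars (put_rule p r s) = vars s"
  "arrs (put_rule p r s) a = (if a = 0 then overwrite p (rule_input r) (arrs s 0) else arrs s a)"
proof -
  have "overwrite p [x, y, z] f = (f(int p := x))(int p + 1 := y, int p + 2 := z)" for x y z f
  proof
    fix u
    consider "u < int p" | "u = int p" | "u = int p + 1" | "u = int p + 2" | "int p + 2 < u"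
      by linarith
    then show "overwrite p [x, y, z] f u = ((f(int p := x))(int p + 1 := y, int p + 2 := z)) u"
      by cases (auto simp: overwrite_def)
  qed
  moreover have "rule_input r = [rule_input r ! 0, rule_input r ! 1, rule_input r ! 2]"
    by (cases r) auto
  ultimately have "overwrite p (rule_input r) f = (f(int p := rule_input r ! 0))
      (int p + 1 := rule_input r ! 1, int p + 2 := rule_input r ! 2)" for f
    by metis
  then show "arrs (put_rule p r s) a = (if a = 0 then overwrite p (rule_input r) (arrs s 0) else arrs s a)"
    by (simp add: put_rule_def)
qed (simp add: put_rule_def)

definition emit_rules :: "nat \<Rightarrow> nat \<Rightarrow> bool \<Rightarrow> com" where
  "emit_rules B k sel =
     Seq (Assign (B + 6) (C 0))
       (While (Op Less (Var (B + 6)) (Var (B + 4)))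
         (Seq (emit_rule B k sel)
           (Seq (Assign (B + 6) (Op Plus (Var (B + 6)) (C 1)))
                (Assign (B + 11) (Op Plus (Var (B + 11)) (C 3))))))"

lemma loopfree_emit_rule: "loopfree (emit_rule B k sel)" "cost (emit_rule B k sel) \<le> 100"
  by (simp_all add: emit_rule_def emit_shift_def emit_def)

definition prepare :: "nat \<Rightarrow> nat \<Rightarrow> com" where
  "prepare B k =
     Seq (Seq (reset_vars B) (Seq (Assign B (C 0)) (Seq (Store 0 (C 0) (Var (B + 4)))
           (Seq (Store 0 (C 1) (Var (B + 4))) (Assign (B + 11) (C 2))))))
    (Seq (emit_rules B k True) (emit_rules B k False))"

text \<open>The exempt cells are the input area: two lengths and three words for each of the 2 * n
  rules. \<open>prepare\<close> writes every one of them, so their old contents do not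
  matter.\<close>

definition clean :: "nat \<Rightarrow> nat \<Rightarrow> state \<Rightarrow> bool" where
  "clean B n s \<longleftrightarrow> (\<forall>a<B. \<forall>z. \<not> (a = 0 \<and> 0 \<le> z \<and> z < int (6 * n + 2)) \<longrightarrow> arrs s a z = 0)"

lemma runs_eq: "runs w t e c s Q \<Longrightarrow> t = t' \<Longrightarrow> e = e' \<Longrightarrow> runs w t' e' c s Q"
  by simp

context machine
begin

lemma runs_emit_rules:
  assumes s: "base n q R s" and o: "vars s (B + 11) = int p" "p + 3 * n + 3 < 2 ^ w"
    and n: "sz < n" "n \<le> T" and q: "q < k * m" and R: "\<And>t. t < k \<Longrightarrow> R t < m"
  shows "runs w (n * 110 + 10) 0 (emit_rules B k sel) s
    (\<lambda>s'. (\<forall>v. v \<noteq> B + 6 \<and> v \<noteq> B + 11 \<longrightarrow> vars s' v = vars s v) \<and> vars s' (B + 11) = int (p + 3 * n) \<and>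
       (\<forall>a. a \<noteq> 0 \<longrightarrow> arrs s' a = arrs s a) \<and>
       arrs s' 0 = overwrite p (concat (map rule_input (level_slp l m sz n (shift sel R q)))) (arrs s 0))"
    (is "runs _ _ _ _ _ ?Q")
proof -
  let ?r = "level_rule l m sz n (shift sel R q)"
  define I where "I i s' \<longleftrightarrow> (\<forall>v. v \<noteq> B + 6 \<and> v \<noteq> B + 11 \<longrightarrow> vars s' v = vars s v) \<and>
      vars s' (B + 6) = int i \<and> vars s' (B + 11) = int (p + 3 * i) \<and> (\<forall>a. a \<noteq> 0 \<longrightarrow> arrs s' a = arrs s a) \<and>
      arrs s' 0 = overwrite p (concat (map rule_input (map ?r [0..<i]))) (arrs s 0)" for i and s' :: state
  let ?body = "Seq (emit_rule B k sel) (Seq (Assign (B + 6) (Op Plus (Var (B + 6)) (C 1)))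
       (Assign (B + 11) (Op Plus (Var (B + 11)) (C 3))))"
  have step: "exp_val w s' (Op Less (Var (B + 6)) (Var (B + 4))) \<noteq> 0 \<and> runs w 108 0 ?body s' (I (Suc i))"
    if i: "i < n" and I: "I i s'" for i s'
  proof
    have vs: "vars s' (B + 4) = int n" "vars s' (B + 6) = int i" "vars s' (B + 11) = int (p + 3 * i)"
      and bs: "base n q R s'" using I s B by (auto simp: I_def base_def)
    show "exp_val w s' (Op Less (Var (B + 6)) (Var (B + 4))) \<noteq> 0"
      using i vs w by simp
    have pi: "p + 3 * i + 3 < 2 ^ w" using o(2) i by linarith
    have iw: "i + 1 < 2 ^ w" using o(2) i by linarith
    have d: "den w (emit_rule B k sel) s' = put_rule (p + 3 * i) (?r i) s'"
      by (rule den_emit_rule[OF bs vs(2) i vs(3) _ n q R]) (use pi in auto)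
    let ?s1 = "put_rule (p + 3 * i) (?r i) s'"
    have e1: "evn w ?s1 (Op Plus (Var (B + 6)) (C 1)) (i + 1)"
      by (intro evn_Plus evn_Var evn_Const) (use vs iw in auto)
    have e2: "evn w (set_var (B + 6) (int (i + 1)) ?s1) (Op Plus (Var (B + 11)) (C 3)) (p + 3 * i + 3)"
      by (intro evn_Plus evn_Var evn_Const) (use vs pi in auto)
    have "den w ?body s' = set_var (B + 11) (int (p + 3 * i + 3)) (set_var (B + 6) (int (i + 1)) ?s1)"
      using e1 e2 unfolding evn_def by (simp only: den.simps d)
    moreover have "I (Suc i) \<dots>"
      using I unfolding I_def by (auto simp: overwrite_append simp del: map_map)
    ultimately have "runs w (cost ?body) 0 ?body s' (I (Suc i))"
      using runs_den[of ?body "I (Suc i)" w s'] by (simp add: loopfree_emit_rule)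
    then show "runs w 108 0 ?body s' (I (Suc i))"
      by (rule runs_weaken) (use loopfree_emit_rule(2)[of B k sel] in auto)
  qed
  have "runs w (1 + (n * (108 + 2) + 1) + 1) (0 + 0) (emit_rules B k sel) s ?Q"
    unfolding emit_rules_def
  proof (rule runs_Seq)
    show "runs w 1 0 (Assign (B + 6) (C 0)) s (I 0)"
      using runs_den[of "Assign (B + 6) (C 0)" "I 0" w s] o by (simp add: I_def)
    show "runs w (n * (108 + 2) + 1) 0 (While (Op Less (Var (B + 6)) (Var (B + 4))) ?body) s' ?Q"
      if "I 0 s'" for s'
    proof (rule runs_eq[OF runs_While[where I = I and i = 0 and e = "\<lambda>_. 0" and n = n and t = 108]])
      show "exp_val w s'' (Op Less (Var (B + 6)) (Var (B + 4))) = 0 \<and> ?Q s''" if "I n s''" for s''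
        using that s w by (simp add: I_def base_def level_slp_def)
    qed (use that step in auto)
  qed simp
  then show ?thesis by (rule runs_weaken) auto
qed

abbreviation slp_of :: "nat \<Rightarrow> bool \<Rightarrow> (nat \<Rightarrow> nat) \<Rightarrow> nat \<Rightarrow> int slp" where
  "slp_of n sel R q \<equiv> level_slp l m sz n (shift sel R q)"

text \<open>Since the entries are small and nonnegative, the wrapping in \<open>init_state\<close>
  leaves the input as it is.\<close>

lemma rule_input_bound:
  assumes "sz < n" and "z \<in> set (concat (map rule_input (level_slp l m sz n sh)))"
  shows "0 \<le> z \<and> z < int n"
proof -
  obtain x where x: "x < n" "z \<in> set (rule_input (level_rule l m sz n sh x))"
    using assms(2) by (auto simp: level_slp_def)
  have "1 < n" using assms(1) by (simp add: sz)
  then show ?thesis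
    using x level_string_rule(2,3)[OF l m k sz assms(1) x(1)]
    by (cases "level_rule l m sz n sh x") fastforce+
qed

text \<open>The cells that are not written here are zero by \<open>clean\<close>, so the given
  program cannot tell the result from a fresh start.\<close>

lemma runs_prepare:
  assumes s: "base n q R s" "clean B n s"
    and n: "sz < n" "n \<le> T" and q: "q < k * m" and R: "\<And>t. t < k \<Longrightarrow> R t < m"
  shows "runs w (220 * n + 2 * B + 30) 0 (prepare B k) s
    (\<lambda>s'. agree B (init_state w (slp_pair_input (slp_of n True R q) (slp_of n False R q))) s' \<and>
       vars s' B = 0 \<and> base n q R s' \<and> vars s' (B + 7) = vars s (B + 7) \<and> clean B n s')"
    (is "runs _ _ _ _ _ ?Q")
proof -
  let ?S = "slp_of n True R q" and ?T = "slp_of n False R q"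
  let ?inp = "slp_pair_input ?S ?T"
  let ?start = "Seq (reset_vars B) (Seq (Assign B (C 0)) (Seq (Store 0 (C 0) (Var (B + 4)))
           (Seq (Store 0 (C 1) (Var (B + 4))) (Assign (B + 11) (C 2)))))"
  have nw: "6 * n + 8 < 2 ^ w" using n(2) Tw by linarith
  have n4: "vars s (B + 4) = int n" using s by (simp add: base_def)
  define I where "I p f s' \<longleftrightarrow> (\<forall>v<B. vars s' v = 0) \<and> vars s' B = 0 \<and> base n q R s' \<and>
      vars s' (B + 7) = vars s (B + 7) \<and> vars s' (B + 11) = int p \<and> (\<forall>a. a \<noteq> 0 \<longrightarrow> arrs s' a = arrs s a) \<and>
      arrs s' 0 = overwrite 0 f (arrs s 0)" for p f and s' :: state
  have c: "wrap w (int 2) = int 2" "wrap w (int 1) = int 1"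
    by (rule wrap_int; use nw in linarith)+
  have "overwrite 0 [int n, int n] (arrs s 0) = (arrs s 0)(0 := int n, 1 := int n)"
  proof
    fix u :: int
    consider "u < 0" | "u = 0" | "u = 1" | "1 < u" by linarith
    then show "overwrite 0 [int n, int n] (arrs s 0) u = ((arrs s 0)(0 := int n, 1 := int n)) u"
      by cases (auto simp: overwrite_def)
  qed
  then have "I 2 [int n, int n] (den w ?start s)"
    using s c n4 B by (auto simp: I_def base_def)
  then have 1: "runs w (2 * B + 8) 0 ?start s (I 2 [int n, int n])"
    by (intro runs_eq[OF runs_den]) (simp_all add: loopfree_reset_vars)
  have gen: "runs w (n * 110 + 10) 0 (emit_rules B k sel) s'
      (I (p + 3 * n) (f @ concat (map rule_input (slp_of n sel R q))))"
    if I: "I p f s'" and p: "p + 3 * n + 3 < 2 ^ w" "p = length f" for sel p f s'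
  proof (rule runs_weaken[OF runs_emit_rules[OF _ _ p(1) n q R]])
    show "base n q R s'" "vars s' (B + 11) = int p" using I by (auto simp: I_def)
  qed (use I p B in \<open>auto simp: I_def base_def overwrite_append\<close>)
  have "runs w ((2 * B + 8) + ((n * 110 + 10) + (n * 110 + 10) + 1) + 1) (0 + (0 + 0)) (prepare B k) s
      (I (2 + 3 * n + 3 * n) (([int n, int n] @ concat (map rule_input ?S)) @ concat (map rule_input ?T)))"
    unfolding prepare_def
  proof (rule runs_Seq[OF 1], rule runs_Seq[OF gen])
    let ?f = "[int n, int n] @ concat (map rule_input ?S)"
    show "runs w (n * 110 + 10) 0 (emit_rules B k False) s'
        (I (2 + 3 * n + 3 * n) (?f @ concat (map rule_input ?T)))" if "I (2 + 3 * n) ?f s'" for s'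
      by (rule gen[OF that]) (use nw in auto)
  qed (use nw in auto)
  then show ?thesis
  proof (rule runs_weaken)
    fix s'
    assume "I (2 + 3 * n + 3 * n) (([int n, int n] @ concat (map rule_input ?S)) @ concat (map rule_input ?T)) s'"
    then have I: "I (2 + 3 * n + 3 * n) ?inp s'"
      by (simp add: slp_pair_input_def)
    have len: "length ?inp = 6 * n + 2" by (simp add: slp_pair_input_def)
    have bnd: "0 \<le> z \<and> z < 2 ^ w" if "z \<in> set ?inp" for z
    proof -
      have "0 \<le> z \<and> z \<le> int n"
        using that rule_input_bound[OF n(1), of z "shift True R q"] rule_input_bound[OF n(1), of z "shift False R q"]
        by (auto simp: slp_pair_input_def simp del: set_concat)
      moreover have "n < 2 ^ w" using nw by linarith
      then have "int n < 2 ^ w" by simp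
      ultimately show ?thesis by linarith
    qed
    have c0: "arrs s' 0 z = (if 0 \<le> z \<and> z < int (length ?inp) then wrap w (?inp ! nat z) else 0)" for z
    proof (cases "0 \<le> z \<and> z < int (length ?inp)")
      case True
      then have "?inp ! nat z \<in> set ?inp" by (intro nth_mem) auto
      then show ?thesis using I True bnd wrap_id by (auto simp: I_def overwrite_def)
    next
      case False
      then have "arrs s' 0 z = arrs s 0 z" using I by (auto simp: I_def overwrite_def)
      then show ?thesis using False s(2) B by (auto simp: clean_def len)
    qed
    have ca: "arrs s' a z = 0" if "a \<noteq> 0" "a < B" for a z
      using I s(2) that by (auto simp: I_def clean_def)
    have "clean B n s'"
      unfolding clean_def
    proof (intro allI impI)
      fix a z
      assume "a < B" "\<not> (a = 0 \<and> 0 \<le> z \<and> z < int (6 * n + 2))"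
      then show "arrs s' a z = 0"
        using c0[of z] ca[of a z] by (cases "a = 0") (auto simp: len)
    qed
    moreover have "agree B (init_state w ?inp) s'"
    proof -
      have "arrs (init_state w ?inp) a z = arrs s' a z" if "a < B" for a z
        using c0[of z] ca[of a z] that by (cases "a = 0") (simp_all add: init_state_def)
      then show ?thesis using I by (auto simp: agree_def I_def init_state_def)
    qed
    ultimately show "?Q s'"
      using I by (auto simp: I_def)
  qed (auto simp: algebra_simps)
qed

end

section \<open>From decision to search\<close>

definition search_step :: "nat \<Rightarrow> nat \<Rightarrow> com \<Rightarrow> com" where
  "search_step B k P =
     Seq (prepare B k)
    (Seq (clocked B P)
    (Seq (If (Var 0)
            (Store (B + 2) (Op Divide (Var (B + 5)) (Var (B + 2))) (Op Modulo (Var (B + 5)) (Var (B + 2))))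
            Skip)
    (Seq (clear_memory B)
         (Assign (B + 5) (Op Plus (Var (B + 5)) (C 1))))))"

definition chosen_exp :: "nat \<Rightarrow> nat \<Rightarrow> exp" where
  "chosen_exp B t = Cell (B + 1) (Op Plus (Op Times (C t) (Var (B + 2))) (Cell (B + 2) (C t)))"

primrec sum_exp :: "nat \<Rightarrow> nat \<Rightarrow> exp" where
  "sum_exp B 0 = C 0"
| "sum_exp B (Suc t) = Op Plus (sum_exp B t) (chosen_exp B t)"

definition search :: "nat \<Rightarrow> nat \<Rightarrow> com \<Rightarrow> com" where
  "search B k P =
     Seq (Assign (B + 5) (C 0))
    (Seq (While (Op Less (Var (B + 5)) (Op Times (C k) (Var (B + 2)))) (search_step B k P))
         (If (Op Equal (sum_exp B (k - 1)) (chosen_exp B (k - 1))) (Assign (B + 7) (C 1)) Skip))"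

definition all_searches :: "nat \<Rightarrow> nat \<Rightarrow> com \<Rightarrow> com" where
  "all_searches B k P =
     While (Op Less (Var (B + 4)) (Op Plus (Var (B + 1)) (C 1)))
       (Seq (If (Op Less (Var (B + 10)) (Var (B + 4))) (search B k P) Skip)
            (Assign (B + 4) (Op Times (Var (B + 4)) (C 2))))"

definition step_time :: "nat \<Rightarrow> com \<Rightarrow> nat \<Rightarrow> nat" where
  "step_time B P T = (weight P + 4 * B + 400) * (T + 1)"

text \<open>The calls of one search use different shift functions; the time and the error bound are
  uniform in them.\<close>

definition reliable :: "nat \<Rightarrow> nat \<Rightarrow> nat \<Rightarrow> nat \<Rightarrow> nat \<Rightarrow> com \<Rightarrow> nat \<Rightarrow> real \<Rightarrow> bool" where
  "reliable w T l m sz P n e \<longleftrightarrow> (\<exists>tP\<le>T. \<forall>sh sh'. 1 - e \<le> output_prob w P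
     (slp_pair_input (level_slp l m sz n sh) (level_slp l m sz n sh')) tP
     (inner_prod (slp_string (level_slp l m sz n sh)) (slp_string (level_slp l m sz n sh'))))"

context machine
begin

definition solution :: "(nat \<Rightarrow> nat) \<Rightarrow> bool" where
  "solution J \<longleftrightarrow> (\<forall>t<k. J t < m) \<and> (\<Sum>t<k - 1. A (t * m + J t)) = A ((k - 1) * m + J (k - 1))"

definition extends :: "(nat \<Rightarrow> nat) \<Rightarrow> nat \<Rightarrow> bool" where
  "extends R i \<longleftrightarrow> (\<exists>J. solution J \<and> (\<forall>t<i. J t = R t))"

definition hit :: "(nat \<Rightarrow> nat) \<Rightarrow> nat \<Rightarrow> bool" where
  "hit R q \<longleftrightarrow> (\<exists>J. solution J \<and> (\<forall>t<q div m. J t = R t) \<and> J (q div m) = q mod m)"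

text \<open>The position \<open>q\<close> stands for element \<open>q mod m\<close> of set
  \<open>q div m\<close>. As soon as an element tried so far continues the prefix, \<open>R\<close>
  must hold such an element for the current set. A later hit may overwrite an earlier one, which
  preserves this property.\<close>

definition search_inv :: "nat \<Rightarrow> (nat \<Rightarrow> nat) \<Rightarrow> bool" where
  "search_inv q R \<longleftrightarrow> ((\<exists>J. solution J) \<longrightarrow> extends R (q div m) \<and>
     ((\<exists>J. solution J \<and> (\<forall>t<q div m. J t = R t) \<and> J (q div m) < q mod m) \<longrightarrow> extends R (Suc (q div m))))"

lemma search_inv_0: "search_inv 0 R"
  by (simp add: search_inv_def extends_def)

lemma search_inv_Suc:
  assumes q: "q < k * m" and inv: "search_inv q R"
  shows "search_inv (Suc q) (if hit R q then R(q div m := q mod m) else R)" (is "search_inv _ ?R")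
proof (cases "\<exists>J. solution J")
  case True
  define i j where "i = q div m" and "j = q mod m"
  have i: "i < k" using q by (simp add: i_def less_mult_imp_div_less)
  have same: "(\<forall>t<i. J t = ?R t) \<longleftrightarrow> (\<forall>t<i. J t = R t)" for J :: "nat \<Rightarrow> nat"
    by (auto simp: i_def)
  have ext: "extends R i"
    and ext': "(\<exists>J. solution J \<and> (\<forall>t<i. J t = R t) \<and> J i < j) \<Longrightarrow> extends R (Suc i)"
    using inv True by (auto simp: search_inv_def i_def j_def)
  have e1: "extends ?R i" using ext same by (simp add: extends_def)
  have e2: "extends ?R (Suc i)" if J: "solution J" "\<forall>t<i. J t = ?R t" "J i < Suc j" for J
  proof (cases "hit R q")
    case True
    then obtain J' where "solution J'" "\<forall>t<i. J' t = R t" "J' i = j"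
      by (auto simp: hit_def i_def j_def)
    then show ?thesis using True
      by (auto simp: extends_def less_Suc_eq i_def j_def intro!: exI[of _ J'])
  next
    case False
    then have "J i \<noteq> j" using J same unfolding hit_def i_def j_def by auto
    then have "J i < j" using J(3) by simp
    then have "extends R (Suc i)" using ext' J(1,2) same by blast
    then show ?thesis using False by simp
  qed
  show ?thesis
  proof (cases "Suc j = m")
    case True
    then have *: "Suc q div m = Suc i" "Suc q mod m = 0"
      by (auto simp: i_def j_def div_Suc mod_Suc)
    obtain J where J: "solution J" "\<forall>t<i. J t = ?R t" using e1 by (auto simp: extends_def)
    \<comment> \<open>All elements of set \<open>i\<close> have been tried now, and a solution
      extending the prefix uses one of them.\<close>
    moreover have "J i < Suc j" using J(1) i True by (simp add: solution_def)
    ultimately have "extends ?R (Suc i)" by (rule e2)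
    then show ?thesis unfolding search_inv_def * by simp
  next
    case False
    then have *: "Suc q div m = i" "Suc q mod m = Suc j"
      using m by (auto simp: i_def j_def div_Suc mod_Suc)
    show ?thesis unfolding search_inv_def * using e1 e2 by blast
  qed
qed (simp add: search_inv_def)

lemma solution_cong:
  assumes "\<And>t. t < k \<Longrightarrow> J t = J' t"
  shows "solution J \<longleftrightarrow> solution J'"
proof -
  have "(\<Sum>t<k - 1. A (t * m + J t)) = (\<Sum>t<k - 1. A (t * m + J' t))"
    using assms by (intro sum.cong) auto
  moreover have "J (k - 1) = J' (k - 1)" using assms k by simp
  moreover have "(\<forall>t<k. J t < m) \<longleftrightarrow> (\<forall>t<k. J' t < m)" using assms by simp
  ultimately show ?thesis by (simp only: solution_def)
qed

lemma search_inv_final: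
  assumes "search_inv (k * m) R" and "solution J"
  shows "solution R"
proof -
  have "extends R k" using assms m unfolding search_inv_def by auto
  then obtain J' where "solution J'" "\<forall>t<k. J' t = R t" by (auto simp: extends_def)
  then show ?thesis using solution_cong[of J' R] by simp
qed

text \<open>A restricted set consists of copies of one element, so the shifts of any tuple
  \<open>J\<close> are the elements of \<open>J' J\<close>, which replaces the restricted entries by
  the prescribed choices. Hence a common one exists iff some \<open>J' J\<close> is a solution, and
  these are the solutions counted by \<open>hit\<close>.\<close>

lemma inner_prod_iff_hit:
  assumes q: "q < k * m" and R: "\<And>t. t < k \<Longrightarrow> R t < m"
  shows "inner_prod (level l m (shift True R q) k @ [0]) (level l m (shift False R q) k @ [0]) \<noteq> 0 \<longleftrightarrow> hit R q"
proof -
  define J' where "J' J t = (if t < q div m then R t else if t = q div m then q mod m else J t)" for J :: "nat \<Rightarrow> nat" and t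
  have i: "q div m < k" using q by (simp add: less_mult_imp_div_less)
  have dm: "(t * m + J t) div m = t" if "J t < m" for J :: "nat \<Rightarrow> nat" and t
    using that by simp
  have ch: "choice R q (t * m + J t) = t * m + J' J t" if "J t < m" for J :: "nat \<Rightarrow> nat" and t
    unfolding choice_def dm[of J, OF that] J'_def by auto
  have idx: "t * m + J t < k * m" if "t < k" "J t < m" for J :: "nat \<Rightarrow> nat" and t
  proof -
    have "t * m + J t < (t + 1) * m" using that by simp
    also have "\<dots> \<le> k * m" using that by (intro mult_le_mono1) simp
    finally show ?thesis .
  qed
  have U: "shift sel R q p \<le> U" if "p < k * m" for sel p
    using A[OF choice_less[OF that q R]] by (simp add: shift_def)
  have "U \<le> k * U" using k by simp
  then have lt: "shift sel R q p < 2 ^ l" if "p < k * m" for sel p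
    using U[OF that, of sel] kU by linarith
  have sums: "(\<Sum>t<k. shift sel R q (t * m + J t)) < 2 ^ l" if "\<And>t. t < k \<Longrightarrow> J t < m" for sel J
  proof -
    have "(\<Sum>t<k. shift sel R q (t * m + J t)) \<le> (\<Sum>t<k. U)"
      using U idx that by (intro sum_mono) auto
    then show ?thesis using kU by simp
  qed
  obtain k' where k': "k = Suc k'" using k by (cases k) auto
  then have k1: "k - 1 = k'" and kk: "k' < k" by simp_all
  have split: "(\<Sum>t<k. f t) = (\<Sum>t<k'. f t) + f k'" for f :: "nat \<Rightarrow> nat"
    by (subst k') simp
  have "inner_prod (level l m (shift True R q) k @ [0]) (level l m (shift False R q) k @ [0]) \<noteq> 0 \<longleftrightarrow>
      (\<exists>J. (\<forall>t<k. J t < m) \<and> (\<Sum>t<k. shift True R q (t * m + J t)) = (\<Sum>t<k. shift False R q (t * m + J t)))"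
    by (rule inner_prod_levels_nonzero_iff) (use lt sums in auto)
  also have "\<dots> \<longleftrightarrow> (\<exists>J. (\<forall>t<k. J t < m) \<and> solution (J' J))"
  proof (intro ex_cong1 conj_cong refl)
    fix J :: "nat \<Rightarrow> nat"
    assume J: "\<forall>t<k. J t < m"
    have 1: "shift sel R q (t * m + J t) = (if sel = (t < k') then A (t * m + J' J t) else 0)" if "t < k" for sel t
      using that J ch[of J t] dm[of J t] k1 by (simp add: shift_def)
    have "(\<Sum>t<k. shift True R q (t * m + J t)) = (\<Sum>t<k'. A (t * m + J' J t))"
      unfolding split using 1 kk by simp
    moreover have "(\<Sum>t<k. shift False R q (t * m + J t)) = A (k' * m + J' J k')"
      unfolding split using 1 kk by simp
    moreover have "\<forall>t<k. J' J t < m" using J R m by (auto simp: J'_def)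
    ultimately show "(\<Sum>t<k. shift True R q (t * m + J t)) = (\<Sum>t<k. shift False R q (t * m + J t)) \<longleftrightarrow>
        solution (J' J)"
      using k1 by (simp add: solution_def)
  qed
  also have "\<dots> \<longleftrightarrow> hit R q"
  proof
    assume "\<exists>J. (\<forall>t<k. J t < m) \<and> solution (J' J)"
    then show "hit R q" unfolding hit_def by (auto simp: J'_def)
  next
    assume "hit R q"
    then obtain J where J: "solution J" "\<forall>t<q div m. J t = R t" "J (q div m) = q mod m"
      by (auto simp: hit_def)
    then have "J' J = J" by (auto simp: J'_def)
    then show "\<exists>J. (\<forall>t<k. J t < m) \<and> solution (J' J)"
      using J(1) by (intro exI[of _ J]) (auto simp: solution_def)
  qed
  finally show ?thesis .
qed

lemma base_frame: "base n q R s \<Longrightarrow> frame B s s' \<Longrightarrow> base n q R s'"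
  by (simp add: base_def frame_def)

text \<open>\<open>good\<close> marks the size for which the answers can be trusted. For other sizes
  the answer is arbitrary, but the clock still guarantees, without error, that the call ends, the
  memory is restored and the choices remain valid indices.\<close>

lemma runs_search_step:
  assumes P: "com_bound P \<le> B" and s: "base n q R s" "clean B n s"
    and n: "sz < n" "n \<le> T" and q: "q < k * m" and R: "\<And>t. t < k \<Longrightarrow> R t < m"
    and good: "good \<Longrightarrow> reliable w T l m sz P n e" and e: "0 \<le> e"
  shows "runs w (step_time B P T) (if good then e else 0) (search_step B k P) s
    (\<lambda>s'. \<exists>R'. (\<forall>t<k. R' t < m) \<and> base n (Suc q) R' s' \<and> clean B n s' \<and>
       vars s' (B + 7) = vars s (B + 7) \<and>
       (good \<longrightarrow> R' = (if hit R q then R(q div m := q mod m) else R)))"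
    (is "runs _ _ ?e _ _ ?Q")
proof -
  have km: "k * m < sz" using l by (auto simp: sz)
  have nw: "6 * n + 8 < 2 ^ w" using n(2) Tw by linarith
  have qw: "q + 1 < 2 ^ w" using q km n nw by linarith
  have qi: "q div m < k" using q by (simp add: less_mult_imp_div_less)
  have qj: "q mod m < m" using m by simp
  let ?S = "slp_of n True R q" and ?T = "slp_of n False R q"
  let ?inp = "slp_pair_input ?S ?T"
  define J0 where "J0 R' s' \<longleftrightarrow> base n q R' s' \<and> vars s' (B + 7) = vars s (B + 7)" for R' and s' :: state
  define J1 where "J1 s' \<longleftrightarrow> J0 R s' \<and> agree B (init_state w ?inp) s' \<and> vars s' B = 0 \<and> clean B n s'" for s'
  define J2 where "J2 R' s' \<longleftrightarrow> J0 R' s' \<and> clock_ok w B s' \<and> (\<exists>s1. clean B n s1 \<and> logged B s1 s')" for R' s'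
  define upd where "upd R' \<longleftrightarrow> (\<forall>t<k. R' t < m) \<and> (good \<longrightarrow> R' = (if hit R q then R(q div m := q mod m) else R))" for R'
  have 1: "runs w (220 * T + 2 * B + 30) 0 (prepare B k) s J1"
    by (rule runs_weaken[OF runs_prepare[OF s n q R]]) (use n(2) in \<open>auto simp: J1_def J0_def\<close>)
  have 2: "runs w (weight P * (T + 1)) ?e (clocked B P) s1
      (\<lambda>s'. J2 R s' \<and> (good \<longrightarrow> (vars s' 0 \<noteq> 0 \<longleftrightarrow> hit R q)))" if J1: "J1 s1" for s1
  proof -
    have t: "vars s1 (Suc B) = int T" "vars s1 B = 0" and ag: "agree B (init_state w ?inp) s1"
      using J1 by (auto simp: J1_def J0_def base_def)
    have "T < 2 ^ w" using Tw by linarith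
    then have "int T < 2 ^ w" by simp
    then have ok: "clock_ok w B s1" using t w by (simp add: clock_ok_def)
    have J2: "J2 R s'" if "clock_ok w B s' \<and> frame B s1 s' \<and> logged B s1 s'" for s'
      using that J1 base_frame[of n q R s1 s'] by (auto simp: J1_def J2_def J0_def frame_def)
    show ?thesis
    proof (cases good)
      case True
      then obtain tP where tP: "tP \<le> T" "1 - e \<le> output_prob w P ?inp tP (inner_prod (slp_string ?S) (slp_string ?T))"
        using good by (auto simp: reliable_def)
      have "inner_prod (slp_string ?S) (slp_string ?T) \<noteq> 0 \<longleftrightarrow> hit R q"
        unfolding slp_string_level_slp[OF l m k sz n(1)] by (rule inner_prod_iff_hit[OF q R])
      then show ?thesis
        by (intro runs_weaken[OF runs_clocked_output[OF P B ok t(2,1) ag tP(2,1)]]) (use True J2 in auto)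
    next
      case False
      show ?thesis
        by (rule runs_weaken[OF runs_clocked[OF P ok t(2,1)]]) (use False J2 in auto)
    qed
  qed
  let ?rec = "If (Var 0)
            (Store (B + 2) (Op Divide (Var (B + 5)) (Var (B + 2))) (Op Modulo (Var (B + 5)) (Var (B + 2)))) Skip"
  have 3: "runs w 2 0 ?rec s2 (\<lambda>s'. \<exists>R'. J2 R' s' \<and> upd R')"
    if J2: "J2 R s2" and h: "good \<longrightarrow> (vars s2 0 \<noteq> 0 \<longleftrightarrow> hit R q)" for s2
  proof -
    have v: "vars s2 (B + 5) = int q" "vars s2 (B + 2) = int m" using J2 by (auto simp: J2_def J0_def base_def)
    have "evn w s2 (Op Divide (Var (B + 5)) (Var (B + 2))) (q div m)" "evn w s2 (Op Modulo (Var (B + 5)) (Var (B + 2))) (q mod m)"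
      by (intro evn_Divide evn_Modulo evn_Var v; use qw in simp)+
    then have d: "den w ?rec s2 = (if vars s2 0 \<noteq> 0 then set_cell (B + 2) (int (q div m)) (int (q mod m)) s2 else s2)"
      unfolding evn_def den.simps by (simp del: exp_val.simps(4))
    define R' where "R' = (if vars s2 0 \<noteq> 0 then R(q div m := q mod m) else R)"
    have "J2 R' (den w ?rec s2)"
      using J2 qi unfolding d R'_def J2_def J0_def
      by (auto simp: base_def clock_ok_def logged_def)
    moreover have "upd R'" using h R qj by (auto simp: upd_def R'_def)
    ultimately have "runs w (cost ?rec) 0 ?rec s2 (\<lambda>s'. \<exists>R'. J2 R' s' \<and> upd R')"
      by (intro runs_den) auto
    then show ?thesis by (rule runs_weaken) auto
  qed
  have 4: "runs w (T * (2 * B + 4) + 1) 0 (clear_memory B) s3 (\<lambda>s'. \<exists>R'. J0 R' s' \<and> clean B n s' \<and> upd R')"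
    if J2: "J2 R' s3" and upd: "upd R'" for R' s3
  proof -
    obtain s1 where ok: "clock_ok w B s3" and s1: "clean B n s1" "logged B s1 s3" and J0: "J0 R' s3"
      using J2 by (auto simp: J2_def)
    have "vars s3 B \<le> int T" using ok J0 by (auto simp: clock_ok_def J0_def base_def)
    from runs_clear_memory[OF ok this] show ?thesis
    proof (rule runs_weaken)
      fix s'
      assume s': "(\<forall>x. x \<noteq> B \<longrightarrow> vars s' x = vars s3 x) \<and> frame B s3 s' \<and>
         (\<forall>a<B. \<forall>z. arrs s' a z =
         (if \<exists>h. 0 \<le> h \<and> h < vars s3 B \<and> arrs s3 B h = z then 0 else arrs s3 a z))"
      have "arrs s' a z = 0" if "a < B" "\<not> (a = 0 \<and> 0 \<le> z \<and> z < int (6 * n + 2))" for a z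
      proof (cases "\<exists>h. 0 \<le> h \<and> h < vars s3 B \<and> arrs s3 B h = z")
        case True
        then show ?thesis using s' that(1) by simp
      next
        case False
        have "arrs s' a z = (if \<exists>h. 0 \<le> h \<and> h < vars s3 B \<and> arrs s3 B h = z then 0 else arrs s3 a z)"
          using s' that(1) by blast
        then have "arrs s' a z = arrs s3 a z" unfolding if_not_P[OF False] .
        also have "\<dots> = arrs s1 a z" using s1(2) False that(1) unfolding logged_def by blast
        also have "\<dots> = 0" using s1(1) that unfolding clean_def by blast
        finally show ?thesis .
      qed
      then have "clean B n s'" by (auto simp: clean_def)
      moreover have "J0 R' s'" using J0 s' base_frame[of n q R' s3 s'] by (auto simp: J0_def)
      ultimately show "\<exists>R'. J0 R' s' \<and> clean B n s' \<and> upd R'" using upd by blast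
    qed auto
  qed
  have 5: "runs w 1 0 (Assign (B + 5) (Op Plus (Var (B + 5)) (C 1))) s4 ?Q"
    if J0: "J0 R' s4" "clean B n s4" and upd: "upd R'" for R' s4
  proof -
    have "evn w s4 (Op Plus (Var (B + 5)) (C 1)) (q + 1)"
      by (intro evn_Plus evn_Var evn_Const) (use J0 qw in \<open>auto simp: J0_def base_def\<close>)
    then have d: "den w (Assign (B + 5) (Op Plus (Var (B + 5)) (C 1))) s4 = set_var (B + 5) (int (Suc q)) s4"
      by (simp add: evn_def)
    have "?Q (set_var (B + 5) (int (Suc q)) s4)"
      using J0 upd by (intro exI[of _ R']) (auto simp: J0_def base_def clean_def upd_def)
    then show ?thesis
      using runs_den[of "Assign (B + 5) (Op Plus (Var (B + 5)) (C 1))" ?Q w s4] unfolding d by simp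
  qed
  have "runs w ((220 * T + 2 * B + 30) + (weight P * (T + 1) + (2 + ((T * (2 * B + 4) + 1) + 1 + 1) + 1) + 1) + 1)
      (0 + (?e + (0 + (0 + 0)))) (search_step B k P) s ?Q"
    unfolding search_step_def
  proof (rule runs_Seq[OF 1], rule runs_Seq[OF 2], assumption)
    fix s2
    assume "J2 R s2 \<and> (good \<longrightarrow> (vars s2 0 \<noteq> 0 \<longleftrightarrow> hit R q))"
    then have "J2 R s2" "good \<longrightarrow> (vars s2 0 \<noteq> 0 \<longleftrightarrow> hit R q)" by auto
    then show "runs w (2 + ((T * (2 * B + 4) + 1) + 1 + 1) + 1) (0 + (0 + 0))
        (Seq ?rec (Seq (clear_memory B) (Assign (B + 5) (Op Plus (Var (B + 5)) (C 1))))) s2 ?Q"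
    proof (rule runs_Seq[OF 3])
      fix s3
      assume "\<exists>R'. J2 R' s3 \<and> upd R'"
      then obtain R' where "J2 R' s3" "upd R'" by blast
      then show "runs w ((T * (2 * B + 4) + 1) + 1 + 1) (0 + 0)
         (Seq (clear_memory B) (Assign (B + 5) (Op Plus (Var (B + 5)) (C 1)))) s3 ?Q"
        by (rule runs_Seq[OF 4]) (use 5 in auto)
    qed simp
  qed (use e in auto)
  then show ?thesis
    by (rule runs_weaken) (auto simp: step_time_def algebra_simps)
qed


lemma evn_sum_exp:
  assumes "base n q R s" and "\<And>t. t < k \<Longrightarrow> R t < m" and "k * m < 2 ^ w" and "i \<le> k"
  shows "t < k \<Longrightarrow> evn w s (chosen_exp B t) (A (t * m + R t))"
    and "evn w s (sum_exp B i) (\<Sum>t<i. A (t * m + R t))"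
proof -
  have idx: "t * m + R t < k * m" if "t < k" for t
  proof -
    have "t * m + R t < (t + 1) * m" using assms(2)[OF that] by simp
    also have "\<dots> \<le> k * m" using that by (intro mult_le_mono1) simp
    finally show ?thesis .
  qed
  show chosen: "evn w s (chosen_exp B t) (A (t * m + R t))" if t: "t < k" for t
    unfolding chosen_exp_def
  proof (rule evn_Cell)
    have "k \<le> k * m" using m by simp
    then have c: "evn w s (C t) t" using t assms(3) by (intro evn_Const) linarith
    have i: "t * m + R t < 2 ^ w" using idx[OF t] assms(3) by linarith
    show "evn w s (Op Plus (Op Times (C t) (Var (B + 2))) (Cell (B + 2) (C t))) (t * m + R t)"
      by (intro evn_Plus evn_Times c evn_Var evn_Cell[OF c])
        (use assms(1) i t in \<open>auto simp: base_def\<close>)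
    show "arrs s (B + 1) (int (t * m + R t)) = int (A (t * m + R t))"
      using assms(1) idx[OF t] unfolding base_def by blast
  qed
  show "evn w s (sum_exp B i) (\<Sum>t<i. A (t * m + R t))"
    using assms(4)
  proof (induction i)
    case (Suc i)
    have "(\<Sum>t<Suc i. A (t * m + R t)) \<le> (\<Sum>t<Suc i. U)"
      using Suc.prems idx A by (intro sum_mono) auto
    also have "\<dots> \<le> k * U" using mult_le_mono1[OF Suc.prems, of U] by simp
    finally have "(\<Sum>t<Suc i. A (t * m + R t)) < 2 ^ w" using kUw by linarith
    then show ?case
      using Suc chosen[of i] by (auto intro!: evn_Plus)
  qed (auto intro!: evn_Const[of 0 w s, simplified])
qed

text \<open>Only a verified tuple sets the flag, so it is sound even if the answers are wrong. The
  error is a union bound over the \<open>k * m\<close> calls.\<close>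

lemma runs_search:
  assumes P: "com_bound P \<le> B" and s: "base n q R s" "clean B n s"
    and n: "sz < n" "n \<le> T" and R: "\<And>t. t < k \<Longrightarrow> R t < m"
    and good: "good \<Longrightarrow> reliable w T l m sz P n e" and e: "0 \<le> e"
  shows "runs w (k * m * (step_time B P T + 2) + 10) (if good then real (k * m) * e else 0) (search B k P) s
    (\<lambda>s'. \<exists>R' q'. (\<forall>t<k. R' t < m) \<and> base n q' R' s' \<and> clean B n s' \<and>
       vars s' (B + 7) = (if solution R' then 1 else vars s (B + 7)) \<and>
       (good \<longrightarrow> (\<exists>J. solution J) \<longrightarrow> solution R'))"
    (is "runs _ _ ?e _ _ ?Q")
proof -
  define I where "I j s' \<longleftrightarrow> (\<exists>R'. (\<forall>t<k. R' t < m) \<and> base n j R' s' \<and> clean B n s' \<and>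
       vars s' (B + 7) = vars s (B + 7) \<and> (good \<longrightarrow> search_inv j R'))" for j s'
  have km: "k * m < sz" using l by (auto simp: sz)
  then have kmw: "k * m < 2 ^ w" using n Tw by linarith
  let ?guard = "Op Less (Var (B + 5)) (Op Times (C k) (Var (B + 2)))"
  have guard: "exp_val w s' ?guard = of_bool (j < k * m)" if "I j s'" for j s'
  proof -
    have "k \<le> k * m" using m by simp
    then have "k < 2 ^ w" using kmw by linarith
    then have "evn w s' ?guard (of_bool (j < k * m))"
      using that kmw w by (intro evn_Less evn_Var evn_Times evn_Const) (auto simp: I_def base_def)
    then show ?thesis by (simp add: evn_def)
  qed
  have 1: "runs w 1 0 (Assign (B + 5) (C 0)) s (I 0)"
  proof -
    have "I 0 (set_var (B + 5) 0 s)"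
      using s R search_inv_0[of R] unfolding I_def by (intro exI[of _ R]) (auto simp: base_def clean_def)
    then show ?thesis using runs_den[of "Assign (B + 5) (C 0)" "I 0" w s] by simp
  qed
  have 2: "runs w (k * m * (step_time B P T + 2) + 1) ?e (While ?guard (search_step B k P)) s1 (I (k * m))"
    if "I 0 s1" for s1
  proof (rule runs_eq[OF runs_While[where I = I and i = 0 and n = "k * m" and t = "step_time B P T"
          and e = "\<lambda>_. if good then e else 0"]])
    fix j s'
    assume j: "j < k * m" and I: "I j s'"
    then obtain R' where R': "\<forall>t<k. R' t < m" "base n j R' s'" "clean B n s'"
       "vars s' (B + 7) = vars s (B + 7)" "good \<longrightarrow> search_inv j R'" by (auto simp: I_def)
    have "runs w (step_time B P T) (if good then e else 0) (search_step B k P) s' (I (Suc j))"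
    proof (rule runs_weaken[OF runs_search_step[where good = good and e = e, OF P R'(2,3) n j]])
      fix s''
      assume "\<exists>R''. (\<forall>t<k. R'' t < m) \<and> base n (Suc j) R'' s'' \<and> clean B n s'' \<and>
          vars s'' (B + 7) = vars s' (B + 7) \<and>
          (good \<longrightarrow> R'' = (if hit R' j then R'(j div m := j mod m) else R'))"
      then obtain R'' where R'': "\<forall>t<k. R'' t < m" "base n (Suc j) R'' s''" "clean B n s''"
          "vars s'' (B + 7) = vars s' (B + 7)"
          "good \<longrightarrow> R'' = (if hit R' j then R'(j div m := j mod m) else R')" by blast
      have "good \<longrightarrow> search_inv (Suc j) R''"
        using R''(5) R'(5) search_inv_Suc[OF j, of R'] by auto
      then show "I (Suc j) s''" unfolding I_def using R'' R'(4) by (intro exI[of _ R'']) simp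
    qed (use R' good e in auto)
    then show "exp_val w s' ?guard \<noteq> 0 \<and> runs w (step_time B P T) (if good then e else 0) (search_step B k P) s' (I (Suc j))"
      using guard[OF I] j by simp
  next
    fix s'
    assume "I (k * m) s'"
    then show "exp_val w s' ?guard = 0 \<and> I (k * m) s'" using guard by simp
  qed (use that e in auto)
  let ?check = "If (Op Equal (sum_exp B (k - 1)) (chosen_exp B (k - 1))) (Assign (B + 7) (C 1)) Skip"
  have 3: "runs w 2 0 ?check s2 ?Q" if I: "I (k * m) s2" for s2
  proof -
    obtain R' where R': "\<And>t. t < k \<Longrightarrow> R' t < m" "base n (k * m) R' s2" "clean B n s2"
       "vars s2 (B + 7) = vars s (B + 7)" "good \<longrightarrow> search_inv (k * m) R'" using I by (auto simp: I_def)
    note ev = evn_sum_exp[OF R'(2,1) kmw]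
    have "evn w s2 (Op Equal (sum_exp B (k - 1)) (chosen_exp B (k - 1)))
        (of_bool ((\<Sum>t<k - 1. A (t * m + R' t)) = A ((k - 1) * m + R' (k - 1))))"
      by (intro evn_Equal ev w) (use k in auto)
    also have "(\<Sum>t<k - 1. A (t * m + R' t)) = A ((k - 1) * m + R' (k - 1)) \<longleftrightarrow> solution R'"
      using R'(1) by (simp add: solution_def)
    finally have "den w ?check s2 = (if solution R' then set_var (B + 7) 1 s2 else s2)"
      using w by (subst den_If_evn) auto
    moreover have "?Q (if solution R' then set_var (B + 7) 1 s2 else s2)"
      using R' search_inv_final[of R']
      by (intro exI[of _ R'] exI[of _ "k * m"]) (auto simp: base_def clean_def)
    ultimately have "runs w (cost ?check) 0 ?check s2 ?Q" by (intro runs_den) auto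
    then show ?thesis by (rule runs_weaken) auto
  qed
  have "runs w (1 + ((k * m * (step_time B P T + 2) + 1) + 2 + 1) + 1) (0 + (?e + 0)) (search B k P) s ?Q"
    unfolding search_def by (rule runs_Seq[OF 1], rule runs_Seq[OF 2], assumption) (use 3 e in auto)
  then show ?thesis by (rule runs_weaken) auto
qed

text \<open>The flag \<open>f\<close> is sound in all rounds and complete after round
  \<open>j0\<close>. Only this round is charged with an error, so the sum over the rounds has a
  single term. \<open>L\<close> is the actual number of rounds and \<open>G\<close> a bound on
  it.\<close>

lemma runs_all_searches:
  assumes P: "com_bound P \<le> B" and s: "base 1 q R s" "clean B 1 s" "vars s (B + 7) = 0"
    and R: "\<And>t. t < k \<Longrightarrow> R t < m"
    and good: "sz < 2 ^ j0" "2 ^ j0 \<le> T" "reliable w T l m sz P (2 ^ j0) e" and e: "0 \<le> e"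
    and G: "T < 2 ^ G"
  shows "runs w (G * (k * m * (step_time B P T + 2) + 20) + 1) (real (k * m) * e) (all_searches B k P) s
    (\<lambda>s'. vars s' (B + 7) = of_bool (\<exists>J. solution J))"
    (is "runs _ _ _ _ _ ?Q")
proof -
  define I where "I j s' \<longleftrightarrow> (\<exists>R' q' f. (\<forall>t<k. R' t < m) \<and> base (2 ^ j) q' R' s' \<and> clean B (2 ^ j) s' \<and>
       vars s' (B + 7) = of_bool f \<and> (f \<longrightarrow> (\<exists>J. solution J)) \<and> (j0 < j \<longrightarrow> (\<exists>J. solution J) \<longrightarrow> f))" for j s'
  define L where "L = (LEAST j. T < 2 ^ j)"
  have L: "T < 2 ^ L" "L \<le> G" using G unfolding L_def by (auto intro: LeastI Least_le)
  have below: "2 ^ j \<le> T" if "j < L" for j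
    using not_less_Least[of j "\<lambda>j. T < 2 ^ j"] that unfolding L_def by simp
  have j0: "j0 < L"
  proof (rule ccontr)
    assume "\<not> j0 < L"
    then have "(2::nat) ^ L \<le> 2 ^ j0" by (intro power_increasing) auto
    then show False using L(1) good(2) by linarith
  qed
  let ?guard = "Op Less (Var (B + 4)) (Op Plus (Var (B + 1)) (C 1))"
  let ?body = "Seq (If (Op Less (Var (B + 10)) (Var (B + 4))) (search B k P) Skip)
            (Assign (B + 4) (Op Times (Var (B + 4)) (C 2)))"
  let ?time = "k * m * (step_time B P T + 2) + 10"
  have guard: "exp_val w s' ?guard = of_bool (2 ^ j < T + 1)" if "I j s'" for j s'
  proof -
    have "evn w s' ?guard (of_bool (2 ^ j < T + 1))"
      using that Tw w by (intro evn_Less evn_Var evn_Plus evn_Const) (auto simp: I_def base_def)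
    then show ?thesis by (simp add: evn_def)
  qed
  have I1: "I 0 s"
    unfolding I_def using s R
    by (intro exI[of _ R] exI[of _ q] exI[of _ False]) auto
  have step: "runs w (?time + 3) (if j = j0 then real (k * m) * e else 0) ?body s1 (I (Suc j))"
    if j: "j < L" and I: "I j s1" for j s1
  proof -
    obtain R' q' f where R': "\<And>t. t < k \<Longrightarrow> R' t < m" "base (2 ^ j) q' R' s1" "clean B (2 ^ j) s1"
       "vars s1 (B + 7) = of_bool f" "f \<Longrightarrow> \<exists>J. solution J" "j0 < j \<Longrightarrow> \<exists>J. solution J \<Longrightarrow> f"
      using I by (auto simp: I_def)
    note jT = below[OF j]
    have guard2: "evn w s1 (Op Less (Var (B + 10)) (Var (B + 4))) (of_bool (sz < 2 ^ j))"
      by (intro evn_Less evn_Var w) (use R'(2) in \<open>auto simp: base_def\<close>)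
    define I2 where "I2 s' \<longleftrightarrow> (\<exists>R' q' f. (\<forall>t<k. R' t < m) \<and> base (2 ^ j) q' R' s' \<and> clean B (2 ^ j) s' \<and>
       vars s' (B + 7) = of_bool f \<and> (f \<longrightarrow> (\<exists>J. solution J)) \<and> (j0 < Suc j \<longrightarrow> (\<exists>J. solution J) \<longrightarrow> f))" for s'
    have 1: "runs w (Suc ?time) (if j = j0 then real (k * m) * e else 0)
        (If (Op Less (Var (B + 10)) (Var (B + 4))) (search B k P) Skip) s1 I2"
    proof (rule runs_If, cases "sz < 2 ^ j")
      case True
      have "runs w ?time (if j = j0 then real (k * m) * e else 0) (search B k P) s1 I2"
      proof (rule runs_weaken[OF runs_search[where good = "j = j0" and e = e, OF P R'(2,3) True jT R'(1)]])
        fix s2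
        assume "\<exists>R'' q'. (\<forall>t<k. R'' t < m) \<and> base (2 ^ j) q' R'' s2 \<and> clean B (2 ^ j) s2 \<and>
          vars s2 (B + 7) = (if solution R'' then 1 else vars s1 (B + 7)) \<and>
          (j = j0 \<longrightarrow> (\<exists>J. solution J) \<longrightarrow> solution R'')"
        then obtain R'' q'' where R'': "\<forall>t<k. R'' t < m" "base (2 ^ j) q'' R'' s2" "clean B (2 ^ j) s2"
          "vars s2 (B + 7) = (if solution R'' then 1 else vars s1 (B + 7))"
          "j = j0 \<longrightarrow> (\<exists>J. solution J) \<longrightarrow> solution R''" by blast
        show "I2 s2" unfolding I2_def
          by (intro exI[of _ R''] exI[of _ q''] exI[of _ "solution R'' \<or> f"])
            (use R'' R'(4,5,6) less_Suc_eq in auto)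
      qed (use good(3) e in auto)
      then show "runs w ?time (if j = j0 then real (k * m) * e else 0)
        (if exp_val w s1 (Op Less (Var (B + 10)) (Var (B + 4))) \<noteq> 0 then search B k P else Skip) s1 I2"
        using guard2 True by (simp add: evn_def)
    next
      case False
      then have "j \<noteq> j0" using good(1) by auto
      then have "I2 s1" unfolding I2_def
        by (intro exI[of _ R'] exI[of _ q'] exI[of _ f]) (use R' less_Suc_eq in auto)
      then have "runs w ?time (if j = j0 then real (k * m) * e else 0) Skip s1 I2"
        by (intro runs_weaken[OF runs_den[of Skip I2]]) (use e in auto)
      then show "runs w ?time (if j = j0 then real (k * m) * e else 0)
        (if exp_val w s1 (Op Less (Var (B + 10)) (Var (B + 4))) \<noteq> 0 then search B k P else Skip) s1 I2"
        using guard2 False by (simp add: evn_def)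
    qed
    have 2: "runs w 1 0 (Assign (B + 4) (Op Times (Var (B + 4)) (C 2))) s2 (I (Suc j))" if "I2 s2" for s2
    proof -
      obtain R' q' f where R': "\<forall>t<k. R' t < m" "base (2 ^ j) q' R' s2" "clean B (2 ^ j) s2"
         "vars s2 (B + 7) = of_bool f" "f \<longrightarrow> (\<exists>J. solution J)" "j0 < Suc j \<longrightarrow> (\<exists>J. solution J) \<longrightarrow> f"
        using \<open>I2 s2\<close> by (auto simp: I2_def)
      have c: "(2::nat) ^ j * 2 < 2 ^ w" "(2::nat) < 2 ^ w" using jT Tw by linarith+
      have "evn w s2 (Op Times (Var (B + 4)) (C 2)) (2 ^ j * 2)"
        by (intro evn_Times evn_Var evn_Const c) (use R'(2) in \<open>simp add: base_def\<close>)
      then have d: "den w (Assign (B + 4) (Op Times (Var (B + 4)) (C 2))) s2 = set_var (B + 4) (int (2 ^ Suc j)) s2"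
        by (simp add: evn_def mult.commute)
      \<comment> \<open>The exempt input area grows with the size, so cleanliness passes on to the
        next size.\<close>
      have cl: "clean B (2 ^ Suc j) s2"
        unfolding clean_def
      proof (intro allI impI)
        fix a z
        assume a: "a < B" and nz: "\<not> (a = 0 \<and> 0 \<le> z \<and> z < int (6 * 2 ^ Suc j + 2))"
        have "int (6 * 2 ^ j + 2) \<le> int (6 * 2 ^ Suc j + 2)" by simp
        then have "\<not> (a = 0 \<and> 0 \<le> z \<and> z < int (6 * 2 ^ j + 2))" using nz by linarith
        then show "arrs s2 a z = 0" using R'(3) a unfolding clean_def by blast
      qed
      have "I (Suc j) (set_var (B + 4) (int (2 ^ Suc j)) s2)"
        unfolding I_def using R' cl
        by (intro exI[of _ R'] exI[of _ q'] exI[of _ f]) (auto simp: base_def clean_def)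
      then show ?thesis
        using runs_den[of "Assign (B + 4) (Op Times (Var (B + 4)) (C 2))" "I (Suc j)" w s2] unfolding d by simp
    qed
    show ?thesis
      by (rule runs_weaken[OF runs_Seq[OF 1 2]]) auto
  qed
  have "runs w ((L - 0) * (?time + 3 + 2) + 1) (\<Sum>j=0..<L. if j = j0 then real (k * m) * e else 0)
      (all_searches B k P) s ?Q"
    unfolding all_searches_def
  proof (rule runs_While[where I = I])
    fix j s'
    assume "j < L" "I j s'"
    then show "exp_val w s' ?guard \<noteq> 0 \<and> runs w (?time + 3) (if j = j0 then real (k * m) * e else 0) ?body s' (I (Suc j))"
      using step guard below[of j] by simp
  next
    fix s'
    assume I: "I L s'"
    then show "exp_val w s' ?guard = 0 \<and> ?Q s'"
      using guard[OF I] L(1) j0 by (auto simp: I_def)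
  qed (use I1 e in auto)
  then show ?thesis
  proof (rule runs_weaken)
    have "L * (?time + 3 + 2) \<le> G * (?time + 10)" by (intro mult_le_mono L) simp
    then show "(L - 0) * (?time + 3 + 2) + 1 \<le> G * (k * m * (step_time B P T + 2) + 20) + 1" by (simp add: algebra_simps)
  qed (use j0 in auto)
qed

end

section \<open>The reduction\<close>

text \<open>The exponent is a constant of the program, so the repeated product is still an
  expression of constant size.\<close>

primrec power_exp :: "nat \<Rightarrow> nat \<Rightarrow> exp" where
  "power_exp x 0 = C 1"
| "power_exp x (Suc i) = Op Times (power_exp x i) (Var x)"

lemma evn_power_exp:
  assumes "vars s x = int m" and "0 < m" and "m ^ r < 2 ^ w" and "i \<le> r"
  shows "evn w s (power_exp x i) (m ^ i)"
  using assms(4)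
proof (induction i)
  case 0
  have "1 < (2::nat) ^ w" using assms(2,3) one_le_power[of m r] by linarith
  then show ?case using evn_Const[of 1 w s] by simp
next
  case (Suc i)
  have "m ^ Suc i \<le> m ^ r" using Suc.prems assms(2) by (intro power_increasing) auto
  then have "m ^ i * m < 2 ^ w" using assms(3) by (simp add: mult.commute)
  then show ?case
    using evn_Times[OF Suc.IH evn_Var[OF assms(1)]] Suc.prems by (simp add: mult.commute)
qed

text \<open>Array 0 is to become the input array of the given program, so the instance is moved out
  and its cells are zeroed. Cells 0 and 1 keep \<open>m\<close> and \<open>U\<close>; they lie in
  the area exempt from \<open>clean\<close>.\<close>

definition copy_instance :: "nat \<Rightarrow> nat \<Rightarrow> com" where
  "copy_instance B k =
     While (Op Less (Var (B + 6)) (Op Times (C k) (Var (B + 2))))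
       (Seq (Store (B + 1) (Var (B + 6)) (Cell 0 (Op Plus (Var (B + 6)) (C 2))))
       (Seq (Store 0 (Op Plus (Var (B + 6)) (C 2)) (C 0))
            (Assign (B + 6) (Op Plus (Var (B + 6)) (C 1)))))"

definition compute_level :: "nat \<Rightarrow> nat \<Rightarrow> com" where
  "compute_level B k =
     While (Op Less (Var (B + 9)) (Op Plus (Op Times (C k) (Var (B + 8))) (C 1)))
       (Seq (Assign (B + 9) (Op Times (Var (B + 9)) (C 2)))
            (Assign (B + 3) (Op Plus (Var (B + 3)) (C 1))))"

definition budget_exp :: "nat \<Rightarrow> nat \<Rightarrow> nat \<Rightarrow> exp" where
  "budget_exp B r c = Op Times (C c)
     (Op Plus (Op Divide (Op Plus (Var (B + 8)) (power_exp (B + 2) r)) (power_exp (B + 2) 4)) (C 1))"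

definition reduction :: "nat \<Rightarrow> nat \<Rightarrow> nat \<Rightarrow> nat \<Rightarrow> com \<Rightarrow> com" where
  "reduction B k r c P =
     Seq (Seq (Assign (B + 2) (Cell 0 (C 0))) (Assign (B + 8) (Cell 0 (C 1))))
    (Seq (copy_instance B k)
    (Seq (Assign (B + 9) (C 1))
    (Seq (compute_level B k)
    (Seq (Seq (Assign (B + 10) (Op Times (Op Plus (Var (B + 3)) (C 1)) (Op Plus (Op Times (C k) (Var (B + 2))) (C 1))))
         (Seq (Assign (B + 1) (budget_exp B r c)) (Assign (B + 4) (C 1))))
    (Seq (all_searches B k P)
         (Assign 0 (Var (B + 7))))))))"

text \<open>
  For \<open>U = O(m ^ r)\<close> the budget is \<open>O(m ^ (r - 4))\<close>, which leaves room for polynomially many calls; still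
  it exceeds \<open>N powr (1 / 3 - \<eta>)\<close> because the strings have length \<open>N = \<Theta>(m ^ (2 * r) * U)\<close>.
\<close>

definition budget :: "nat \<Rightarrow> nat \<Rightarrow> nat \<Rightarrow> nat \<Rightarrow> nat" where
  "budget r c m U = c * ((U + m ^ r) div m ^ 4 + 1)"

text \<open>\<open>k * U\<close> bounds the sum of \<open>k\<close> shifts, which must stay below
  2^l to avoid carries. Minimality keeps 2^l within a factor 2 of it, and hence the length in O(m^k
  * U).\<close>

definition level_bits :: "nat \<Rightarrow> nat \<Rightarrow> nat" where
  "level_bits k U = (LEAST j. k * U < 2 ^ j)"

lemma level_bits:
  assumes "0 < k" and "0 < U"
  shows "k * U < 2 ^ level_bits k U" and "0 < level_bits k U" and "2 ^ level_bits k U \<le> 2 * (k * U)"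
    and "j < level_bits k U \<Longrightarrow> 2 ^ j \<le> k * U"
proof -
  show 1: "k * U < 2 ^ level_bits k U"
    unfolding level_bits_def by (rule LeastI[of _ "k * U"]) simp
  show "0 < level_bits k U"
  proof (rule ccontr)
    assume "\<not> 0 < level_bits k U"
    then have "k * U < 1" using 1 by simp
    then show False using assms by simp
  qed
  then obtain j where j: "level_bits k U = Suc j" using gr0_conv_Suc by auto
  show below: "2 ^ j \<le> k * U" if "j < level_bits k U" for j
    using not_less_Least[of j "\<lambda>j. k * U < 2 ^ j"] that unfolding level_bits_def by simp
  then show "2 ^ level_bits k U \<le> 2 * (k * U)" using below[of j] j by simp
qed

lemma nth_concat_uniform:
  assumes "\<And>xs. xs \<in> set xss \<Longrightarrow> length xs = m" and "i < length xss" and "j < m"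
  shows "concat xss ! (i * m + j) = xss ! i ! j"
  using assms
proof (induction xss arbitrary: i)
  case (Cons xs xss)
  then show ?case
    by (cases i) (auto simp: nth_append add.assoc)
qed simp

lemma output_prob_runs:
  assumes "runs w t e c (init_state w inp) (\<lambda>s. vars s 0 = z)" and "t \<le> t'"
  shows "1 - e \<le> output_prob w c inp t' z"
proof -
  have "1 - e \<le> ewp w (t + (t' - t)) c (init_state w inp) (\<lambda>u' s'. of_bool (t' - t \<le> u' \<and> vars s' 0 = z))"
    using assms(1) unfolding runs_def by blast
  also have "\<dots> \<le> ewp w (t + (t' - t)) c (init_state w inp) (\<lambda>_ s'. of_bool (vars s' 0 = z))"
    by (rule ewp_mono) auto
  finally show ?thesis
    using assms(2) by (simp add: ewp_eq_prob output_prob_def)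
qed

context machine
begin

lemma runs_copy_instance:
  assumes v: "vars s (B + 2) = int m" "vars s (B + 6) = 0" and kmw: "k * m + 2 < 2 ^ w"
    and inp: "\<And>p. p < k * m \<Longrightarrow> arrs s 0 (int (p + 2)) = int (A p)"
  shows "runs w (k * m * 7 + 1) 0 (copy_instance B k) s
    (\<lambda>s'. (\<forall>v. v \<noteq> B + 6 \<longrightarrow> vars s' v = vars s v) \<and> (\<forall>p<k * m. arrs s' (B + 1) (int p) = int (A p)) \<and>
      (\<forall>z. arrs s' 0 z = (if 2 \<le> z \<and> z < int (k * m + 2) then 0 else arrs s 0 z)) \<and>
      (\<forall>a. a \<noteq> 0 \<and> a \<noteq> B + 1 \<longrightarrow> arrs s' a = arrs s a))"
    (is "runs _ _ _ _ _ ?Q")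
proof -
  define I where "I i s' \<longleftrightarrow> (\<forall>v. v \<noteq> B + 6 \<longrightarrow> vars s' v = vars s v) \<and> vars s' (B + 6) = int i \<and>
      (\<forall>p<i. arrs s' (B + 1) (int p) = int (A p)) \<and>
      (\<forall>z. arrs s' 0 z = (if 2 \<le> z \<and> z < int (i + 2) then 0 else arrs s 0 z)) \<and>
      (\<forall>a. a \<noteq> 0 \<and> a \<noteq> B + 1 \<longrightarrow> arrs s' a = arrs s a)" for i and s' :: state
  let ?guard = "Op Less (Var (B + 6)) (Op Times (C k) (Var (B + 2)))"
  let ?body = "Seq (Store (B + 1) (Var (B + 6)) (Cell 0 (Op Plus (Var (B + 6)) (C 2))))
       (Seq (Store 0 (Op Plus (Var (B + 6)) (C 2)) (C 0)) (Assign (B + 6) (Op Plus (Var (B + 6)) (C 1))))"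
  have "k \<le> k * m" using m by simp
  then have kw: "k < 2 ^ w" using kmw by linarith
  have guard: "exp_val w s' ?guard = of_bool (i < k * m)" if I: "I i s'" for i s'
  proof -
    have "evn w s' ?guard (of_bool (i < k * m))"
      by (intro evn_Less evn_Var evn_Times evn_Const kw w) (use I v kmw in \<open>auto simp: I_def\<close>)
    then show ?thesis by (simp add: evn_def)
  qed
  have step: "runs w 5 0 ?body s1 (I (Suc i))" if i: "i < k * m" and I: "I i s1" for i s1
  proof -
    have x: "vars s1 (B + 6) = int i" using I by (simp add: I_def)
    have iw: "i + 2 < 2 ^ w" using i kmw by linarith
    have e2: "evn w s' (Op Plus (Var (B + 6)) (C 2)) (i + 2)"
      and e1: "evn w s' (Op Plus (Var (B + 6)) (C 1)) (i + 1)" if "vars s' = vars s1" for s'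
      by (intro evn_Plus evn_Var evn_Const; use that x iw in simp)+
    have "arrs s1 0 (int (i + 2)) = int (A i)" using I inp[OF i] by (simp add: I_def)
    then have e3: "evn w s1 (Cell 0 (Op Plus (Var (B + 6)) (C 2))) (A i)"
      by (rule evn_Cell[OF e2[OF refl]])
    have "den w ?body s1 = set_var (B + 6) (int (i + 1)) (set_cell 0 (int (i + 2)) 0 (set_cell (B + 1) (int i) (int (A i)) s1))"
      using e1 e2 e3 x unfolding evn_def den.simps by (simp del: exp_val.simps(3,4))
    moreover have "I (Suc i) \<dots>"
      using I B by (auto simp: I_def less_Suc_eq)
    ultimately have "runs w (cost ?body) 0 ?body s1 (I (Suc i))" by (intro runs_den) auto
    then show ?thesis by (rule runs_weaken) auto
  qed
  have "runs w ((k * m - 0) * (5 + 2) + 1) (\<Sum>j=0..<k * m. 0) (copy_instance B k) s ?Q"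
    unfolding copy_instance_def
  proof (rule runs_While[where I = I])
    show "I 0 s" using v by (auto simp: I_def)
  next
    fix j s'
    assume "j < k * m" "I j s'"
    then show "exp_val w s' ?guard \<noteq> 0 \<and> runs w 5 0 ?body s' (I (Suc j))" using guard step by simp
  next
    fix s'
    assume I: "I (k * m) s'"
    then show "exp_val w s' ?guard = 0 \<and> ?Q s'" using guard[OF I] by (simp add: I_def)
  qed auto
  then show ?thesis by (rule runs_weaken) auto
qed

end

lemma runs_compute_level:
  fixes k U w :: nat
  assumes k: "0 < k" and U: "0 < U" and v: "vars s (B + 8) = int U" "vars s (B + 9) = 1" "vars s (B + 3) = 0"
    and kUw: "2 * (k * U) + 2 < 2 ^ w" and w: "0 < w"
  shows "runs w (level_bits k U * 5 + 1) 0 (compute_level B k) s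
    (\<lambda>s'. (\<forall>v. v \<noteq> B + 9 \<and> v \<noteq> B + 3 \<longrightarrow> vars s' v = vars s v) \<and> vars s' (B + 3) = int (level_bits k U) \<and>
       arrs s' = arrs s)"
    (is "runs _ _ _ _ _ ?Q")
proof -
  let ?l = "level_bits k U"
  define I where "I i s' \<longleftrightarrow> (\<forall>v. v \<noteq> B + 9 \<and> v \<noteq> B + 3 \<longrightarrow> vars s' v = vars s v) \<and>
      vars s' (B + 3) = int i \<and> vars s' (B + 9) = int (2 ^ i) \<and> arrs s' = arrs s" for i and s' :: state
  let ?guard = "Op Less (Var (B + 9)) (Op Plus (Op Times (C k) (Var (B + 8))) (C 1))"
  let ?body = "Seq (Assign (B + 9) (Op Times (Var (B + 9)) (C 2)))
            (Assign (B + 3) (Op Plus (Var (B + 3)) (C 1)))"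
  have "k \<le> k * U" using U by simp
  then have kw: "k < 2 ^ w" "k * U < 2 ^ w" "k * U + 1 < 2 ^ w" "(1::nat) < 2 ^ w" "(2::nat) < 2 ^ w"
    using kUw by linarith+
  have guard: "exp_val w s' ?guard = of_bool (2 ^ i < k * U + 1)" if I: "I i s'" for i s'
  proof -
    have "evn w s' ?guard (of_bool (2 ^ i < k * U + 1))"
      by (intro evn_Less evn_Var evn_Plus evn_Times evn_Const kw w) (use I v in \<open>auto simp: I_def\<close>)
    then show ?thesis by (simp add: evn_def)
  qed
  have step: "runs w 3 0 ?body s1 (I (Suc i))" if i: "i < ?l" and I: "I i s1" for i s1
  proof -
    have p: "2 ^ i \<le> k * U" using level_bits(4)[OF k U i] .
    have i2: "2 ^ i * 2 < (2::nat) ^ w" using p kUw by linarith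
    have "i < 2 ^ i" by simp
    then have i1: "i + 1 < 2 ^ w" using p kw(3) by linarith
    have e1: "evn w s1 (Op Times (Var (B + 9)) (C 2)) (2 ^ i * 2)"
      by (intro evn_Times evn_Var evn_Const kw i2) (use I in \<open>auto simp: I_def\<close>)
    have e2: "evn w (set_var (B + 9) (int (2 ^ i * 2)) s1) (Op Plus (Var (B + 3)) (C 1)) (i + 1)"
      by (intro evn_Plus evn_Var evn_Const kw i1) (use I in \<open>auto simp: I_def\<close>)
    have "den w ?body s1 = set_var (B + 3) (int (i + 1)) (set_var (B + 9) (int (2 ^ i * 2)) s1)"
      using e1 e2 unfolding evn_def by (simp only: den.simps)
    moreover have "I (Suc i) \<dots>" using I by (auto simp: I_def)
    ultimately have "runs w (cost ?body) 0 ?body s1 (I (Suc i))" by (intro runs_den) auto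
    then show ?thesis by (rule runs_weaken) auto
  qed
  have "runs w ((?l - 0) * (3 + 2) + 1) (\<Sum>j=0..<?l. 0) (compute_level B k) s ?Q"
    unfolding compute_level_def
  proof (rule runs_While[where I = I])
    show "I 0 s" using v by (auto simp: I_def)
  next
    fix j s'
    assume j: "j < ?l" and I: "I j s'"
    have "2 ^ j < k * U + 1" using level_bits(4)[OF k U j] by linarith
    then show "exp_val w s' ?guard \<noteq> 0 \<and> runs w 3 0 ?body s' (I (Suc j))" using guard[OF I] step[OF j I] by simp
  next
    fix s'
    assume I: "I ?l s'"
    have "\<not> 2 ^ ?l < k * U + 1" using level_bits(1)[OF k U] by linarith
    then show "exp_val w s' ?guard = 0 \<and> ?Q s'" using guard[OF I] I by (simp add: I_def)
  qed auto
  then show ?thesis by (rule runs_weaken) auto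
qed

lemma runs_reduction:
  fixes k m U w B r c :: nat and As :: "int list list"
  defines "T \<equiv> budget r c m U" and "l \<equiv> level_bits k U"
  defines "sz \<equiv> (l + 1) * (k * m + 1)"
  assumes inst: "ksum_instance k m U As" and B: "0 < B" and k: "0 < k" and m: "0 < m" and r: "4 \<le> r" and c: "0 < c"
    and P: "com_bound P \<le> B" and e: "0 \<le> e"
    and Tw: "6 * T + 8 < 2 ^ w" and kU2w: "2 * (k * U) + 2 < 2 ^ w" and Umw: "U + m ^ r < 2 ^ w"
    and good: "sz < 2 ^ j0" "2 ^ j0 \<le> T" "reliable w T l m sz P (2 ^ j0) e"
      and G: "T < 2 ^ G"
  shows "runs w (k * m * 7 + l * 5 + G * (k * m * (step_time B P T + 2) + 20) + 50) (real (k * m) * e)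
    (reduction B k r c P) (init_state w (ksum_input m U As))
    (\<lambda>s. vars s 0 = of_bool (ksum_solvable k As))"
proof -
  have As: "length As = k" "\<And>A. A \<in> set As \<Longrightarrow> length A = m" "\<And>A. A \<in> set As \<Longrightarrow> set A \<subseteq> {1..int U}"
    using inst by (auto simp: ksum_instance_def)
  define A where "A p = nat (concat As ! p)" for p
  have lenA: "length (concat As) = k * m"
    using As(1,2) by (induction As arbitrary: k) auto
  have Ap: "1 \<le> concat As ! p \<and> concat As ! p \<le> int U" if "p < k * m" for p
  proof -
    have "concat As ! p \<in> set (concat As)" by (rule nth_mem) (use that lenA in simp)
    then obtain A where "A \<in> set As" "concat As ! p \<in> set A" by auto
    then show ?thesis using As(3)[of A] by auto
  qed
  have Apn: "int (A p) = concat As ! p" "A p \<le> U" if "p < k * m" for p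
    using Ap[OF that] by (auto simp: A_def)
  have "0 < k * m" using k m by simp
  from Ap[OF this] have U: "0 < U" by simp
  note lb = level_bits[OF k U, folded l_def]
  have kU': "k * U < 2 ^ w" using kU2w by linarith
  interpret machine w B k m l sz T U A
    by unfold_locales (use B k m lb sz_def Apn(2) kU' Tw in auto)
  have km: "k * m < sz" using lb(2) by (simp add: sz_def)
  have szT: "sz < T" using good(1,2) by linarith
  have szw: "sz < 2 ^ w" "k * m + 2 < 2 ^ w" using km szT Tw by linarith+
  define s0 where "s0 = init_state w (ksum_input m U As)"
  have inp: "ksum_input m U As ! (p + 2) = concat As ! p" for p by (simp add: ksum_input_def)
  have len: "length (ksum_input m U As) = k * m + 2" by (simp add: ksum_input_def lenA)
  have Uw: "U < 2 ^ w" "m < 2 ^ w"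
  proof -
    show "U < 2 ^ w" using Umw by linarith
    have "m \<le> k * m" using k by simp
    then show "m < 2 ^ w" using szw(2) by linarith
  qed
  have cell: "arrs s0 0 (int i) = wrap w (ksum_input m U As ! i)" if "i < k * m + 2" for i
  proof -
    have "i < length (ksum_input m U As)" using that len by simp
    then show ?thesis by (simp add: s0_def init_state_def)
  qed
  have cells: "arrs s0 0 0 = int m" "arrs s0 0 1 = int U"
    using cell[of 0] cell[of 1] Uw by (simp_all add: ksum_input_def)
  have cellsA: "arrs s0 0 (int (p + 2)) = int (A p)" if "p < k * m" for p
  proof -
    have "A p < 2 ^ w" using Apn(2)[OF that] Uw by linarith
    then have "wrap w (int (A p)) = int (A p)" by (rule wrap_int)
    moreover have "p + 2 < k * m + 2" using that by simp
    ultimately show ?thesis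
      using cell[of "p + 2"] by (simp only: inp Apn(1)[OF that])
  qed
  have zero: "vars s0 v = 0" "a \<noteq> 0 \<Longrightarrow> arrs s0 a z = 0" "\<not> (0 \<le> z \<and> z < int (k * m + 2)) \<Longrightarrow> arrs s0 0 z = 0" for v a z
    by (auto simp: s0_def init_state_def len)
  \<comment> \<open>\<open>K1\<close> to \<open>K4\<close> are the assertions between the phases:
    after reading the parameters, copying the instance, computing the level, and setting the budget
    and the first size.\<close>
  define K1 where "K1 s \<longleftrightarrow> vars s (B + 2) = int m \<and> vars s (B + 8) = int U \<and>
      (\<forall>v. v \<noteq> B + 2 \<and> v \<noteq> B + 8 \<longrightarrow> vars s v = 0) \<and> arrs s = arrs s0" for s :: state
  define K2 where "K2 s \<longleftrightarrow> vars s (B + 2) = int m \<and> vars s (B + 8) = int U \<and> vars s (B + 3) = 0 \<and>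
      vars s (B + 5) = 0 \<and> vars s (B + 7) = 0 \<and>
      (\<forall>p<k * m. arrs s (B + 1) (int p) = int (A p)) \<and> (\<forall>t<k. arrs s (B + 2) (int t) = 0) \<and> clean B 1 s" for s :: state
  define K3 where "K3 s \<longleftrightarrow> vars s (B + 2) = int m \<and> vars s (B + 8) = int U \<and> vars s (B + 3) = int l \<and>
      vars s (B + 5) = 0 \<and> vars s (B + 7) = 0 \<and>
      (\<forall>p<k * m. arrs s (B + 1) (int p) = int (A p)) \<and> (\<forall>t<k. arrs s (B + 2) (int t) = 0) \<and> clean B 1 s" for s :: state
  define K4 where "K4 s \<longleftrightarrow> base 1 0 (\<lambda>_. 0) s \<and> clean B 1 s \<and> vars s (B + 7) = 0" for s
  let ?i1 = "Seq (Assign (B + 2) (Cell 0 (C 0))) (Assign (B + 8) (Cell 0 (C 1)))"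
  have 1: "runs w 3 0 ?i1 s0 K1"
  proof -
    have "K1 (den w ?i1 s0)"
      using cells zero w by (auto simp: K1_def)
    then have "runs w (cost ?i1) 0 ?i1 s0 K1" by (intro runs_den) auto
    then show ?thesis by (rule runs_weaken) auto
  qed
  have 2: "runs w (k * m * 7 + 1) 0 (copy_instance B k) s K2" if K1: "K1 s" for s
  proof (rule runs_weaken[OF runs_copy_instance])
    fix s' :: state
    assume s': "(\<forall>v. v \<noteq> B + 6 \<longrightarrow> vars s' v = vars s v) \<and> (\<forall>p<k * m. arrs s' (B + 1) (int p) = int (A p)) \<and>
      (\<forall>z. arrs s' 0 z = (if 2 \<le> z \<and> z < int (k * m + 2) then 0 else arrs s 0 z)) \<and>
      (\<forall>a. a \<noteq> 0 \<and> a \<noteq> B + 1 \<longrightarrow> arrs s' a = arrs s a)"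
    have "arrs s' a z = 0" if a: "a < B" "\<not> (a = 0 \<and> 0 \<le> z \<and> z < int (6 * 1 + 2))" for a z
    proof (cases "a = 0")
      case True
      then have "arrs s' 0 z = (if 2 \<le> z \<and> z < int (k * m + 2) then 0 else arrs s0 0 z)"
        using s' K1 by (simp add: K1_def)
      then show ?thesis using True a(2) zero(3)[of z] by auto
    next
      case False
      then show ?thesis using a s' K1 zero(2)[of a z] by (simp add: K1_def)
    qed
    then have "clean B 1 s'" unfolding clean_def by blast
    then show "K2 s'" using s' K1 B zero(2)[of "B + 2"] unfolding K2_def by (simp add: K1_def)
  qed (use K1 cellsA szw in \<open>auto simp: K1_def\<close>)
  have 3: "runs w 1 0 (Assign (B + 9) (C 1)) s (\<lambda>s'. K2 s' \<and> vars s' (B + 9) = 1)" if K2: "K2 s" for s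
    using runs_den[of "Assign (B + 9) (C 1)" "\<lambda>s'. K2 s' \<and> vars s' (B + 9) = 1" w s] K2 w
    by (simp add: K2_def clean_def)
  have 4: "runs w (l * 5 + 1) 0 (compute_level B k) s K3" if K2: "K2 s \<and> vars s (B + 9) = 1" for s
    unfolding l_def
    by (rule runs_weaken[OF runs_compute_level[OF k U _ _ _ kU2w w]])
      (use K2 in \<open>auto simp: K2_def K3_def l_def clean_def\<close>)
  let ?e10 = "Op Times (Op Plus (Var (B + 3)) (C 1)) (Op Plus (Op Times (C k) (Var (B + 2))) (C 1))"
  let ?i5 = "Seq (Assign (B + 10) ?e10) (Seq (Assign (B + 1) (budget_exp B r c)) (Assign (B + 4) (C 1)))"
  have 5: "runs w 5 0 ?i5 s K4" if K3: "K3 s" for s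
  proof -
    have v: "vars s (B + 3) = int l" "vars s (B + 2) = int m" "vars s (B + 8) = int U"
      using K3 by (auto simp: K3_def)
    have "k * 1 \<le> k * m" using m by (intro mult_le_mono2) simp
    then have kw: "k < 2 ^ w" "1 < (2::nat) ^ w" "k * m < 2 ^ w" "k * m + 1 < 2 ^ w" using szw by linarith+
    have "l + 1 \<le> sz" unfolding sz_def by simp
    then have lw: "l + 1 < 2 ^ w" using szw(1) by (rule le_less_trans)
    have e10: "evn w s ?e10 sz"
      unfolding sz_def by (intro evn_Times evn_Plus evn_Var v evn_Const kw lw szw(1)[unfolded sz_def])
    define s1 where "s1 = set_var (B + 10) (int sz) s"
    have v1: "vars s1 (B + 2) = int m" "vars s1 (B + 8) = int U" using v by (simp_all add: s1_def)
    have mr: "m ^ r < 2 ^ w" using Umw by linarith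
    note pw = evn_power_exp[OF v1(1) m mr]
    have le: "(U + m ^ r) div m ^ 4 + 1 \<le> T"
      unfolding T_def budget_def using mult_le_mono1[of 1 c "(U + m ^ r) div m ^ 4 + 1"] c by simp
    have "c \<le> T" unfolding T_def budget_def by simp
    then have bw: "c < 2 ^ w" "T < 2 ^ w" "(U + m ^ r) div m ^ 4 + 1 < 2 ^ w" using le Tw by linarith+
    have e1: "evn w s1 (budget_exp B r c) T"
      unfolding budget_exp_def T_def budget_def
      by (intro evn_Times evn_Plus evn_Divide evn_Var v1 evn_Const pw kw Umw bw bw(2)[unfolded T_def budget_def] r order_refl)
    have "den w ?i5 s = set_var (B + 4) 1 (set_var (B + 1) (int T) s1)"
      using e10 e1 w unfolding evn_def den.simps s1_def by simp
    moreover have "K4 \<dots>"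
      using K3 by (simp add: K4_def K3_def base_def clean_def s1_def)
    ultimately have "runs w (cost ?i5) 0 ?i5 s K4" by (intro runs_den) auto
    then show ?thesis by (rule runs_weaken) auto
  qed
  have 6: "runs w (G * (k * m * (step_time B P T + 2) + 20) + 1) (real (k * m) * e) (all_searches B k P) s
      (\<lambda>s'. vars s' (B + 7) = of_bool (\<exists>J. solution J))" if "K4 s" for s
    by (rule runs_all_searches[where R = "\<lambda>_. 0" and q = 0, OF P _ _ _ _ good e G])
      (use that m in \<open>auto simp: K4_def\<close>)
  have sol: "(\<exists>J. solution J) \<longleftrightarrow> ksum_solvable k As"
  proof -
    have idx: "int (A (t * m + J t)) = As ! t ! J t" if "t < k" "J t < m" for J :: "nat \<Rightarrow> nat" and t
    proof -
      have "t * m + J t < (t + 1) * m" using that by simp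
      also have "\<dots> \<le> k * m" using that by (intro mult_le_mono1) simp
      finally show ?thesis
        using Apn(1) nth_concat_uniform[of As m t "J t"] As that by simp
    qed
    have eq: "solution J \<longleftrightarrow> (\<forall>t<k. J t < m) \<and> (\<Sum>t<k - 1. As ! t ! J t) = As ! (k - 1) ! J (k - 1)" for J
    proof (cases "\<forall>t<k. J t < m")
      case True
      have "(\<Sum>t<k - 1. As ! t ! J t) = int (\<Sum>t<k - 1. A (t * m + J t))"
        unfolding of_nat_sum using idx[of _ J] True by (intro sum.cong) auto
      moreover have "As ! (k - 1) ! J (k - 1) = int (A ((k - 1) * m + J (k - 1)))"
        using idx[of "k - 1" J] True k by simp
      ultimately show ?thesis using True by (simp only: solution_def of_nat_eq_iff)
    qed (auto simp: solution_def)
    show ?thesis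
    proof
      assume "\<exists>J. solution J"
      then obtain J where J: "\<forall>t<k. J t < m" "(\<Sum>t<k - 1. As ! t ! J t) = As ! (k - 1) ! J (k - 1)"
        using eq by blast
      then show "ksum_solvable k As"
        unfolding ksum_solvable_def using As by (intro exI[of _ "\<lambda>t. As ! t ! J t"]) auto
    next
      assume "ksum_solvable k As"
      then obtain a where a: "\<forall>i<k. a i \<in> set (As ! i)" "(\<Sum>i<k - 1. a i) = a (k - 1)"
        by (auto simp: ksum_solvable_def)
      have "\<exists>j<m. As ! i ! j = a i" if "i < k" for i
        using a(1) that As by (metis in_set_conv_nth nth_mem)
      then obtain J where J: "\<And>i. i < k \<Longrightarrow> J i < m \<and> As ! i ! J i = a i" by metis
      have "(\<Sum>t<k - 1. As ! t ! J t) = (\<Sum>t<k - 1. a t)" using J by (intro sum.cong) auto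
      then have "solution J" using a(2) J k by (auto simp: eq)
      then show "\<exists>J. solution J" by blast
    qed
  qed
  have 7: "runs w 1 0 (Assign 0 (Var (B + 7))) s (\<lambda>s'. vars s' 0 = of_bool (ksum_solvable k As))"
    if "vars s (B + 7) = of_bool (\<exists>J. solution J)" for s
    using runs_den[of "Assign 0 (Var (B + 7))" "\<lambda>s'. vars s' 0 = of_bool (ksum_solvable k As)" w s] that sol
    by simp
  have "runs w (3 + ((k * m * 7 + 1) + (1 + ((l * 5 + 1) + (5 +
      ((G * (k * m * (step_time B P T + 2) + 20) + 1) + 1 + 1) + 1) + 1) + 1) + 1) + 1)
     (0 + (0 + (0 + (0 + (0 + (real (k * m) * e + 0))))))
     (reduction B k r c P) s0 (\<lambda>s'. vars s' 0 = of_bool (ksum_solvable k As))"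
    unfolding reduction_def
    by (rule runs_Seq[OF 1], rule runs_Seq[OF 2], assumption, rule runs_Seq[OF 3], assumption,
        rule runs_Seq[OF 4], assumption, rule runs_Seq[OF 5], assumption, rule runs_Seq[OF 6], assumption, rule 7)
      (use e in auto)
  then show ?thesis
    unfolding s0_def by (rule runs_weaken) auto
qed

section \<open>Choice of the parameters\<close>

text \<open>With m^k \<le> N for k = 2r, the second condition gives N^(-\<eta>) \<le> m^(-4),
  matching the division in \<open>budget\<close>. The third and the fifth make the unpadded programs
  smaller than N^\<epsilon>, and the fourth turns the union bound over k * m calls into an error of
  at most 1/m.\<close>

lemma parameters_exist:
  fixes \<epsilon> \<gamma> \<eta> :: real
  assumes "0 < \<epsilon>" and "0 < \<gamma>" and "0 < \<eta>"
  obtains r :: nat where "6 \<le> r" and "4 \<le> real (2 * r) * \<eta>" and "1 \<le> real (2 * r) * \<epsilon>"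
    and "real (2 * r) \<le> 2 powr (real (2 * r) * \<gamma> - 2)"
    and "4 * real (2 * r) < 2 powr (real (2 * r) * \<epsilon> - 1) * (\<epsilon> * ln 2)"
proof -
  have "eventually (\<lambda>r :: nat. 6 \<le> r) sequentially"
    by (rule eventually_ge_at_top)
  moreover have "eventually (\<lambda>r :: nat. 4 \<le> real (2 * r) * \<eta>) sequentially"
    using assms by real_asymp
  moreover have "eventually (\<lambda>r :: nat. 1 \<le> real (2 * r) * \<epsilon>) sequentially"
    using assms by real_asymp
  moreover have "eventually (\<lambda>r :: nat. real (2 * r) \<le> 2 powr (real (2 * r) * \<gamma> - 2)) sequentially"
    using assms by real_asymp
  moreover have "eventually (\<lambda>r :: nat. 4 * real (2 * r) < 2 powr (real (2 * r) * \<epsilon> - 1) * (\<epsilon> * ln 2)) sequentially"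
    using assms by real_asymp
  ultimately have "eventually (\<lambda>r :: nat. 6 \<le> r \<and> 4 \<le> real (2 * r) * \<eta> \<and> 1 \<le> real (2 * r) * \<epsilon> \<and>
      real (2 * r) \<le> 2 powr (real (2 * r) * \<gamma> - 2) \<and>
      4 * real (2 * r) < 2 powr (real (2 * r) * \<epsilon> - 1) * (\<epsilon> * ln 2)) sequentially"
    by eventually_elim auto
  then show ?thesis using that eventually_happens[of _ sequentially] by auto
qed

lemma length_lower_bound:
  fixes m k l N :: nat
  assumes "N = level_length l m k + 1" and "0 < k" and "0 < l"
  shows "m ^ k * 2 ^ (l - 1) \<le> N"
proof -
  obtain k' l' where kl: "k = Suc k'" "l = Suc l'" using assms(2,3) gr0_conv_Suc by auto
  have "m ^ k * 2 ^ (l - 1) \<le> m ^ k * (2 ^ l - 1)"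
    by (intro mult_le_mono2) (simp add: kl)
  also have "\<dots> \<le> level_length l m k" unfolding kl(1) by (rule level_length_lower)
  finally show ?thesis using assms(1) by simp
qed

text \<open>The lower bound m^k * 2^(l - 1) on N is used twice: its first factor yields m^(k *
  \<epsilon>), which beats m and the constants, and its second one yields the exponential of (l - 1)
  * \<open>?x\<close>, which beats the factor l + 1 by exp(y) \<ge> 1 + y.\<close>

lemma size_less_powr:
  fixes m k l N :: nat and \<epsilon> :: real
  assumes N: "N = level_length l m k + 1" and k: "0 < k" and l: "0 < l" and m: "2 \<le> m"
    and \<epsilon>: "0 < \<epsilon>" "\<epsilon> < 1" "1 \<le> real k * \<epsilon>" "4 * real k < 2 powr (real k * \<epsilon> - 1) * (\<epsilon> * ln 2)"
  shows "real ((l + 1) * (k * m + 1)) < real N powr \<epsilon>"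
proof -
  let ?x = "\<epsilon> * ln 2"
  have x: "0 < ?x" "?x < 1"
    using \<epsilon> ln_2_less_1 mult_strict_mono[of \<epsilon> 1 "ln 2" 1] by auto
  have "k * m + 1 \<le> 2 * (k * m)" using k m by (simp add: Suc_le_eq)
  then have "real ((l + 1) * (k * m + 1)) \<le> real ((l + 1) * (2 * (k * m)))"
    by (intro of_nat_mono mult_le_mono2)
  also have "\<dots> = 4 * real k * (real m * ((l + 1) / 2))" by (simp add: algebra_simps)
  also have "\<dots> < (2 powr (real k * \<epsilon> - 1) * ?x) * (real m * ((l + 1) / 2))"
    using \<epsilon>(4) m by (intro mult_strict_right_mono) auto
  also have "\<dots> \<le> (real m powr (real k * \<epsilon> - 1) * ?x) * (real m * ((l + 1) / 2))"
    using \<epsilon>(3) m x by (intro mult_right_mono powr_mono2) auto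
  also have "\<dots> = real m powr (real k * \<epsilon>) * ((l + 1) * ?x / 2)"
    using m by (simp add: powr_diff)
  also have "\<dots> \<le> real m powr (real k * \<epsilon>) * 2 powr (real (l - 1) * \<epsilon>)"
  proof (intro mult_left_mono)
    \<comment> \<open>The difference of the two sides is 1 + (l - 3) * \<open>?x\<close> / 2,
      positive for l \<ge> 1 because \<open>?x\<close> is less than 1.\<close>
    have "(real l + 1) * ?x / 2 \<le> 1 + real (l - 1) * ?x"
    proof -
      have "0 \<le> real (l - 1) * ?x" using x by simp
      then show ?thesis using l x by (simp add: of_nat_diff field_simps)
    qed
    also have "\<dots> \<le> exp (real (l - 1) * ?x)" by (rule exp_ge_add_one_self)
    also have "\<dots> = 2 powr (real (l - 1) * \<epsilon>)" by (simp add: powr_def mult_ac)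
    finally show "real (l + 1) * ?x / 2 \<le> 2 powr (real (l - 1) * \<epsilon>)" by (simp add: add.commute)
  qed simp
  also have "\<dots> = real (m ^ k * 2 ^ (l - 1)) powr \<epsilon>"
    using m by (simp add: powr_mult powr_powr flip: powr_realpow)
  also have "\<dots> \<le> real N powr \<epsilon>"
    using length_lower_bound[OF N k l] \<epsilon> by (intro powr_mono2 of_nat_mono) auto
  finally show ?thesis .
qed

lemma length_upper_bound:
  fixes m k l N :: nat
  assumes N: "N = level_length l m k + 1" and "0 < k" "0 < m" "0 < U" and "2 ^ l \<le> 2 * (k * U)"
  shows "N \<le> 3 * k * 2 ^ k * (m ^ k * U)"
proof -
  have "N \<le> level_length l m k + 2 ^ l" using N by simp
  also have "\<dots> \<le> (2 * m) ^ k * (2 ^ l + 1)" by (rule level_length_upper) (rule assms)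
  also have "\<dots> \<le> (2 * m) ^ k * (3 * (k * U))"
  proof (rule mult_le_mono2)
    have "1 \<le> k * U" using assms by simp
    then show "2 ^ l + 1 \<le> 3 * (k * U)" using assms(5) by linarith
  qed
  finally show ?thesis by (simp add: power_mult_distrib mult_ac)
qed

text \<open>For V = U + m^r one has m^(2r) * U \<le> V^3, whatever the ratio of U to m^r, so V
  bounds the cube root of N up to a constant. The saving N^(-\<eta>) matches the division by m^4,
  and the 1 added in the budget makes up for rounding down.\<close>

lemma powr_le_budget:
  fixes m r U N c :: nat and \<eta> D :: real
  assumes N: "N \<le> 3 * (2 * r) * 2 ^ (2 * r) * (m ^ (2 * r) * U)" "m ^ (2 * r) \<le> N"
    and m: "0 < m" and r: "0 < r" and \<eta>: "0 < \<eta>" "4 \<le> real (2 * r) * \<eta>"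
    and D: "0 \<le> D" "D * (3 * (2 * r) * 2 ^ (2 * r)) \<le> real c"
  shows "D * real N powr (1 / 3 - \<eta>) \<le> real (budget r c m U)"
proof -
  define E where "E = 3 * (2 * r) * 2 ^ (2 * r)"
  let ?V = "U + m ^ r"
  have E: "1 \<le> E"
    using r by (simp add: E_def Suc_le_eq)
  have mN: "1 \<le> m ^ (2 * r)" "1 \<le> N" using m N(2) one_le_power[of m "2 * r"] by linarith+
  have "m ^ (2 * r) = (m ^ r)\<^sup>2" by (simp add: mult.commute flip: power_mult)
  also have "\<dots> \<le> ?V\<^sup>2" by (intro power_mono) auto
  finally have "m ^ (2 * r) * U \<le> ?V\<^sup>2 * ?V" by (intro mult_le_mono) auto
  also have "\<dots> = ?V ^ 3" by (simp add: power2_eq_square power3_eq_cube)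
  finally have "N \<le> E * ?V ^ 3" using N(1) unfolding E_def by (meson le_trans mult_le_mono2)
  then have "real N \<le> real E * real ?V ^ 3" by (metis of_nat_mono of_nat_mult of_nat_power)
  then have "real N powr (1 / 3) \<le> (real E * real ?V ^ 3) powr (1 / 3)" by (intro powr_mono2) auto
  also have "\<dots> = real E powr (1 / 3) * real ?V"
  proof -
    have "0 < real ?V" using m by (simp add: add_nonneg_pos)
    then have "(real ?V ^ 3) powr (1 / 3) = real ?V"
      using powr_realpow[of "real ?V" 3] powr_powr[of "real ?V" 3 "1 / 3"] by simp
    then show ?thesis by (simp only: powr_mult of_nat_0_le_iff zero_le_power)
  qed
  also have "\<dots> \<le> real E powr 1 * real ?V"
    using E by (intro mult_right_mono powr_mono) auto
  finally have 1: "real N powr (1 / 3) \<le> real E * real ?V" using E by simp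
  have "real N powr (- \<eta>) \<le> real (m ^ (2 * r)) powr (- \<eta>)"
    using N(2) mN \<eta> m by (intro powr_mono2') auto
  also have "\<dots> = real m powr (- (real (2 * r) * \<eta>))"
    using m by (simp add: powr_powr flip: powr_realpow)
  also have "\<dots> \<le> real m powr (- 4)"
    using m \<eta>(2) by (intro powr_mono) auto
  also have "\<dots> = 1 / real m ^ 4" using m by (simp add: powr_minus divide_inverse)
  finally have 2: "real N powr (- \<eta>) \<le> 1 / real m ^ 4" .
  have "D * real N powr (1 / 3 - \<eta>) = D * (real N powr (1 / 3) * real N powr (- \<eta>))"
    by (simp flip: powr_add)
  also have "\<dots> \<le> D * ((real E * real ?V) * (1 / real m ^ 4))"
    using D(1) 1 2 by (intro mult_left_mono mult_mono) auto
  also have "\<dots> = (D * real E) * (real ?V / real m ^ 4)" by simp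
  also have "\<dots> \<le> real c * real (?V div m ^ 4 + 1)"
  proof (intro mult_mono)
    show "D * real E \<le> real c" using D(2) by (simp add: E_def)
    have "?V < (?V div m ^ 4 + 1) * m ^ 4"
      using m by (metis add.commute dividend_less_times_div mult.commute mult_Suc plus_1_eq_Suc zero_less_power)
    then have "real ?V \<le> real (?V div m ^ 4 + 1) * real m ^ 4"
      by (metis less_imp_le of_nat_mono of_nat_mult of_nat_power)
    then show "real ?V / real m ^ 4 \<le> real (?V div m ^ 4 + 1)"
      using m by (simp add: pos_divide_le_eq)
  qed auto
  finally show ?thesis by (simp only: budget_def of_nat_mult)
qed

lemma power_of_two_between:
  fixes x :: real
  assumes "1 \<le> x"
  obtains j :: nat where "x \<le> 2 ^ j" and "2 ^ j \<le> 2 * x"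
proof
  let ?j = "nat \<lceil>log 2 x\<rceil>"
  have "0 \<le> log 2 x" using assms by simp
  then have j: "real ?j = of_int \<lceil>log 2 x\<rceil>" by simp
  have x: "x = 2 powr (log 2 x)" using assms by simp
  also have "\<dots> \<le> 2 powr real ?j" unfolding j by (intro powr_mono) auto
  finally show "x \<le> 2 ^ ?j" by (simp add: powr_realpow)
  have "2 powr real ?j \<le> 2 powr (log 2 x + 1)" unfolding j by (intro powr_mono) linarith+
  also have "\<dots> = 2 * x" using assms by (simp add: powr_add)
  finally show "2 ^ ?j \<le> 2 * x" by (simp add: powr_realpow)
qed

text \<open>By the last assumption k is at most m^(k * \<gamma> - 2), and N^(-\<gamma>) is at most
  m^(-k * \<gamma>); together with the factor m the exponents add up to -1.\<close>

lemma error_bound: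
  fixes k m N :: nat and \<gamma> :: real
  assumes "m ^ k \<le> N" and "2 \<le> m" and "0 < k" and "0 < \<gamma>" and "real k \<le> 2 powr (real k * \<gamma> - 2)"
  shows "real (k * m) * real N powr (- \<gamma>) \<le> real m powr (- 1)"
proof -
  have ge: "2 \<le> real k * \<gamma>"
  proof (rule ccontr)
    assume "\<not> 2 \<le> real k * \<gamma>"
    then have "2 powr (real k * \<gamma> - 2) < 2 powr 0" by (intro powr_less_mono) auto
    then show False using assms(3,5) by simp
  qed
  have "real N powr (- \<gamma>) \<le> real (m ^ k) powr (- \<gamma>)"
    using assms(1,2,4) by (intro powr_mono2') auto
  also have "\<dots> = real m powr (- (real k * \<gamma>))"
    using assms(2) by (simp add: powr_powr flip: powr_realpow)
  finally have "real (k * m) * real N powr (- \<gamma>) \<le> real k * real m * real m powr (- (real k * \<gamma>))"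
    by (simp add: mult_left_mono)
  also have "\<dots> \<le> real m powr (real k * \<gamma> - 2) * real m * real m powr (- (real k * \<gamma>))"
  proof (intro mult_right_mono)
    have "real k \<le> 2 powr (real k * \<gamma> - 2)" by fact
    also have "\<dots> \<le> real m powr (real k * \<gamma> - 2)" using ge assms(2) by (intro powr_mono2) auto
    finally show "real k \<le> real m powr (real k * \<gamma> - 2)" .
  qed auto
  also have "\<dots> = real m powr (real k * \<gamma> - 2) * real m powr 1 * real m powr (- (real k * \<gamma>))"
    using assms(2) by simp
  also have "\<dots> = real m powr (- 1)" by (simp only: powr_add[symmetric]) simp
  finally show ?thesis .
qed


text \<open>The budget is O(m^(r - 4)). The number of sizes tried is bounded by a + r * m instead of
  a logarithm, which costs one factor m, and the calls per size cost another. The total O(m^(r - 2))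
  is still below m^(r - 1).\<close>

lemma time_bound:
  fixes k m r c U K t T l :: nat
  defines "T \<equiv> budget r c m U" and "l \<equiv> level_bits k U"
  defines "a \<equiv> c * (K + 2)"
  assumes k: "0 < k" and m: "0 < m" and U: "0 < U" "U \<le> K * m ^ r" and r: "6 \<le> r"
  shows "T < 2 ^ (a + r * m)"
    and "k * m * 7 + l * 5 + (a + r * m) * (k * m * (t * (T + 1) + 2) + 20) + 50 \<le>
      (7 * k + 5 * (2 * k * K + r) + (a + r) * (k * (t * (a + 1) + 2) + 20) + 50) * m ^ (r - 1)"
proof -
  have pos: "1 \<le> m ^ i" for i using m by simp
  have mr: "m ^ r = m ^ (r - 4) * m ^ 4" using r by (simp flip: power_add)
  have "U + m ^ r \<le> (K + 1) * m ^ r" using U(2) by simp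
  then have "U + m ^ r \<le> (K + 1) * m ^ (r - 4) * m ^ 4" unfolding mr by (simp only: mult.assoc)
  then have "(U + m ^ r) div m ^ 4 \<le> ((K + 1) * m ^ (r - 4) * m ^ 4) div m ^ 4"
    by (rule div_le_mono)
  also have "\<dots> = (K + 1) * m ^ (r - 4)" using m by simp
  finally have "(U + m ^ r) div m ^ 4 + 1 \<le> (K + 2) * m ^ (r - 4)" using pos[of "r - 4"] by simp
  then have T: "T \<le> a * m ^ (r - 4)"
    unfolding T_def budget_def a_def mult.assoc by (rule mult_le_mono2)
  have mp: "m ^ i \<le> 2 ^ (r * m)" if "i \<le> r" for i
  proof -
    have "m ^ i \<le> m ^ r" using that m by (intro power_increasing) auto
    also have "\<dots> \<le> (2 ^ m) ^ r" by (intro power_mono) (auto intro: less_imp_le)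
    finally show ?thesis by (simp add: mult.commute flip: power_mult)
  qed
  have "a * m ^ (r - 4) < 2 ^ a * 2 ^ (r * m)"
    by (rule mult_less_le_imp_less) (use m mp[of "r - 4"] pos[of "r - 4"] in auto)
  with T show "T < 2 ^ (a + r * m)" unfolding power_add by (rule le_less_trans)
  have "2 ^ l \<le> 2 * (k * U)" unfolding l_def by (rule level_bits(3)[OF k U(1)])
  also have "\<dots> \<le> 2 * k * K * m ^ r" using U(2) by simp
  also have "\<dots> < 2 ^ (2 * k * K) * 2 ^ (r * m)"
    by (rule mult_less_le_imp_less) (use m mp[of r] pos[of r] in auto)
  finally have "(2::nat) ^ l < 2 ^ (2 * k * K + r * m)" by (simp only: power_add)
  then have l: "l \<le> 2 * k * K + r * m" by (simp only: power_strict_increasing_iff)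
  let ?M = "m ^ (r - 1)"
  have mM: "m \<le> ?M" "1 \<le> ?M"
    using r m power_increasing[of 1 "r - 1" m] pos by auto
  have 1: "k * m * 7 \<le> (7 * k) * ?M" using mM by simp
  have 2: "l * 5 \<le> 5 * (2 * k * K + r) * ?M"
  proof -
    have "2 * k * K \<le> 2 * k * K * ?M" "r * m \<le> r * ?M" using mM by simp_all
    then have "2 * k * K + r * m \<le> (2 * k * K + r) * ?M" by (simp only: distrib_right)
    then have "l * 5 \<le> 5 * ((2 * k * K + r) * ?M)" using l by linarith
    then show ?thesis by (simp only: mult.assoc)
  qed
  have 3: "(a + r * m) * (k * m * (t * (T + 1) + 2) + 20) \<le> (a + r) * (k * (t * (a + 1) + 2) + 20) * ?M"
  proof -
    let ?W = "m ^ (r - 4)"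
    have "T + 1 \<le> (a + 1) * ?W" using T pos[of "r - 4"] by simp
    then have "t * (T + 1) \<le> t * (a + 1) * ?W" unfolding mult.assoc by (rule mult_le_mono2)
    moreover have "2 \<le> 2 * ?W" using pos[of "r - 4"] by simp
    ultimately have "t * (T + 1) + 2 \<le> (t * (a + 1) + 2) * ?W" by (simp only: distrib_right)
    then have "k * m * (t * (T + 1) + 2) \<le> k * m * ((t * (a + 1) + 2) * ?W)" by (rule mult_le_mono2)
    moreover have "20 \<le> 20 * (m * ?W)" using m pos[of "r - 4"] by simp
    moreover have "(k * y + 20) * (m * ?W) = k * m * (y * ?W) + 20 * (m * ?W)" for y
      by (simp add: algebra_simps)
    ultimately have "k * m * (t * (T + 1) + 2) + 20 \<le> (k * (t * (a + 1) + 2) + 20) * (m * ?W)"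
      by (simp only: add_mono)
    moreover have "a + r * m \<le> (a + r) * m" using m by (simp add: distrib_right)
    ultimately have "(a + r * m) * (k * m * (t * (T + 1) + 2) + 20) \<le>
        ((a + r) * m) * ((k * (t * (a + 1) + 2) + 20) * (m * ?W))"
      by (rule mult_le_mono[rotated])
    also have "\<dots> = (a + r) * (k * (t * (a + 1) + 2) + 20) * (m * (m * ?W))" by (simp only: mult_ac)
    also have "m * (m * ?W) = m ^ (r - 2)"
    proof -
      have "r - 2 = Suc (Suc (r - 4))" using r by simp
      then show ?thesis by simp
    qed
    also have "(a + r) * (k * (t * (a + 1) + 2) + 20) * m ^ (r - 2) \<le> (a + r) * (k * (t * (a + 1) + 2) + 20) * ?M"
      using m by (intro mult_le_mono2 power_increasing) auto
    finally show ?thesis .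
  qed
  have 4: "50 \<le> 50 * ?M" using mM by simp
  show "k * m * 7 + l * 5 + (a + r * m) * (k * m * (t * (T + 1) + 2) + 20) + 50 \<le>
      (7 * k + 5 * (2 * k * K + r) + (a + r) * (k * (t * (a + 1) + 2) + 20) + 50) * ?M"
    using add_mono[OF add_mono[OF add_mono[OF 1 2] 3] 4] by (simp only: distrib_right)
qed

text \<open>Since X \<ge> 2, a constant factor d is at most X^d and can be moved into the exponent.
  \<open>E\<close> dominates factor plus exponent in each of the three estimates.\<close>

lemma word_size_bounds:
  fixes m U r c k X E :: nat
  defines "X \<equiv> m + U"
  assumes m: "0 < m" and U: "0 < U" and E: "E = 18 * c + r + 2 * k + 12" and X: "X ^ E \<le> 2 ^ w" and c: "0 < c"
  shows "6 * budget r c m U + 8 < 2 ^ w" and "2 * (k * U) + 2 < 2 ^ w" and "U + m ^ r < 2 ^ w"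
proof -
  have X2: "2 \<le> X" using m U by (simp add: X_def)
  have pos: "1 \<le> X ^ r" using X2 by simp
  have small: "y < 2 ^ w" if "y \<le> d * X ^ i" "d + i \<le> E" for y d i
  proof -
    have "d * X ^ i < 2 ^ d * X ^ i" using X2 by simp
    also have "\<dots> \<le> X ^ d * X ^ i" using X2 by (intro mult_le_mono1 power_mono) auto
    also have "\<dots> \<le> X ^ E" unfolding power_add[symmetric] using that(2) X2 by (intro power_increasing) auto
    finally show ?thesis using that(1) X by linarith
  qed
  have "U \<le> X" by (simp add: X_def)
  also have "X \<le> X ^ (r + 1)" using X2 pos by simp
  finally have U': "U \<le> X ^ (r + 1)" .
  have "m ^ r \<le> X ^ r" by (intro power_mono) (simp_all add: X_def)
  also have "\<dots> \<le> X ^ (r + 1)" using X2 by (intro power_increasing) auto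
  finally have V: "U + m ^ r \<le> 2 * X ^ (r + 1)" using U' by simp
  then show "U + m ^ r < 2 ^ w" by (rule small) (simp add: E)
  have "2 * (k * U) + 2 \<le> (2 * k + 2) * X ^ 1" using X2 mult_le_mono2[of U X k] by (simp add: X_def algebra_simps)
  then show "2 * (k * U) + 2 < 2 ^ w" by (rule small) (simp add: E)
  have p1: "1 \<le> X ^ (r + 1)" using X2 by simp
  have "(U + m ^ r) div m ^ 4 + 1 \<le> U + m ^ r + 1" by simp
  also have "\<dots> \<le> 3 * X ^ (r + 1)" using V p1 by linarith
  finally have "budget r c m U \<le> c * (3 * X ^ (r + 1))" unfolding budget_def by (rule mult_le_mono2)
  then have "6 * budget r c m U + 8 \<le> 18 * (c * X ^ (r + 1)) + 8 * X ^ (r + 1)"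
    using p1 by linarith
  also have "\<dots> = (18 * c + 8) * X ^ (r + 1)" by (simp add: distrib_right)
  finally show "6 * budget r c m U + 8 < 2 ^ w" by (rule small) (simp add: E)
qed

text \<open>Again constant factors become powers of m + U \<ge> 2; the exponents are 3k + 1, k and k
  + 1. So words that are logarithmic in m + U also meet the requirement of the given program, which
  refers to N.\<close>

lemma length_log_bound:
  fixes m U k N :: nat
  assumes N: "N \<le> 3 * k * 2 ^ k * (m ^ k * U)" and m: "0 < m" and U: "0 < U"
  shows "log 2 (real N + 1) \<le> real (5 * k + 2) * log 2 (real (m + U))"
proof -
  let ?X = "m + U"
  have X2: "2 \<le> ?X" using m U by simp
  have "N + 1 \<le> (3 * k + 1) * 2 ^ k * (?X ^ k * ?X)"
  proof -
    have "m ^ k * U \<le> ?X ^ k * ?X" by (intro mult_le_mono power_mono) auto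
    then have "N \<le> 3 * k * 2 ^ k * (?X ^ k * ?X)" using N by (meson le_trans mult_le_mono2)
    then have "N \<le> 3 * k * (2 ^ k * (?X ^ k * ?X))" by (simp only: mult.assoc)
    moreover have "1 \<le> 2 ^ k * (?X ^ k * ?X)" using m by (simp add: Suc_le_eq)
    ultimately have "N + 1 \<le> 3 * k * (2 ^ k * (?X ^ k * ?X)) + 1 * (2 ^ k * (?X ^ k * ?X))" by linarith
    then show ?thesis by (simp only: distrib_right mult.assoc)
  qed
  also have "\<dots> \<le> 2 ^ (3 * k + 1) * 2 ^ k * (?X ^ k * ?X)"
    by (intro mult_le_mono1) (metis less_exp less_imp_le)
  also have "\<dots> \<le> ?X ^ (3 * k + 1) * ?X ^ k * (?X ^ k * ?X)"
    by (intro mult_le_mono power_mono X2 order_refl) auto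
  also have "\<dots> = ?X ^ (5 * k + 2)"
    by (simp flip: power_add power_Suc2)
  finally have "real N + 1 \<le> real ?X ^ (5 * k + 2)"
    by (metis of_nat_1 of_nat_add of_nat_mono of_nat_power)
  then have "log 2 (real N + 1) \<le> log 2 (real ?X ^ (5 * k + 2))"
    by (intro log_mono) auto
  also have "\<dots> = real (5 * k + 2) * log 2 (real ?X)"
    by (rule log_nat_power) (use m in simp)
  finally show ?thesis .
qed

section \<open>From fast inner products to fast kSUM\<close>

lemma solves_ksum_reduction:
  fixes \<epsilon> \<delta> :: real
  assumes \<epsilon>: "0 < \<epsilon>" "\<epsilon> < 1 / 3" and \<Sigma>: "{0, 1} \<subseteq> \<Sigma>" and \<delta>: "0 < \<delta>"
    and P: "solves_slp_inner_prod P \<Sigma> 1 2 \<epsilon> (1 / 3 - \<delta>)"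
  shows "\<exists>r\<ge>6. \<exists>Q. solves_ksum Q (2 * r) (real r - 1)"
proof -
  obtain c0 \<gamma> C0 where \<gamma>: "0 < \<gamma>" and H: "\<And>N n S S' w. slp \<Sigma> S \<Longrightarrow> slp \<Sigma> S' \<Longrightarrow>
        length S = n \<Longrightarrow> length S' = n \<Longrightarrow>
        length (slp_string S) = N \<Longrightarrow> length (slp_string S') = N \<Longrightarrow>
        1 * real N powr \<epsilon> \<le> real n \<Longrightarrow> real n \<le> 2 * real N powr \<epsilon> \<Longrightarrow>
        real w \<ge> c0 * log 2 (real N + 1) \<Longrightarrow>
        output_prob w P (slp_pair_input S S') (nat \<lfloor>C0 * real N powr (1 / 3 - \<delta>)\<rfloor>)
            (inner_prod (slp_string S) (slp_string S')) \<ge> 1 - real N powr (- \<gamma>)"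
    using P unfolding solves_slp_inner_prod_def by blast
  \<comment> \<open>Both the running time, of order N^(1/3 - \<delta>), and the size, of order
    N^\<epsilon>, must stay within a budget of order N^(1/3 - \<eta>).\<close>
  define \<eta> where "\<eta> = min \<delta> (1 / 3 - \<epsilon>)"
  have \<eta>: "0 < \<eta>" "\<eta> \<le> \<delta>" "\<epsilon> \<le> 1 / 3 - \<eta>" using \<epsilon> \<delta> by (auto simp: \<eta>_def)
  obtain r :: nat where r: "6 \<le> r" "4 \<le> real (2 * r) * \<eta>" "1 \<le> real (2 * r) * \<epsilon>"
    "real (2 * r) \<le> 2 powr (real (2 * r) * \<gamma> - 2)"
    "4 * real (2 * r) < 2 powr (real (2 * r) * \<epsilon> - 1) * (\<epsilon> * ln 2)"
    using parameters_exist[OF \<epsilon>(1) \<gamma> \<eta>(1)] by blast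
  define k where "k = 2 * r"
  note r = r[folded k_def]
  have k: "0 < k" using r(1) by (simp add: k_def)
  \<comment> \<open>\<open>C0\<close> accounts for the running time and 2 for the size, which is at
    most 2 * N^\<epsilon>. The maximum is positive even if \<open>C0\<close> is not.\<close>
  define D where "D = max C0 2"
  define c where "c = nat \<lceil>D * real (3 * k * 2 ^ k)\<rceil>"
  have D: "2 \<le> D" "C0 \<le> D" by (auto simp: D_def)
  have cD: "D * real (3 * k * 2 ^ k) \<le> real c" unfolding c_def by linarith
  have "0 < D * real (3 * k * 2 ^ k)" using D k by simp
  then have c: "0 < c" using cD by linarith
  define B where "B = Suc (com_bound P)"
  define E where "E = 18 * c + r + 2 * k + 12"
  \<comment> \<open>The first entry serves the arithmetic of the reduction, the second the word size
    required by \<open>P\<close>, where \<open>c0\<close> may be negative.\<close>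
  define cw where "cw = max (real E) (max c0 0 * real (5 * k + 2))"
  \<comment> \<open>The program is fixed before \<open>K\<close>, which occurs only in the running
    time.\<close>
  have main: "output_prob w (reduction B k r c P) (ksum_input m U As)
      (k * m * 7 + level_bits k U * 5 + (c * (K + 2) + r * m) * (k * m * (step_time B P (budget r c m U) + 2) + 20) + 50)
      (of_bool (ksum_solvable k As)) \<ge> 1 - real m powr (- 1)"
    if m: "2 \<le> m" and U: "0 < U" "U \<le> K * m ^ r" and inst: "ksum_instance k m U As"
      and w: "real w \<ge> cw * log 2 (real (m + U))" for m U K w As
  proof -
    define l where "l = level_bits k U"
    define sz where "sz = (l + 1) * (k * m + 1)"
    define T where "T = budget r c m U"
    define N where "N = level_length l m k + 1"
    note lb = level_bits[OF k U(1), folded l_def]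
    have m0: "0 < m" using m by simp
    have logX: "0 < log 2 (real (m + U))" using m by simp
    have "real E * log 2 (real (m + U)) \<le> cw * log 2 (real (m + U))"
      using logX by (intro mult_right_mono) (auto simp: cw_def)
    then have "real E * log 2 (real (m + U)) \<le> real w" using w by (rule order_trans)
    moreover have "0 < real (m + U)" using m by simp
    ultimately have "log 2 (real (m + U) ^ E) \<le> real w" by (simp only: log_nat_power)
    then have "real (m + U) ^ E \<le> 2 powr real w" using m by (subst (asm) log_le_iff) auto
    then have XE: "(m + U) ^ E \<le> 2 ^ w"
      by (simp add: powr_realpow) (metis of_nat_add of_nat_le_iff of_nat_numeral of_nat_power)
    note ws = word_size_bounds[OF m0 U(1) E_def XE c]
    have Nu: "N \<le> 3 * k * 2 ^ k * (m ^ k * U)"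
      by (rule length_upper_bound[OF N_def k m0 U(1) lb(3)])
    have "m ^ k * 1 \<le> m ^ k * 2 ^ (l - 1)" by (intro mult_le_mono2) simp
    then have Nl: "m ^ k \<le> N" using length_lower_bound[OF N_def k lb(2)] by linarith
    have "1 \<le> m ^ k" using m0 by simp
    then have N1: "1 \<le> real N" using Nl by linarith
    have "c0 * log 2 (real N + 1) \<le> max c0 0 * log 2 (real N + 1)"
      by (intro mult_right_mono) auto
    also have "\<dots> \<le> max c0 0 * (real (5 * k + 2) * log 2 (real (m + U)))"
      by (intro mult_left_mono length_log_bound[OF Nu m0 U(1)]) auto
    also have "\<dots> = (max c0 0 * real (5 * k + 2)) * log 2 (real (m + U))" by (simp only: mult.assoc)
    also have "\<dots> \<le> cw * log 2 (real (m + U))"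
      using logX by (intro mult_right_mono) (auto simp: cw_def)
    also have "\<dots> \<le> real w" by (rule w)
    finally have wN: "c0 * log 2 (real N + 1) \<le> real w" .
    have budget: "D * real N powr (1 / 3 - \<eta>) \<le> real T"
      unfolding T_def using Nu Nl m0 r(1,2) \<eta>(1) D cD
      by (intro powr_le_budget[where r = r, folded k_def]) auto
    have "real N powr \<epsilon> \<ge> 1" using N1 \<epsilon> by (intro ge_one_powr_ge_zero) auto
    \<comment> \<open>This is the round whose size lies in the window for which \<open>P\<close>
      makes a promise.\<close>
    then obtain j where j: "real N powr \<epsilon> \<le> 2 ^ j" "2 ^ j \<le> 2 * real N powr \<epsilon>"
      by (rule power_of_two_between)
    have "real sz < 2 ^ j"
      using size_less_powr[OF N_def k lb(2) m \<epsilon>(1) _ r(3,5)] \<epsilon> j(1) unfolding sz_def by linarith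
    then have szj: "sz < 2 ^ j" by (metis of_nat_less_iff of_nat_numeral of_nat_power)
    have "2 * real N powr \<epsilon> \<le> D * real N powr (1 / 3 - \<eta>)"
      using D N1 \<eta>(3) by (intro mult_mono powr_mono) auto
    then have "2 ^ j \<le> real T" using j(2) budget by linarith
    then have jT: "2 ^ j \<le> T" by (metis of_nat_le_iff of_nat_numeral of_nat_power)
    have rel: "reliable w T l m sz P (2 ^ j) (real N powr (- \<gamma>))"
      unfolding reliable_def
    proof (intro exI conjI allI)
      have "C0 * real N powr (1 / 3 - \<delta>) \<le> D * real N powr (1 / 3 - \<eta>)"
        using D N1 \<eta>(2) by (intro mult_mono powr_mono) auto
      then have "C0 * real N powr (1 / 3 - \<delta>) \<le> real T" using budget by linarith
      then show "nat \<lfloor>C0 * real N powr (1 / 3 - \<delta>)\<rfloor> \<le> T" by linarith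
      fix sh sh'
      show "1 - real N powr (- \<gamma>) \<le> output_prob w P
         (slp_pair_input (level_slp l m sz (2 ^ j) sh) (level_slp l m sz (2 ^ j) sh'))
         (nat \<lfloor>C0 * real N powr (1 / 3 - \<delta>)\<rfloor>)
         (inner_prod (slp_string (level_slp l m sz (2 ^ j) sh)) (slp_string (level_slp l m sz (2 ^ j) sh')))"
        by (rule H[OF slp_level_slp[OF lb(2) m0 k sz_def szj \<Sigma>] slp_level_slp[OF lb(2) m0 k sz_def szj \<Sigma>]])
          (use j wN slp_string_level_slp[OF lb(2) m0 k sz_def szj] in \<open>auto simp: N_def\<close>)
    qed
    have "1 - real (k * m) * real N powr (- \<gamma>) \<le> output_prob w (reduction B k r c P) (ksum_input m U As)
      (k * m * 7 + l * 5 + (c * (K + 2) + r * m) * (k * m * (step_time B P T + 2) + 20) + 50)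
      (of_bool (ksum_solvable k As))"
    proof (rule output_prob_runs[OF _ order_refl])
      have G: "T < 2 ^ (c * (K + 2) + r * m)"
        unfolding T_def by (rule time_bound(1)[OF k m0 U r(1)])
      have "0 < B" "4 \<le> r" "com_bound P \<le> B" "0 \<le> real N powr (- \<gamma>)"
        using r(1) by (auto simp: B_def)
      then show "runs w (k * m * 7 + l * 5 + (c * (K + 2) + r * m) * (k * m * (step_time B P T + 2) + 20) + 50)
          (real (k * m) * real N powr (- \<gamma>)) (reduction B k r c P) (init_state w (ksum_input m U As))
          (\<lambda>s. vars s 0 = of_bool (ksum_solvable k As))"
        using runs_reduction[where r = r and c = c and w = w and ?j0.0 = j and e = "real N powr (- \<gamma>)",
            OF inst _ k m0 _ c, folded l_def T_def, folded sz_def] ws szj jT rel G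
        by (simp only: T_def[symmetric])
    qed
    moreover have "real (k * m) * real N powr (- \<gamma>) \<le> real m powr (- 1)"
      by (rule error_bound[OF Nl m k \<gamma> r(4)])
    ultimately show ?thesis unfolding l_def T_def by linarith
  qed
  have "solves_ksum (reduction B k r c P) (2 * r) (real r - 1)"
    unfolding solves_ksum_def
  proof (rule exI[of _ cw], rule exI[of _ 1], intro conjI allI)
    fix K :: real
    define K' where "K' = nat \<lceil>K\<rceil>"
    define a where "a = c * (K' + 2)"
    define t where "t = weight P + 4 * B + 400"
    define Ct where "Ct = 7 * k + 5 * (2 * k * K' + r) + (a + r) * (k * (t * (a + 1) + 2) + 20) + 50"
    show "\<exists>C. \<forall>m U As w. 1 \<le> m \<longrightarrow> real U \<le> K * real m powr real_of_int \<lceil>real (2 * r) / 2\<rceil> \<longrightarrow>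
        ksum_instance (2 * r) m U As \<longrightarrow> cw * log 2 (real (m + U)) \<le> real w \<longrightarrow>
        1 - real m powr - 1 \<le> output_prob w (reduction B k r c P) (ksum_input m U As)
          (nat \<lfloor>C * real m powr (real r - 1)\<rfloor>) (of_bool (ksum_solvable (2 * r) As))"
    proof (intro exI[of _ "real Ct"] allI impI)
      fix m U :: nat and As :: "int list list" and w :: nat
      assume m1: "1 \<le> m" and UK: "real U \<le> K * real m powr real_of_int \<lceil>real (2 * r) / 2\<rceil>"
        and inst: "ksum_instance (2 * r) m U As" and w: "cw * log 2 (real (m + U)) \<le> real w"
      show "1 - real m powr - 1 \<le> output_prob w (reduction B k r c P) (ksum_input m U As)
          (nat \<lfloor>real Ct * real m powr (real r - 1)\<rfloor>) (of_bool (ksum_solvable (2 * r) As))"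
      proof (cases "m = 1")
        \<comment> \<open>For \<open>m = 1\<close> the required probability is 1 - 1 = 0.\<close>
        case True
        then show ?thesis by (simp add: output_prob_def)
      next
        case False
        then have m: "2 \<le> m" using m1 by simp
        have "real U \<le> K * real m ^ r" using UK m1 by (simp add: powr_realpow)
        also have "\<dots> \<le> real K' * real m ^ r" unfolding K'_def by (intro mult_right_mono) (linarith, simp)
        finally have U: "U \<le> K' * m ^ r" by (metis of_nat_le_iff of_nat_mult of_nat_power)
        have "As \<noteq> []" using inst r(1) by (auto simp: ksum_instance_def)
        then have As0: "length (hd As) = m" "set (hd As) \<subseteq> {1..int U}"
          using inst hd_in_set[of As] by (auto simp: ksum_instance_def)
        have "hd As \<noteq> []" using As0(1) m by auto
        then have "hd (hd As) \<in> {1..int U}" using As0(2) hd_in_set by blast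
        then have U0: "0 < U" by auto
        let ?t = "k * m * 7 + level_bits k U * 5 +
            (c * (K' + 2) + r * m) * (k * m * (step_time B P (budget r c m U) + 2) + 20) + 50"
        have "?t \<le> Ct * m ^ (r - 1)"
          using time_bound(2)[OF k _ U0 U r(1), where c = c and t = t] m
          unfolding Ct_def a_def t_def step_time_def by simp
        moreover have "real Ct * real m powr (real r - 1) = real (Ct * m ^ (r - 1))"
          using m r(1) by (simp add: of_nat_diff flip: powr_realpow)
        ultimately have t: "?t \<le> nat \<lfloor>real Ct * real m powr (real r - 1)\<rfloor>"
          by (simp only: floor_of_nat nat_int)
        have "1 - real m powr (- 1) \<le> output_prob w (reduction B k r c P) (ksum_input m U As) ?t
            (of_bool (ksum_solvable k As))"
          by (rule main[OF m U0 U]) (use inst w in \<open>auto simp: k_def\<close>)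
        also have "\<dots> \<le> output_prob w (reduction B k r c P) (ksum_input m U As)
          (nat \<lfloor>real Ct * real m powr (real r - 1)\<rfloor>) (of_bool (ksum_solvable k As))"
          unfolding output_prob_def ewp_eq_prob[symmetric]
          by (rule ewp_mono_time[where g = "\<lambda>s. of_bool (vars s 0 = of_bool (ksum_solvable k As))"]) (use t in auto)
        finally show ?thesis by (simp add: k_def)
      qed
    qed
  qed simp
  then show ?thesis using r(1) by blast
qed

theorem theorem4:
  fixes \<epsilon> :: real and \<Sigma> :: "int set"
  assumes "0 < \<epsilon>" and "\<epsilon> < 1 / 3"
    and "finite \<Sigma>" and "{0, 1} \<subseteq> \<Sigma>"
    and "strong_ksum_conjecture"
  shows "\<exists>\<alpha> \<beta>. 0 < \<alpha> \<and> \<alpha> \<le> \<beta> \<and>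
    (\<forall>\<delta>>0. \<not> (\<exists>P. solves_slp_inner_prod P \<Sigma> \<alpha> \<beta> \<epsilon> (1 / 3 - \<delta>)))"
\<comment> \<open>Every interval from x to 2 * x with x \<ge> 1 contains a power of two, and only
  powers of two are tried as sizes; hence the constants 1 and 2.\<close>
proof (rule exI[of _ 1], rule exI[of _ 2], intro conjI allI impI notI)
  fix \<delta> :: real
  assume "0 < \<delta>" and "\<exists>P. solves_slp_inner_prod P \<Sigma> 1 2 \<epsilon> (1 / 3 - \<delta>)"
  then obtain r Q where r: "6 \<le> r" and Q: "solves_ksum Q (2 * r) (real r - 1)"
    using solves_ksum_reduction[OF assms(1,2,4)] by blast
  have "real_of_int \<lceil>real (2 * r) / 2\<rceil> - 1 = real r - 1" by simp
  \<comment> \<open>The saving is a full factor m, so the conjecture is applied with \<epsilon>' =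
    1.\<close>
  with assms(5)[unfolded strong_ksum_conjecture_def, rule_format, of "2 * r" 1] r Q show False
    by auto
qed simp_all

end
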